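(* An oriented maximal surface with harmonic Gauss map in the Minkowski space $\mathbb E^4_1$ is either an open part of a space-like plane or congruent to a surface given by $$x(u,v)=(\phi(u,v),u,v,\phi(u,v))$$ for a smooth harmonic function $\phi:\Omega\subset\mathbb R^2\to\mathbb R$, where $\Omega$ is an open set in $\mathbb R^2$.
   Context: $\mathbb E^4_1$ is $\mathbb R^4$ with the metric $-dx_1^2+dx_2^2+dx_3^2+dx_4^2$. A surface $M$ in $\mathbb E^4_1$ (in particular a plane) is space-like if every nonzero tangent vector $v$ satisfies $\langle v,v\rangle>0$. Let $\widetilde\nabla$ and $\nabla$ be the Levi-Civita connections of $\mathbb E^4_1$ and $M$. The second fundamental form $h$ is defined by $\widetilde\nabla_XY=\nabla_XY+h(X,Y)$ for $X,Y$ tangent, and the mean curvature vector is $H=\frac12(h(e_1,e_1)+h(e_2,e_2))$ for an orthonormal tangent frame $\{e_1,e_2\}$. A maximal surface is a space-like surface with $H=0$. The Gauss map is $\nu=e_3\wedge e_4:M\to\bigwedge^2\mathbb E^4_1$, where $\{e_1,e_2,e_3,e_4\}$ is an oriented local orthonormal frame with $e_1,e_2$ tangent and $e_3,e_4$ normal to $M$; $\bigwedge^2\mathbb E^4_1$ is identified with a pseudo-Euclidean space via $\langle f_1\wedge f_2,g_1\wedge g_2\rangle=\det(\langle f_i,g_j\rangle)$. The Laplacian $\Delta=\sum_{i=1}^2(\nabla_{e_i}e_i-e_ie_i)$ of $M$ acts componentwise on $\nu$, and $\nu$ is harmonic if $\Delta\nu=0$. Congruent means related by an isometry of $\mathbb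 E^4_1$.
   Formalization: The surface is taken to be connected, and "given by x(u,v)" is local: one isometry serves the whole surface, but Ω and φ are chosen near each point; a single global graph fails for (t, e^s cos t, e^s sin t, t). *)

theory Defs
  imports "HOL-Analysis.Analysis"
begin

section \<open>Smooth maps on open subsets of Euclidean spaces\<close>

abbreviation dd :: "('a::real_normed_vector \<Rightarrow> 'b::real_normed_vector) \<Rightarrow> 'a \<Rightarrow> 'a \<Rightarrow> 'b" where
  "dd f p a \<equiv> frechet_derivative f (at p) a"

text \<open>The following two notions are meant for open sets \<open>S\<close> only.\<close>

primrec Ck_on :: "nat \<Rightarrow> 'a::euclidean_space set \<Rightarrow> ('a \<Rightarrow> 'b::real_normed_vector) \<Rightarrow> bool" where
  "Ck_on 0 S f \<longleftrightarrow> continuous_on S f"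
| "Ck_on (Suc k) S f \<longleftrightarrow> f differentiable_on S \<and> (\<forall>b\<in>Basis. Ck_on k S (\<lambda>p. dd f p b))"

definition smooth_on :: "'a::euclidean_space set \<Rightarrow> ('a \<Rightarrow> 'b::real_normed_vector) \<Rightarrow> bool" where
  "smooth_on S f \<longleftrightarrow> (\<forall>k. Ck_on k S f)"

definition harmonic_function_on :: "(real^2) set \<Rightarrow> (real^2 \<Rightarrow> real) \<Rightarrow> bool" where
  "harmonic_function_on S \<phi> \<longleftrightarrow>
     (\<forall>w\<in>S. dd (\<lambda>z. dd \<phi> z (axis 1 1)) w (axis 1 1) + dd (\<lambda>z. dd \<phi> z (axis 2 1)) w (axis 2 1) = 0)"

section \<open>Minkowski space\<close>

definition mink :: "real^4 \<Rightarrow> real^4 \<Rightarrow> real" where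
  "mink v w = - (v$1 * w$1) + v$2 * w$2 + v$3 * w$3 + v$4 * w$4"

definition minkowski_isometry :: "(real^4 \<Rightarrow> real^4) \<Rightarrow> bool" where
  "minkowski_isometry F \<longleftrightarrow>
     (\<exists>L b. linear L \<and> (\<forall>v w. mink (L v) (L w) = mink v w) \<and> (\<forall>x. F x = L x + b))"

definition spacelike_plane :: "(real^4) set \<Rightarrow> bool" where
  "spacelike_plane P \<longleftrightarrow>
     (\<exists>c V. subspace V \<and> dim V = 2 \<and> (\<forall>v\<in>V. v \<noteq> 0 \<longrightarrow> mink v v > 0) \<and> P = (\<lambda>v. c + v) ` V)"

text \<open>The space of bivectors is realised as the space of antisymmetric \<open>4 \<times> 4\<close> matrices; since the
  Laplacian acts componentwise, only the linear structure of this space is needed.\<close>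

definition wedge :: "real^4 \<Rightarrow> real^4 \<Rightarrow> real^4^4" where
  "wedge v w = (\<chi> i j. v$i * w$j - v$j * w$i)"

text \<open>In the index type \<open>4\<close> the numeral \<open>4\<close> is \<open>0\<close>; \<open>vector\<close> still puts the last entry there.\<close>

lemma vector_4:
  "(vector [a, b, c, d] :: 'a::zero^4)$1 = a"
  "(vector [a, b, c, d] :: 'a::zero^4)$2 = b"
  "(vector [a, b, c, d] :: 'a::zero^4)$3 = c"
  "(vector [a, b, c, d] :: 'a::zero^4)$4 = d"
  by (simp_all add: vector_def)

section \<open>Oriented surfaces\<close>

text \<open>An abstract smooth surface is a topological space \<open>M\<close> together with an atlas, i.e. a set \<open>A\<close> of
  pairs \<open>(D, p)\<close>, where \<open>D\<close> is an open subset of the plane and \<open>p\<close> (an inverse chart) is a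
  homeomorphism of \<open>D\<close> onto an open subset of \<open>M\<close>. It is oriented by requiring all
  transition maps to have positive Jacobian determinant.\<close>

type_synonym 'm atlas = "((real^2) set \<times> (real^2 \<Rightarrow> 'm)) set"

definition oriented_surface :: "'m topology \<Rightarrow> 'm atlas \<Rightarrow> bool" where
  "oriented_surface M A \<longleftrightarrow>
     Hausdorff_space M \<and> second_countable M \<and>
     (\<forall>(D, p)\<in>A. open D \<and> openin M (p ` D) \<and>
        homeomorphic_map (top_of_set D) (subtopology M (p ` D)) p) \<and>
     (\<Union>(D, p)\<in>A. p ` D) = topspace M \<and>
     (\<forall>(D, p)\<in>A. \<forall>(D', p')\<in>A.
        let S = {w\<in>D. p w \<in> p' ` D'}; \<tau> = (\<lambda>w. inv_into D' p' (p w)) in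
          smooth_on S \<tau> \<and> (\<forall>w\<in>S. det (matrix (frechet_derivative \<tau> (at w))) > 0))"

section \<open>Geometry of a parametrized surface\<close>

text \<open>In this section \<open>X\<close> is a parametrization, defined near \<open>w\<close>. Tangent vectors (and tangent vector
  fields) are given by their coordinates \<open>a\<close>, standing for \<open>dX(a)\<close>.\<close>

definition induced_metric :: "(real^2 \<Rightarrow> real^4) \<Rightarrow> real^2 \<Rightarrow> real^2 \<Rightarrow> real^2 \<Rightarrow> real" where
  "induced_metric X w a b = mink (dd X w a) (dd X w b)"

text \<open>The Levi-Civita connection of the induced metric, by the Koszul formula for the constant
  (hence commuting) coordinate fields \<open>a\<close>, \<open>b\<close>, \<open>k\<close>.\<close>

definition christoffel :: "(real^2 \<Rightarrow> real^4) \<Rightarrow> real^2 \<Rightarrow> real^2 \<Rightarrow> real^2 \<Rightarrow> real^2" where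
  "christoffel X w a b = (THE c. \<forall>k. induced_metric X w c k =
     (dd (\<lambda>z. induced_metric X z b k) w a + dd (\<lambda>z. induced_metric X z a k) w b - dd (\<lambda>z. induced_metric X z a b) w k) / 2)"

definition levi_civita ::
  "(real^2 \<Rightarrow> real^4) \<Rightarrow> (real^2 \<Rightarrow> real^2) \<Rightarrow> (real^2 \<Rightarrow> real^2) \<Rightarrow> real^2 \<Rightarrow> real^2" where
  "levi_civita X E F w = dd F w (E w) + christoffel X w (E w) (F w)"

definition second_fundamental_form ::
  "(real^2 \<Rightarrow> real^4) \<Rightarrow> (real^2 \<Rightarrow> real^2) \<Rightarrow> (real^2 \<Rightarrow> real^2) \<Rightarrow> real^2 \<Rightarrow> real^4" where
  "second_fundamental_form X E F w =
     dd (\<lambda>z. dd X z (F z)) w (E w) - dd X w (levi_civita X E F w)"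

definition orthonormal_frame_on ::
  "(real^2 \<Rightarrow> real^4) \<Rightarrow> (real^2) set \<Rightarrow> (real^2 \<Rightarrow> real^2) \<Rightarrow> (real^2 \<Rightarrow> real^2) \<Rightarrow> bool" where
  "orthonormal_frame_on X U E1 E2 \<longleftrightarrow> smooth_on U E1 \<and> smooth_on U E2 \<and>
     (\<forall>w\<in>U. induced_metric X w (E1 w) (E1 w) = 1 \<and> induced_metric X w (E2 w) (E2 w) = 1 \<and>
             induced_metric X w (E1 w) (E2 w) = 0)"

definition mean_curvature ::
  "(real^2 \<Rightarrow> real^4) \<Rightarrow> (real^2 \<Rightarrow> real^2) \<Rightarrow> (real^2 \<Rightarrow> real^2) \<Rightarrow> real^2 \<Rightarrow> real^4" where
  "mean_curvature X E1 E2 w =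
     (1/2) *\<^sub>R (second_fundamental_form X E1 E1 w + second_fundamental_form X E2 E2 w)"

definition laplacian ::
  "(real^2 \<Rightarrow> real^4) \<Rightarrow> (real^2 \<Rightarrow> real^2) \<Rightarrow> (real^2 \<Rightarrow> real^2)
     \<Rightarrow> (real^2 \<Rightarrow> 'b::real_normed_vector) \<Rightarrow> real^2 \<Rightarrow> 'b" where
  "laplacian X E1 E2 \<psi> w =
     (\<Sum>E\<leftarrow>[E1, E2]. dd \<psi> w (levi_civita X E E w) - dd (\<lambda>z. dd \<psi> z (E z)) w (E w))"

text \<open>Being orthogonal to \<open>e1\<close> and \<open>e2\<close>, which span the tangent plane, \<open>e3\<close> and \<open>e4\<close> are normal.\<close>

definition adapted_frame ::
  "(real^2 \<Rightarrow> real^4) \<Rightarrow> real^2 \<Rightarrow> real^4 \<Rightarrow> real^4 \<Rightarrow> real^4 \<Rightarrow> real^4 \<Rightarrow> bool" where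
  "adapted_frame X w e1 e2 e3 e4 \<longleftrightarrow>
     (\<exists>a b. e1 = dd X w a \<and> e2 = dd X w b \<and> det (vector [a, b] :: real^2^2) > 0) \<and>
     (\<forall>e\<in>{e1, e2, e3, e4}. \<bar>mink e e\<bar> = 1) \<and>
     mink e1 e2 = 0 \<and> mink e1 e3 = 0 \<and> mink e1 e4 = 0 \<and>
     mink e2 e3 = 0 \<and> mink e2 e4 = 0 \<and> mink e3 e4 = 0 \<and>
     det (vector [e1, e2, e3, e4] :: real^4^4) > 0"

section \<open>Surfaces in Minkowski space\<close>

text \<open>Here \<open>f\<close> maps an oriented surface with atlas \<open>A\<close> to Minkowski space.\<close>

definition spacelike_immersion :: "'m atlas \<Rightarrow> ('m \<Rightarrow> real^4) \<Rightarrow> bool" where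
  "spacelike_immersion A f \<longleftrightarrow>
     (\<forall>(D, p)\<in>A. smooth_on D (f \<circ> p) \<and> (\<forall>w\<in>D. \<forall>a. a \<noteq> 0 \<longrightarrow> induced_metric (f \<circ> p) w a a > 0))"

text \<open>Neither the mean curvature vector nor the Laplacian depends on the frame, and every point has
  a local orthonormal frame; so the next definition and that of \<open>harmonic_map\<close> quantify over all
  local orthonormal frames.\<close>

definition maximal_surface :: "'m atlas \<Rightarrow> ('m \<Rightarrow> real^4) \<Rightarrow> bool" where
  "maximal_surface A f \<longleftrightarrow> spacelike_immersion A f \<and>
     (\<forall>(D, p)\<in>A. \<forall>U E1 E2. open U \<and> U \<subseteq> D \<and> orthonormal_frame_on (f \<circ> p) U E1 E2 \<longrightarrow>
        (\<forall>w\<in>U. mean_curvature (f \<circ> p) E1 E2 w = 0))"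

definition harmonic_map ::
  "'m atlas \<Rightarrow> ('m \<Rightarrow> real^4) \<Rightarrow> ('m \<Rightarrow> 'b::real_normed_vector) \<Rightarrow> bool" where
  "harmonic_map A f \<nu> \<longleftrightarrow>
     (\<forall>(D, p)\<in>A. \<forall>U E1 E2. open U \<and> U \<subseteq> D \<and> orthonormal_frame_on (f \<circ> p) U E1 E2 \<longrightarrow>
        (\<forall>w\<in>U. laplacian (f \<circ> p) E1 E2 (\<nu> \<circ> p) w = 0))"

text \<open>The bivector \<open>e3 \<and> e4\<close> depends neither on the adapted frame nor on the chart.\<close>

definition gauss_map :: "'m atlas \<Rightarrow> ('m \<Rightarrow> real^4) \<Rightarrow> 'm \<Rightarrow> real^4^4" where
  "gauss_map A f q = (THE n. \<exists>D p w e1 e2 e3 e4. (D, p) \<in> A \<and> w \<in> D \<and> p w = q \<and>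
     adapted_frame (f \<circ> p) w e1 e2 e3 e4 \<and> n = wedge e3 e4)"

definition graph_surface :: "(real^2 \<Rightarrow> real) \<Rightarrow> real^2 \<Rightarrow> real^4" where
  "graph_surface \<phi> w = vector [\<phi> w, w$1, w$2, \<phi> w]"

end

theory Submission
  imports Defs "HOL-Complex_Analysis.Conformal_Mappings"
begin

text \<open>In an orthonormal frame, \<open>H = 0\<close> and harmonicity of the Gauss map force the second fundamental form
  to take values in null vectors that are mutually orthogonal, so that its image spans at most one
  null line \<open>\<real>\<eta>\<close> of the normal plane. Where it does not vanish, \<open>\<eta>\<close> has constant direction, since its
  derivative is normal and orthogonal to \<open>\<eta>\<close>; where it vanishes on an open set, the normal plane is
  constant there. In both cases some constant null vector \<open>l \<noteq> 0\<close> is normal to the surface along an open set,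
  i.e. the function \<open>\<langle>x, l\<rangle>\<close> is constant there. As \<open>H = 0\<close>, this function is harmonic, hence real
  analytic in isothermal coordinates, and so it is constant on the whole connected surface. After an
  isometry \<open>l = (1, 0, 0, 1)\<close>, and then \<open>x\<^sub>1 = x\<^sub>4\<close> up to a translation. The projection to \<open>(x\<^sub>2, x\<^sub>3)\<close> is
  now a local isometry onto the Euclidean plane, in which \<open>x\<^sub>4\<close> is harmonic. In particular the second
  alternative always holds: a space-like plane is locally such a graph as well.\<close>

section \<open>Calculus of smooth maps\<close>

text \<open>The Gauss map is e3 \<and> e4, yet no normal frame is ever differentiated: the Hodge
  star is a constant linear map, so it turns the equation into one for e1 \<and> e2, whose
  derivatives are those of the immersion. The obstacle is the indefinite normal metric. With
  \<alpha> = h(e1, e1) and \<beta> = h(e1, e2), the component of the equation along e1 \<and> e2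
  says only that the squared lengths of \<alpha> and \<beta> add up to zero; the component along
  \<alpha> \<and> \<beta> adds that their Gram determinant vanishes, and the two together become a
  sum of two real squares. The normal plane contains two null lines, and across zeros of h the image
  could a priori pass from one to the other. Hence the null vector is found on one small ball only,
  and what is propagated is the constancy of one height function. The isothermal coordinates for
  this come from the surface itself: every \<langle>x, c\<rangle> is harmonic, and for c = e1(w) it
  has nonzero differential at w.\<close>

lemma dd_cong:
  assumes "open S" "x \<in> S" "\<And>y. y \<in> S \<Longrightarrow> f y = g y"
  shows "dd f x = dd g x"
proof -
  \<comment> \<open>Agreement for every F also covers points without a derivative: \<open>dd\<close>
    then chooses from the same candidates for f and g.\<close>
  have "(f has_derivative F) (at x) \<longleftrightarrow> (g has_derivative F) (at x)" for F
    using has_derivative_transform_within_open[OF _ assms(1,2), of f F UNIV g]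
      has_derivative_transform_within_open[OF _ assms(1,2), of g F UNIV f] assms(3)
    by auto
  then show ?thesis unfolding frechet_derivative_def by simp
qed

lemma dd_eqI: "(f has_derivative F) (at x) \<Longrightarrow> dd f x = F"
  using frechet_derivative_at by metis

lemma Ck_on_cong:
  assumes "open S" "\<And>x. x \<in> S \<Longrightarrow> f x = g x" "Ck_on k S f"
  shows "Ck_on k S g"
  using assms(2,3)
proof (induction k arbitrary: f g)
  case 0
  then show ?case using continuous_on_cong[of S S f g] by simp
next
  case (Suc k)
  have f: "f differentiable_on S" using Suc.prems(2) by simp
  have "g differentiable (at x)" if x: "x \<in> S" for x
  proof -
    obtain F where "(f has_derivative F) (at x)"
      using f x by (auto simp: differentiable_on_eq_differentiable_at[OF assms(1)] differentiable_def)
    then have "(g has_derivative F) (at x)"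
      by (rule has_derivative_transform_within_open[OF _ assms(1) x]) (rule Suc.prems(1))
    then show ?thesis by (auto simp: differentiable_def)
  qed
  then have "g differentiable_on S"
    by (simp add: differentiable_on_eq_differentiable_at[OF assms(1)])
  moreover have "Ck_on k S (\<lambda>p. dd g p b)" if "b \<in> Basis" for b
    by (rule Suc.IH[of "\<lambda>p. dd f p b"])
      (use Suc.prems that dd_cong[OF assms(1), of _ f g] in auto)
  ultimately show ?case by simp
qed

lemma Ck_on_Suc_mono: "Ck_on (Suc k) S f \<Longrightarrow> Ck_on k S f"
  by (induction k arbitrary: f) (auto simp: differentiable_imp_continuous_on)

lemma Ck_on_SucD:
  assumes "Ck_on (Suc k) S f" "open S" "x \<in> S"
  shows "(f has_derivative dd f x) (at x)"
  using assms by (simp add: differentiable_on_eq_differentiable_at frechet_derivative_works[symmetric])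

lemma Ck_on_SucI:
  assumes "open S" "\<And>x. x \<in> S \<Longrightarrow> (f has_derivative F x) (at x)"
    "\<And>b. b \<in> Basis \<Longrightarrow> Ck_on k S (\<lambda>x. F x b)"
  shows "Ck_on (Suc k) S f"
proof -
  have "f differentiable_on S"
    using assms(1,2) by (auto simp: differentiable_on_eq_differentiable_at differentiable_def)
  moreover have "Ck_on k S (\<lambda>p. dd f p b)" if "b \<in> Basis" for b
    by (rule Ck_on_cong[OF assms(1) _ assms(3)[OF that]]) (simp add: dd_eqI[OF assms(2)])
  ultimately show ?thesis by simp
qed

lemma Ck_on_const: "open S \<Longrightarrow> Ck_on k S (\<lambda>x. c)"
proof (induction k arbitrary: c)
  case (Suc k)
  then show ?case by (intro Ck_on_SucI[where F = "\<lambda>x h. 0"]) auto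
qed auto

lemma Ck_on_bounded_linear:
  assumes "open S" "bounded_linear L"
  shows "Ck_on k S f \<Longrightarrow> Ck_on k S (\<lambda>x. L (f x))"
proof (induction k arbitrary: f)
  case 0
  then show ?case using bounded_linear.continuous_on[OF assms(2)] by auto
next
  case (Suc k)
  show ?case
    by (rule Ck_on_SucI[OF assms(1) bounded_linear.has_derivative[OF assms(2) Ck_on_SucD[OF Suc.prems assms(1)]]])
      (use Suc in auto)
qed

lemma Ck_on_add:
  assumes "open S"
  shows "Ck_on k S f \<Longrightarrow> Ck_on k S g \<Longrightarrow> Ck_on k S (\<lambda>x. f x + g x)"
proof (induction k arbitrary: f g)
  case 0
  then show ?case by (auto intro: continuous_intros)
next
  case (Suc k)
  show ?case
    by (rule Ck_on_SucI[OF assms has_derivative_add[OF Ck_on_SucD[OF Suc.prems(1) assms] Ck_on_SucD[OF Suc.prems(2) assms]]])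
      (use Suc in auto)
qed

text \<open>The product rule differentiates either factor, so the induction runs over all f and g at
  once. For a general B it serves scalar multiples, \<open>mink\<close> and \<open>star\<close>
  alike.\<close>

lemma Ck_on_bilinear:
  assumes "open S" "bounded_bilinear B"
  shows "Ck_on k S f \<Longrightarrow> Ck_on k S g \<Longrightarrow> Ck_on k S (\<lambda>x. B (f x) (g x))"
proof (induction k arbitrary: f g)
  case 0
  then show ?case using bounded_bilinear.continuous_on[OF assms(2)] by auto
next
  case (Suc k)
  show ?case
  proof (rule Ck_on_SucI[OF assms(1) bounded_bilinear.FDERIV[OF assms(2)
          Ck_on_SucD[OF Suc.prems(1) assms(1)] Ck_on_SucD[OF Suc.prems(2) assms(1)]]])
    show "Ck_on k S (\<lambda>x. B (f x) (dd g x b) + B (dd f x b) (g x))" if "b \<in> Basis" for b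
      using Suc.prems that Ck_on_Suc_mono[OF Suc.prems(1)] Ck_on_Suc_mono[OF Suc.prems(2)]
      by (intro Ck_on_add[OF assms(1)] Suc.IH) auto
  qed
qed

lemma smooth_onI_derivative:
  assumes "open S" "\<And>x. x \<in> S \<Longrightarrow> (f has_derivative F x) (at x)"
    "\<And>b. b \<in> Basis \<Longrightarrow> smooth_on S (\<lambda>x. F x b)"
  shows "smooth_on S f"
proof -
  have "Ck_on (Suc k) S f" for k
    using assms by (auto intro!: Ck_on_SucI simp: smooth_on_def simp del: Ck_on.simps)
  then show ?thesis
    unfolding smooth_on_def using Ck_on_Suc_mono by blast
qed

lemma smooth_onD:
  assumes "smooth_on S f" "open S" "x \<in> S"
  shows "(f has_derivative dd f x) (at x)"
  using assms Ck_on_SucD[of 0] unfolding smooth_on_def by blast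

lemma smooth_on_continuous: "smooth_on S f \<Longrightarrow> continuous_on S f"
  unfolding smooth_on_def using Ck_on.simps(1) by blast

lemma smooth_on_cong:
  "smooth_on S f \<Longrightarrow> open S \<Longrightarrow> (\<And>x. x \<in> S \<Longrightarrow> f x = g x) \<Longrightarrow> smooth_on S g"
  unfolding smooth_on_def using Ck_on_cong by blast

lemma smooth_on_const: "open S \<Longrightarrow> smooth_on S (\<lambda>x. c)"
  by (simp add: smooth_on_def Ck_on_const)

lemma smooth_on_bounded_linear:
  "bounded_linear L \<Longrightarrow> open S \<Longrightarrow> smooth_on S f \<Longrightarrow> smooth_on S (\<lambda>x. L (f x))"
  by (simp add: smooth_on_def Ck_on_bounded_linear)

lemma smooth_on_bilinear:
  "bounded_bilinear B \<Longrightarrow> open S \<Longrightarrow> smooth_on S f \<Longrightarrow> smooth_on S g \<Longrightarrow> smooth_on S (\<lambda>x. B (f x) (g x))"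
  by (simp add: smooth_on_def Ck_on_bilinear)

lemma smooth_on_add:
  "open S \<Longrightarrow> smooth_on S f \<Longrightarrow> smooth_on S g \<Longrightarrow> smooth_on S (\<lambda>x. f x + g x)"
  by (simp add: smooth_on_def Ck_on_add)

lemma smooth_on_minus:
  "open S \<Longrightarrow> smooth_on S f \<Longrightarrow> smooth_on S (\<lambda>x. - f x)"
  by (rule smooth_on_bounded_linear[OF bounded_linear_minus[OF bounded_linear_ident]])

lemma smooth_on_diff:
  "open S \<Longrightarrow> smooth_on S f \<Longrightarrow> smooth_on S g \<Longrightarrow> smooth_on S (\<lambda>x. f x - g x)"
  using smooth_on_add[of S f "\<lambda>x. - g x"] smooth_on_minus[of S g] by simp

lemmas smooth_on_scaleR = smooth_on_bilinear[OF bounded_bilinear_scaleR]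

lemma smooth_on_mult:
  fixes f g :: "'a::euclidean_space \<Rightarrow> real"
  shows "open S \<Longrightarrow> smooth_on S f \<Longrightarrow> smooth_on S g \<Longrightarrow> smooth_on S (\<lambda>x. f x * g x)"
  by (rule smooth_on_bilinear[OF bounded_bilinear_mult])

lemma smooth_on_sum:
  "open S \<Longrightarrow> (\<And>i. i \<in> I \<Longrightarrow> smooth_on S (f i)) \<Longrightarrow> smooth_on S (\<lambda>x. \<Sum>i\<in>I. f i x)"
  by (induction I rule: infinite_finite_induct) (auto simp: smooth_on_const smooth_on_add)

lemma bounded_linear_dd:
  assumes "smooth_on S f" "open S" "x \<in> S"
  shows "bounded_linear (dd f x)"
  using smooth_onD[OF assms] has_derivative_bounded_linear by blast

text \<open>\<open>Ck_on\<close> speaks of derivatives along fixed basis vectors; a variable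
  direction is reached by expanding it in the basis with smooth coefficients.\<close>

lemma smooth_on_dd_field:
  assumes "smooth_on S f" "open S" "smooth_on S V"
  shows "smooth_on S (\<lambda>x. dd f x (V x))"
proof -
  have "smooth_on S (\<lambda>x. \<Sum>b\<in>Basis. (V x \<bullet> b) *\<^sub>R dd f x b)"
  proof (intro smooth_on_sum smooth_on_scaleR assms)
    fix b :: 'a assume b: "b \<in> Basis"
    show "smooth_on S (\<lambda>x. V x \<bullet> b)"
      using assms by (intro smooth_on_bounded_linear[where L = "\<lambda>v. v \<bullet> b"] bounded_linear_inner_left) auto
    show "smooth_on S (\<lambda>x. dd f x b)"
      using assms(1) b unfolding smooth_on_def using Ck_on.simps(2) by blast
  qed
  then show ?thesis
  proof (rule smooth_on_cong[OF _ assms(2)])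
    fix x assume x: "x \<in> S"
    interpret bounded_linear "dd f x" by (rule bounded_linear_dd[OF assms(1,2) x])
    show "(\<Sum>b\<in>Basis. (V x \<bullet> b) *\<^sub>R dd f x b) = dd f x (V x)"
      by (subst (2) euclidean_representation[symmetric, of "V x"]) (simp add: sum scaleR)
  qed
qed

lemma smooth_on_dd: "smooth_on S f \<Longrightarrow> open S \<Longrightarrow> smooth_on S (\<lambda>x. dd f x a)"
  by (rule smooth_on_dd_field[OF _ _ smooth_on_const])

lemma smooth_on_subset: 
  assumes "smooth_on S f" "T \<subseteq> S"
  shows "smooth_on T f"
proof -
  have "Ck_on k S f \<Longrightarrow> Ck_on k T f" for k
  proof (induction k arbitrary: f)
    case 0 then show ?case using assms(2) continuous_on_subset by auto
  next
    case (Suc k) then show ?case using assms(2) differentiable_on_subset by auto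
  qed
  then show ?thesis using assms(1) unfolding smooth_on_def by blast
qed

text \<open>The derivative of 1/f is a polynomial in 1/f and the derivative of f, so order k for 1/f
  gives order k + 1.\<close>

lemma smooth_on_inverse:
  fixes f :: "'a::euclidean_space \<Rightarrow> real"
  assumes S: "open S" and f: "smooth_on S f" and nz: "\<And>x. x \<in> S \<Longrightarrow> f x \<noteq> 0"
  shows "smooth_on S (\<lambda>x. inverse (f x))"
proof -
  have "Ck_on k S (\<lambda>x. inverse (f x))" for k
  proof (induction k)
    case 0
    show ?case using continuous_on_inverse[OF smooth_on_continuous[OF f]] nz by auto
  next
    case (Suc k)
    show ?case
    proof (rule Ck_on_SucI[OF S, where F = "\<lambda>x h. - (inverse (f x) * dd f x h * inverse (f x))"])
      show "((\<lambda>x. inverse (f x)) has_derivative (\<lambda>h. - (inverse (f x) * dd f x h * inverse (f x)))) (at x)"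
        if "x \<in> S" for x
        using Deriv.has_derivative_inverse[OF nz[OF that] smooth_onD[OF f S that]] .
      show "Ck_on k S (\<lambda>x. - (inverse (f x) * dd f x b * inverse (f x)))" for b
        using smooth_on_dd[OF f S, of b] Suc
        by (intro Ck_on_bounded_linear[OF S bounded_linear_minus[OF bounded_linear_ident]]
            Ck_on_bilinear[OF S bounded_bilinear_mult]) (auto simp: smooth_on_def)
    qed
  qed
  then show ?thesis unfolding smooth_on_def by blast
qed

lemma smooth_on_divide:
  fixes f g :: "'a::euclidean_space \<Rightarrow> real"
  assumes "open S" "smooth_on S f" "smooth_on S g" "\<And>x. x \<in> S \<Longrightarrow> g x \<noteq> 0"
  shows "smooth_on S (\<lambda>x. f x / g x)"
  unfolding divide_inverse using assms by (intro smooth_on_mult smooth_on_inverse) auto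

text \<open>Writing 1/sqrt f as (1/f) sqrt f makes the derivative a smooth function times sqrt f, to
  which the induction hypothesis applies.\<close>

lemma smooth_on_sqrt:
  fixes f :: "'a::euclidean_space \<Rightarrow> real"
  assumes S: "open S" and f: "smooth_on S f" and pos: "\<And>x. x \<in> S \<Longrightarrow> f x > 0"
  shows "smooth_on S (\<lambda>x. sqrt (f x))"
proof -
  have "Ck_on k S (\<lambda>x. sqrt (f x))" for k
  proof (induction k)
    case 0
    show ?case using continuous_on_real_sqrt[OF smooth_on_continuous[OF f]] by simp
  next
    case (Suc k)
    show ?case
    proof (rule Ck_on_SucI[OF S, where F = "\<lambda>x h. dd f x h * (inverse (f x) / 2) * sqrt (f x)"])
      fix x assume x: "x \<in> S"
      have "((\<lambda>x. sqrt (f x)) has_derivative (\<lambda>h. dd f x h * (inverse (sqrt (f x)) / 2))) (at x)"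
        using DERIV_compose_FDERIV[OF DERIV_real_sqrt[OF pos[OF x]] smooth_onD[OF f S x]] .
      moreover have "inverse (sqrt (f x)) = inverse (f x) * sqrt (f x)"
        using pos[OF x] by (simp add: field_simps)
      ultimately show "((\<lambda>x. sqrt (f x)) has_derivative (\<lambda>h. dd f x h * (inverse (f x) / 2) * sqrt (f x))) (at x)"
        by (simp add: mult_ac)
    next
      have "smooth_on S (\<lambda>x. dd f x b * (inverse (f x) / 2))" for b
        by (intro smooth_on_mult smooth_on_divide smooth_on_dd smooth_on_inverse smooth_on_const S f)
          (use pos in \<open>auto simp: less_imp_neq[symmetric]\<close>)
      then show "Ck_on k S (\<lambda>x. dd f x b * (inverse (f x) / 2) * sqrt (f x))" for b
        unfolding smooth_on_def using Suc
        by (intro Ck_on_bilinear[OF S bounded_bilinear_mult, where f = "\<lambda>x. dd f x b * (inverse (f x) / 2)"]) auto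
    qed
  qed
  then show ?thesis unfolding smooth_on_def by blast
qed

lemma smooth_on_vec_nth: "open S \<Longrightarrow> smooth_on S f \<Longrightarrow> smooth_on S (\<lambda>x. f x $ i)"
  by (rule smooth_on_bounded_linear[OF bounded_linear_vec_nth])

text \<open>The derivative of \<open>u \<circ> g\<close> is again of the form \<open>u' \<circ> g\<close> with \<open>u'\<close> smooth, which makes the
  induction on the order of differentiability go through for all \<open>u\<close> at once.\<close>

lemma smooth_on_inverse_map:
  fixes u :: "'a::euclidean_space \<Rightarrow> 'b::real_normed_vector" and g :: "'c::euclidean_space \<Rightarrow> 'a"
  assumes S: "open S" "open T" and u: "smooth_on S u"
    and g: "\<And>y. y \<in> T \<Longrightarrow> g y \<in> S" "\<And>y. y \<in> T \<Longrightarrow> (g has_derivative (\<lambda>h. C h (g y))) (at y)"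
    and C: "\<And>b. b \<in> Basis \<Longrightarrow> smooth_on S (C b)"
  shows "smooth_on T (\<lambda>y. u (g y))"
proof -
  have "smooth_on S u \<Longrightarrow> Ck_on k T (\<lambda>y. u (g y))" for k and u :: "'a \<Rightarrow> 'b"
  proof (induction k arbitrary: u)
    case 0
    have "continuous_on T g"
      using g(2) by (meson continuous_at_imp_continuous_on has_derivative_continuous)
    then have "continuous_on T (\<lambda>y. u (g y))"
      using smooth_on_continuous[OF 0] g(1) by (auto intro: continuous_on_compose2)
    then show ?case by simp
  next
    case (Suc k)
    show ?case
    proof (rule Ck_on_SucI[OF S(2), where F = "\<lambda>y h. dd u (g y) (C h (g y))"])
      show "((\<lambda>y. u (g y)) has_derivative (\<lambda>h. dd u (g y) (C h (g y)))) (at y)" if "y \<in> T" for y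
        using has_derivative_compose[OF g(2)[OF that] smooth_onD[OF Suc.prems S(1) g(1)[OF that]]] .
      show "Ck_on k T (\<lambda>y. dd u (g y) (C b (g y)))" if "b \<in> Basis" for b
        using Suc.IH[OF smooth_on_dd_field[OF Suc.prems S(1) C[OF that]]] .
    qed
  qed
  then show ?thesis using u unfolding smooth_on_def by blast
qed

section \<open>Symmetry of second derivatives\<close>

lemma mvt_line:
  fixes f :: "'a::real_normed_vector \<Rightarrow> real"
  assumes "s > 0" "\<And>t. 0 \<le> t \<Longrightarrow> t \<le> s \<Longrightarrow> (f has_derivative F (x + t *\<^sub>R a)) (at (x + t *\<^sub>R a))"
  obtains t where "0 < t" "t < s" "f (x + s *\<^sub>R a) - f x = s * F (x + t *\<^sub>R a) a"
proof -
  have d: "((\<lambda>t. f (x + t *\<^sub>R a)) has_derivative (\<lambda>h. F (x + t *\<^sub>R a) (h *\<^sub>R a))) (at t)"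
    if "0 \<le> t" "t \<le> s" for t
  proof (rule has_derivative_compose[where f = "\<lambda>t. x + t *\<^sub>R a"])
    show "((\<lambda>t. x + t *\<^sub>R a) has_derivative (\<lambda>h. h *\<^sub>R a)) (at t)"
      by (auto intro!: derivative_eq_intros)
  qed (rule assms(2)[OF that])
  have "\<exists>t\<in>{0<..<s}. f (x + s *\<^sub>R a) - f (x + 0 *\<^sub>R a) = F (x + t *\<^sub>R a) ((s - 0) *\<^sub>R a)"
  proof (rule mvt[OF assms(1)])
    show "continuous_on {0..s} (\<lambda>t. f (x + t *\<^sub>R a))"
      using has_derivative_continuous[OF d] by (intro continuous_at_imp_continuous_on) auto
    show "((\<lambda>t. f (x + t *\<^sub>R a)) has_derivative (\<lambda>h. F (x + t *\<^sub>R a) (h *\<^sub>R a))) (at t)"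
      if "0 < t" "t < s" for t using d that by simp
  qed auto
  then obtain t where t: "t \<in> {0<..<s}" "f (x + s *\<^sub>R a) - f x = F (x + t *\<^sub>R a) (s *\<^sub>R a)"
    by auto
  have "linear (F (x + t *\<^sub>R a))"
    using assms(2)[of t] t(1) by (auto intro: has_derivative_linear)
  then have "f (x + s *\<^sub>R a) - f x = s * F (x + t *\<^sub>R a) a"
    using t(2) by (simp add: linear_scale)
  then show ?thesis using that t(1) by auto
qed

text \<open>The second difference of f over the parallelogram with sides s a and s b equals s^2 P at
  one of its points and s^2 Q at another, by two mean value steps in either order. The parallelogram
  is so small that both values stay within e, half the supposed gap, of P x and Q x, so they cannot
  coincide.\<close>

lemma dd_commute_real:
  fixes f :: "'a::euclidean_space \<Rightarrow> real"
  assumes f: "smooth_on S f" and S: "open S" and x: "x \<in> S"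
  shows "dd (\<lambda>z. dd f z a) x b = dd (\<lambda>z. dd f z b) x a"
proof (rule ccontr)
  define P where "P = (\<lambda>y. dd (\<lambda>z. dd f z a) y b)"
  define Q where "Q = (\<lambda>y. dd (\<lambda>z. dd f z b) y a)"
  assume "dd (\<lambda>z. dd f z a) x b \<noteq> dd (\<lambda>z. dd f z b) x a"
  then have ne: "\<bar>P x - Q x\<bar> > 0" by (simp add: P_def Q_def)
  define e where "e = \<bar>P x - Q x\<bar> / 2"
  have e: "e > 0" using ne by (simp add: e_def)
  have cP: "isCont P x" and cQ: "isCont Q x"
    using smooth_on_continuous[OF smooth_on_dd[OF smooth_on_dd[OF f S] S]] S x
    by (auto simp: P_def Q_def continuous_on_eq_continuous_at)
  obtain d1 where d1: "d1 > 0" "\<And>y. dist y x < d1 \<Longrightarrow> dist (P y) (P x) < e"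
    using cP[unfolded continuous_at_eps_delta, rule_format, OF e] by blast
  obtain d2 where d2: "d2 > 0" "\<And>y. dist y x < d2 \<Longrightarrow> dist (Q y) (Q x) < e"
    using cQ[unfolded continuous_at_eps_delta, rule_format, OF e] by blast
  obtain d3 where d3: "d3 > 0" "\<And>y. dist y x < d3 \<Longrightarrow> y \<in> S"
    using S x unfolding open_dist by blast
  define d where "d = min d1 (min d2 d3)"
  have d: "d > 0" using d1 d2 d3 by (simp add: d_def)
  define s where "s = d / (2 * (norm a + norm b + 1))"
  have na: "norm a + norm b + 1 > 0" by (smt (verit) norm_ge_zero)
  have s: "s > 0" using d na by (simp add: s_def)
  have near: "dist (x + t *\<^sub>R a + r *\<^sub>R b) x < d" if "0 \<le> t" "t \<le> s" "0 \<le> r" "r \<le> s" for t r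
  proof -
    have "dist (x + t *\<^sub>R a + r *\<^sub>R b) x = norm (t *\<^sub>R a + r *\<^sub>R b)" by (simp add: dist_norm)
    also have "\<dots> \<le> t * norm a + r * norm b"
      using that by (intro order_trans[OF norm_triangle_ineq]) auto
    also have "\<dots> \<le> s * norm a + s * norm b"
      using that by (intro add_mono mult_right_mono) auto
    also have "\<dots> \<le> s * (norm a + norm b + 1)" using s by (simp add: algebra_simps)
    also have "\<dots> = d / 2" using na by (simp add: s_def field_simps)
    also have "\<dots> < d" using d by simp
    finally show ?thesis .
  qed
  have inS: "x + t *\<^sub>R a + r *\<^sub>R b \<in> S" if "0 \<le> t" "t \<le> s" "0 \<le> r" "r \<le> s" for t r
    using near[OF that] d3(2) by (simp add: d_def)
  have D: "(f has_derivative dd f y) (at y)" if "y \<in> S" for y by (rule smooth_onD[OF f S that])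
  have D2: "((\<lambda>z. dd f z c) has_derivative dd (\<lambda>z. dd f z c) y) (at y)" if "y \<in> S" for y c
    by (rule smooth_onD[OF smooth_on_dd[OF f S] S that])
  have shift: "((\<lambda>y. f (y + s *\<^sub>R c)) has_derivative dd f (y + s *\<^sub>R c)) (at y)"
    if "y + s *\<^sub>R c \<in> S" for y c
    by (rule has_derivative_compose[where f = "\<lambda>y. y + s *\<^sub>R c" and f' = "\<lambda>h. h", OF _ D[OF that]])
      (auto intro!: derivative_eq_intros)
  obtain t1 where t1: "0 < t1" "t1 < s"
    "(f (x + s *\<^sub>R a + s *\<^sub>R b) - f (x + s *\<^sub>R a)) - (f (x + s *\<^sub>R b) - f x)
       = s * (dd f (x + t1 *\<^sub>R a + s *\<^sub>R b) a - dd f (x + t1 *\<^sub>R a) a)"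
  proof (rule mvt_line[OF s, where f = "\<lambda>y. f (y + s *\<^sub>R b) - f y" and x = x and a = a
        and F = "\<lambda>y h. dd f (y + s *\<^sub>R b) h - dd f y h"])
    fix t assume t: "0 \<le> t" "t \<le> s"
    show "((\<lambda>y. f (y + s *\<^sub>R b) - f y) has_derivative
        (\<lambda>h. dd f (x + t *\<^sub>R a + s *\<^sub>R b) h - dd f (x + t *\<^sub>R a) h)) (at (x + t *\<^sub>R a))"
      using inS[of t s] inS[of t 0] t s by (intro has_derivative_diff shift D) auto
  qed auto
  obtain r1 where r1: "0 < r1" "r1 < s"
    "dd f (x + t1 *\<^sub>R a + s *\<^sub>R b) a - dd f (x + t1 *\<^sub>R a) a = s * P (x + t1 *\<^sub>R a + r1 *\<^sub>R b)"
  proof (rule mvt_line[OF s, where f = "\<lambda>y. dd f y a" and x = "x + t1 *\<^sub>R a" and a = b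
        and F = "\<lambda>y. dd (\<lambda>z. dd f z a) y"])
    fix t assume t: "0 \<le> t" "t \<le> s"
    show "((\<lambda>y. dd f y a) has_derivative dd (\<lambda>z. dd f z a) (x + t1 *\<^sub>R a + t *\<^sub>R b)) 
      (at (x + t1 *\<^sub>R a + t *\<^sub>R b))"
      using inS[of t1 t] t t1 by (intro D2) auto
  qed (auto simp: P_def)
  obtain t2 where t2: "0 < t2" "t2 < s"
    "(f (x + s *\<^sub>R b + s *\<^sub>R a) - f (x + s *\<^sub>R b)) - (f (x + s *\<^sub>R a) - f x)
       = s * (dd f (x + t2 *\<^sub>R b + s *\<^sub>R a) b - dd f (x + t2 *\<^sub>R b) b)"
  proof (rule mvt_line[OF s, where f = "\<lambda>y. f (y + s *\<^sub>R a) - f y" and x = x and a = b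
        and F = "\<lambda>y h. dd f (y + s *\<^sub>R a) h - dd f y h"])
    fix t assume t: "0 \<le> t" "t \<le> s"
    show "((\<lambda>y. f (y + s *\<^sub>R a) - f y) has_derivative
        (\<lambda>h. dd f (x + t *\<^sub>R b + s *\<^sub>R a) h - dd f (x + t *\<^sub>R b) h)) (at (x + t *\<^sub>R b))"
      using inS[of s t] inS[of 0 t] t s by (intro has_derivative_diff shift D) (auto simp: add_ac)
  qed auto
  obtain r2 where r2: "0 < r2" "r2 < s"
    "dd f (x + t2 *\<^sub>R b + s *\<^sub>R a) b - dd f (x + t2 *\<^sub>R b) b = s * Q (x + t2 *\<^sub>R b + r2 *\<^sub>R a)"
  proof (rule mvt_line[OF s, where f = "\<lambda>y. dd f y b" and x = "x + t2 *\<^sub>R b" and a = a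
        and F = "\<lambda>y. dd (\<lambda>z. dd f z b) y"])
    fix t assume t: "0 \<le> t" "t \<le> s"
    show "((\<lambda>y. dd f y b) has_derivative dd (\<lambda>z. dd f z b) (x + t2 *\<^sub>R b + t *\<^sub>R a)) 
      (at (x + t2 *\<^sub>R b + t *\<^sub>R a))"
      using inS[of t t2] t t2 by (intro D2) (auto simp: add_ac)
  qed (auto simp: Q_def)
  have *: "x + s *\<^sub>R b + s *\<^sub>R a = x + s *\<^sub>R a + s *\<^sub>R b" by simp
  have "s * (s * P (x + t1 *\<^sub>R a + r1 *\<^sub>R b)) = s * (s * Q (x + t2 *\<^sub>R b + r2 *\<^sub>R a))"
    using t1(3)[unfolded r1(3)] t2(3)[unfolded r2(3), unfolded *] by linarith
  then have PQ: "P (x + t1 *\<^sub>R a + r1 *\<^sub>R b) = Q (x + t2 *\<^sub>R b + r2 *\<^sub>R a)" using s by simp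
  have "dist (P (x + t1 *\<^sub>R a + r1 *\<^sub>R b)) (P x) < e"
    using near[of t1 r1] t1 r1 by (intro d1(2)) (auto simp: d_def)
  moreover have "dist (Q (x + t2 *\<^sub>R b + r2 *\<^sub>R a)) (Q x) < e"
    using near[of r2 t2] t2 r2 by (intro d2(2)) (auto simp: d_def add_ac)
  ultimately show False
    using PQ unfolding e_def dist_real_def by (smt (verit) field_sum_of_halves)
qed

lemma dd_bounded_linear_comp:
  assumes "bounded_linear L" "(f has_derivative dd f x) (at x)"
  shows "dd (\<lambda>z. L (f z)) x a = L (dd f x a)"
  using dd_eqI[OF bounded_linear.has_derivative[OF assms]] by simp

lemma dd_commute:
  fixes f :: "'a::euclidean_space \<Rightarrow> 'b::euclidean_space"
  assumes f: "smooth_on S f" and S: "open S" and x: "x \<in> S"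
  shows "dd (\<lambda>z. dd f z a) x b = dd (\<lambda>z. dd f z b) x a"
proof (rule euclidean_eqI)
  fix i :: 'b assume "i \<in> Basis"
  have L: "bounded_linear (\<lambda>v::'b. v \<bullet> i)" by (rule bounded_linear_inner_left)
  have *: "dd (\<lambda>z. dd (\<lambda>w. f w \<bullet> i) z a) x b = dd (\<lambda>z. dd f z a) x b \<bullet> i" for a b
  proof -
    have "dd (\<lambda>z. dd (\<lambda>w. f w \<bullet> i) z a) x = dd (\<lambda>z. dd f z a \<bullet> i) x"
      by (rule dd_cong[OF S x]) (simp add: dd_bounded_linear_comp[OF L smooth_onD[OF f S]])
    then show ?thesis
      by (simp add: dd_bounded_linear_comp[OF L smooth_onD[OF smooth_on_dd[OF f S] S x]])
  qed
  show "dd (\<lambda>z. dd f z a) x b \<bullet> i = dd (\<lambda>z. dd f z b) x a \<bullet> i"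
    using dd_commute_real[OF smooth_on_bounded_linear[OF L S f] S x, of a b] by (simp add: *)
qed

section \<open>Unique continuation\<close>

text \<open>The primitive is the line integral of A along the segment from c to x. Closedness
  rewrites the x-derivative of the integrand as \<open>G x t\<close>, which is the t-derivative of t
  A(c + t (x - c)); integrating it over [0, 1] leaves A x.\<close>

lemma poincare_ball:
  fixes A :: "'a::euclidean_space \<Rightarrow> 'a"
  assumes A: "smooth_on (ball c r) A"
    and closed: "\<And>x h k. x \<in> ball c r \<Longrightarrow> dd A x h \<bullet> k = dd A x k \<bullet> h"
  obtains v where "\<And>x. x \<in> ball c r \<Longrightarrow> (v has_derivative (\<lambda>h. A x \<bullet> h)) (at x)"
proof
  let ?B = "ball c r"
  let ?y = "\<lambda>x t. c + t *\<^sub>R (x - c)"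
  define G where "G = (\<lambda>x t. blinfun_inner_right (A (?y x t) + t *\<^sub>R dd A (?y x t) (x - c)))"
  fix x assume x: "x \<in> ?B"
  have y: "?y x t \<in> ?B" if "x \<in> ?B" "t \<in> {0..1}" for x t
  proof -
    have "dist c (?y x t) = t * dist c x"
      using that(2) by (simp add: dist_norm norm_minus_commute)
    also have "\<dots> \<le> dist c x" using that(2) by (simp add: mult_left_le_one_le)
    finally show ?thesis using that(1) by simp
  qed
  have dA: "(A has_derivative dd A z) (at z)" if "z \<in> ?B" for z
    using smooth_onD[OF A _ that] by simp
  have "((\<lambda>x. integral (cbox 0 1) (\<lambda>t. A (?y x t) \<bullet> (x - c))) has_derivative
      blinfun_apply (integral (cbox 0 1) (G x))) (at x within ?B)"
  proof (rule leibniz_rule)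
    fix x and t :: real assume xt: "x \<in> ?B" "t \<in> cbox 0 1"
    have yx: "?y x t \<in> ?B" using y xt by simp
    have lin: "linear (dd A (?y x t))" using dA[OF yx] has_derivative_linear by blast
    have 1: "((\<lambda>x. ?y x t) has_derivative (\<lambda>h. t *\<^sub>R h)) (at x)"
      by (auto intro!: derivative_eq_intros)
    have 2: "((\<lambda>x. x - c) has_derivative (\<lambda>h. h)) (at x)"
      by (auto intro!: derivative_eq_intros)
    have "((\<lambda>x. A (?y x t) \<bullet> (x - c)) has_derivative
        (\<lambda>h. A (?y x t) \<bullet> h + dd A (?y x t) (t *\<^sub>R h) \<bullet> (x - c))) (at x)"
      by (rule has_derivative_inner[OF has_derivative_compose[OF 1 dA[OF yx]] 2])
    also have "(\<lambda>h. A (?y x t) \<bullet> h + dd A (?y x t) (t *\<^sub>R h) \<bullet> (x - c)) = blinfun_apply (G x t)"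
      using closed[OF yx, of _ "x - c"] by (auto simp: G_def linear_scale[OF lin] inner_add_left)
    finally show "((\<lambda>x. A (?y x t) \<bullet> (x - c)) has_derivative blinfun_apply (G x t)) (at x within ?B)"
      by (rule has_derivative_at_withinI)
  next
    fix x assume x: "x \<in> ?B"
    have "continuous_on {0..1} (\<lambda>t. A (?y x t))"
      by (rule continuous_on_compose2[OF smooth_on_continuous[OF A]])
        (use y[OF x] in \<open>auto intro!: continuous_intros\<close>)
    then show "(\<lambda>t. A (?y x t) \<bullet> (x - c)) integrable_on cbox 0 1"
      by (intro integrable_continuous) (auto intro!: continuous_intros)
  next
    have *: "continuous_on (?B \<times> cbox 0 1) (\<lambda>p. ?y (fst p) (snd p))"
      by (auto intro!: continuous_intros)
    have sub: "(\<lambda>p. ?y (fst p) (snd p)) ` (?B \<times> cbox 0 1) \<subseteq> ?B"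
      using y by auto
    have cA: "continuous_on (?B \<times> cbox 0 1) (\<lambda>p. A (?y (fst p) (snd p)))"
      by (rule continuous_on_compose2[OF smooth_on_continuous[OF A] * sub])
    have cb: "continuous_on (?B \<times> cbox 0 1) (\<lambda>p. dd A (?y (fst p) (snd p)) b)" for b
      using continuous_on_compose2[OF smooth_on_continuous[OF smooth_on_dd[OF A]] * sub] by simp
    \<comment> \<open>Joint continuity is known for \<open>dd A\<close> along a fixed vector, so the
      moving direction x - c is expanded in the basis.\<close>
    have "continuous_on (?B \<times> cbox 0 1)
        (\<lambda>p. \<Sum>b\<in>Basis. ((fst p - c) \<bullet> b) *\<^sub>R dd A (?y (fst p) (snd p)) b)"
      by (intro continuous_on_sum continuous_on_scaleR cb continuous_intros)
    moreover have "(\<Sum>b\<in>Basis. ((fst p - c) \<bullet> b) *\<^sub>R dd A (?y (fst p) (snd p)) b)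
        = dd A (?y (fst p) (snd p)) (fst p - c)" if "p \<in> ?B \<times> cbox 0 1" for p
    proof -
      have "?y (fst p) (snd p) \<in> ?B" using sub that by blast
      then have lin: "linear (dd A (?y (fst p) (snd p)))" using dA has_derivative_linear by blast
      show ?thesis
        by (subst (2) euclidean_representation[symmetric, of "fst p - c"])
          (simp only: linear_sum[OF lin] linear_scale[OF lin])
    qed
    ultimately have "continuous_on (?B \<times> cbox 0 1) (\<lambda>p. dd A (?y (fst p) (snd p)) (fst p - c))"
      by (simp cong: continuous_on_cong)
    then have "continuous_on (?B \<times> cbox 0 1)
       (\<lambda>p. A (?y (fst p) (snd p)) + snd p *\<^sub>R dd A (?y (fst p) (snd p)) (fst p - c))"
      by (intro continuous_on_add cA continuous_on_scaleR continuous_intros)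
    then show "continuous_on (?B \<times> cbox 0 1) (\<lambda>(x, t). G x t)"
      unfolding G_def case_prod_beta
      by (rule bounded_linear.continuous_on[OF bounded_linear_blinfun_inner_right])
  qed (use x in auto)
  moreover have "integral (cbox 0 1) (G x) = blinfun_inner_right (A x)"
  proof -
    have "(G x has_integral blinfun_inner_right (1 *\<^sub>R A (?y x 1)) - blinfun_inner_right (0 *\<^sub>R A (?y x 0))) {0..1}"
    proof (rule fundamental_theorem_of_calculus)
      fix t :: real assume t: "t \<in> {0..1}"
      have yx: "?y x t \<in> ?B" using y[OF x t] .
      have lin: "linear (dd A (?y x t))" using dA[OF yx] has_derivative_linear by blast
      have 1: "((\<lambda>t. ?y x t) has_derivative (\<lambda>s. s *\<^sub>R (x - c))) (at t)"
        by (auto intro!: derivative_eq_intros)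
      have "((\<lambda>t. t *\<^sub>R A (?y x t)) has_derivative
          (\<lambda>s. t *\<^sub>R dd A (?y x t) (s *\<^sub>R (x - c)) + s *\<^sub>R A (?y x t))) (at t)"
        by (rule has_derivative_scaleR[OF has_derivative_ident has_derivative_compose[OF 1 dA[OF yx]]])
      moreover have "t *\<^sub>R dd A (?y x t) (s *\<^sub>R v) + s *\<^sub>R A (?y x t) = s *\<^sub>R (A (?y x t) + t *\<^sub>R dd A (?y x t) v)"
        for s v
        unfolding linear_scale[OF lin] scaleR_add_right scaleR_left_commute[of t s] by (rule add.commute)
      ultimately have "((\<lambda>t. t *\<^sub>R A (?y x t)) has_vector_derivative
          A (?y x t) + t *\<^sub>R dd A (?y x t) (x - c)) (at t)"
        unfolding has_vector_derivative_def by simp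
      then show "((\<lambda>t. blinfun_inner_right (t *\<^sub>R A (?y x t))) has_vector_derivative G x t)
          (at t within {0..1})"
        unfolding G_def
        by (rule bounded_linear.has_vector_derivative[OF bounded_linear_blinfun_inner_right
              has_vector_derivative_at_within])
    qed simp
    then have "integral {0..1} (G x) =
        blinfun_inner_right (1 *\<^sub>R A (?y x 1)) - blinfun_inner_right (0 *\<^sub>R A (?y x 0))"
      by (rule integral_unique)
    also have "\<dots> = blinfun_inner_right (A x)"
      by (rule blinfun_eqI) (simp add: blinfun.diff_left)
    finally show ?thesis by (simp only: cbox_interval)
  qed
  ultimately show "((\<lambda>x. integral (cbox 0 1) (\<lambda>t. A (?y x t) \<bullet> (x - c))) has_derivative
      (\<lambda>h. A x \<bullet> h)) (at x)"
    unfolding at_within_open[OF x open_ball] by simp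
qed

text \<open>The inverse function theorem with the image cut down to a ball: its convexity is what
  later lets a vanishing derivative imply constancy.\<close>

lemma local_diffeo:
  fixes \<psi> :: "'a::euclidean_space \<Rightarrow> 'a"
  assumes D: "open D" "x \<in> D" and \<psi>: "smooth_on D \<psi>" and inj: "\<And>h. dd \<psi> x h = 0 \<Longrightarrow> h = 0"
  obtains N e g where "open N" "N \<subseteq> D" "x \<in> N" "e > 0" "homeomorphism N (ball (\<psi> x) e) \<psi> g"
    "\<And>y. y \<in> ball (\<psi> x) e \<Longrightarrow> (g has_derivative inv (dd \<psi> (g y))) (at y)"
    "\<And>y. y \<in> N \<Longrightarrow> bij (dd \<psi> y)"
proof -
  define F where "F = (\<lambda>y. Blinfun (dd \<psi> y))"
  have bl: "bounded_linear (dd \<psi> y)" if "y \<in> D" for y using bounded_linear_dd[OF \<psi> D(1) that] .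
  have F: "blinfun_apply (F y) = dd \<psi> y" if "y \<in> D" for y
    unfolding F_def using bl[OF that] by (rule bounded_linear_Blinfun_apply)
  have "linear (dd \<psi> x)" using bl[OF D(2)] bounded_linear.linear by blast
  moreover have "inj (dd \<psi> x)"
    using linear_injective_0[OF calculation] inj by blast
  ultimately obtain L where L: "linear L" "L \<circ> dd \<psi> x = id" using linear_injective_left_inverse by blast
  have bL: "bounded_linear L" using L(1) linear_conv_bounded_linear by blast
  have contF: "continuous_on D F"
  proof (rule continuous_on_blinfun_componentwise)
    fix i :: 'a
    show "continuous_on D (\<lambda>y. blinfun_apply (F y) i)"
      using smooth_on_continuous[OF smooth_on_dd[OF \<psi> D(1)], of i] F by (simp cong: continuous_on_cong)
  qed
  have "Blinfun L o\<^sub>L F x = id_blinfun"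
    by (rule blinfun_eqI) (use L(2) F[OF D(2)] in \<open>auto simp: bounded_linear_Blinfun_apply[OF bL] fun_eq_iff\<close>)
  then obtain U' V g g' where IFT: "open U'" "U' \<subseteq> D" "x \<in> U'" "open V" "\<psi> x \<in> V" "homeomorphism U' V \<psi> g"
    "\<And>y. y \<in> V \<Longrightarrow> (g has_derivative (g' y)) (at y)"
    "\<And>y. y \<in> V \<Longrightarrow> g' y = inv (blinfun_apply (F (g y)))"
    "\<And>y. y \<in> V \<Longrightarrow> bij (blinfun_apply (F (g y)))"
    using inverse_function_theorem[OF D(1) _ contF D(2), of \<psi> "Blinfun L"] F smooth_onD[OF \<psi> D(1)]
    by (metis (no_types, lifting))
  obtain e where e: "e > 0" "ball (\<psi> x) e \<subseteq> V"
    using IFT(4,5) openE by blast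
  define N where "N = U' \<inter> \<psi> -` ball (\<psi> x) e"
  have c\<psi>: "continuous_on U' \<psi>" using IFT(6) homeomorphism_def by blast
  have gU: "g y \<in> U'" "\<psi> (g y) = y" if "y \<in> V" for y
    using IFT(6) that unfolding homeomorphism_def by auto
  have gN: "g (\<psi> y) = y" "\<psi> y \<in> V" if "y \<in> U'" for y
    using IFT(6) that unfolding homeomorphism_def by auto
  show ?thesis
  proof
    show "open N" unfolding N_def by (rule continuous_open_preimage[OF c\<psi> IFT(1) open_ball])
    show "N \<subseteq> D" "x \<in> N" using IFT(2,3) e by (auto simp: N_def)
    show "homeomorphism N (ball (\<psi> x) e) \<psi> g"
    proof (rule homeomorphism_of_subsets[OF IFT(6)])
      show "\<psi> ` N = ball (\<psi> x) e"
      proof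
        show "ball (\<psi> x) e \<subseteq> \<psi> ` N"
        proof
          fix y assume "y \<in> ball (\<psi> x) e"
          then have "g y \<in> N" "\<psi> (g y) = y" using gU[of y] e(2) by (auto simp: N_def)
          then show "y \<in> \<psi> ` N" by (metis imageI)
        qed
      qed (auto simp: N_def)
    qed (use e in \<open>auto simp: N_def\<close>)
    show "(g has_derivative inv (dd \<psi> (g y))) (at y)" if "y \<in> ball (\<psi> x) e" for y
      using IFT(7,8)[of y] F[of "g y"] gU[of y] e(2) IFT(2) that by (metis subsetD)
    show "bij (dd \<psi> y)" if "y \<in> N" for y
      using IFT(9)[of "\<psi> y"] gN[of y] F[of y] IFT(2) that by (auto simp: N_def)
  qed (rule e)
qed

text \<open>A real eigenvalue s of J would satisfy s^2 = -1, so h and J h are independent and span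
  the plane.\<close>

lemma complex_structure_span:
  fixes J :: "real^2 \<Rightarrow> real^2"
  assumes "linear J" "\<And>h. J (J h) = - h" "h \<noteq> 0"
  obtains \<alpha> \<beta> where "k = \<alpha> *\<^sub>R h + \<beta> *\<^sub>R J h"
proof -
  have ne: "J h \<noteq> s *\<^sub>R h" for s
  proof
    assume "J h = s *\<^sub>R h"
    then have "- h = (s * s) *\<^sub>R h" using assms(2)[of h] by (simp add: linear_scale[OF assms(1)])
    then have "(s * s + 1) *\<^sub>R h = - h + h" by (simp only: scaleR_add_left scaleR_one)
    then show False using assms(3) by (auto simp: add_nonneg_eq_0_iff)
  qed
  have "J h \<noteq> h" using ne[of 1] by simp
  moreover have "independent {J h, h}"
    using ne assms(3) by (auto simp: independent_insert span_singleton)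
  ultimately have "k \<in> span {J h, h}"
    using card_ge_dim_independent[of "{J h, h}" UNIV] by auto
  then show ?thesis using that by (auto simp: span_insert span_singleton algebra_simps)
qed

text \<open>For a complex structure \<open>J\<close> of the plane, \<open>u\<close> is harmonic iff \<open>du \<circ> J\<close> is closed; a primitive of
  \<open>du \<circ> J\<close> is a harmonic conjugate.\<close>

definition J_harmonic :: "(real^2) set \<Rightarrow> (real^2 \<Rightarrow> real^2 \<Rightarrow> real^2) \<Rightarrow> (real^2 \<Rightarrow> real) \<Rightarrow> bool" where
  "J_harmonic D J u \<longleftrightarrow> smooth_on D u \<and>
     (\<forall>x\<in>D. \<forall>h k. dd (\<lambda>z. dd u z (J z k)) x h = dd (\<lambda>z. dd u z (J z h)) x k)"

lemma harmonic_conjugate: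
  assumes u: "J_harmonic D J u" and B: "ball c r \<subseteq> D" and D: "open D"
    and J: "\<And>z. z \<in> D \<Longrightarrow> linear (J z)" "\<And>k. smooth_on D (\<lambda>z. J z k)"
  obtains v where "\<And>x. x \<in> ball c r \<Longrightarrow> (v has_derivative (\<lambda>h. dd u x (J x h))) (at x)"
    "smooth_on (ball c r) v"
proof -
  have su: "smooth_on D u" using u by (simp add: J_harmonic_def)
  \<comment> \<open>The vector field that represents the one-form du o J with respect to the
    Euclidean inner product.\<close>
  define A where "A = (\<lambda>x. \<Sum>b\<in>Basis. dd u x (J x b) *\<^sub>R b)"
  have sJ: "smooth_on D (\<lambda>x. dd u x (J x b))" for b
    by (rule smooth_on_dd_field[OF su D J(2)])
  have sA: "smooth_on D A"
    unfolding A_def by (intro smooth_on_sum smooth_on_scaleR sJ smooth_on_const D)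
  have A: "A x \<bullet> h = dd u x (J x h)" if "x \<in> D" for x h
  proof -
    have lin: "linear (\<lambda>h. dd u x (J x h))"
      using linear_compose[OF J(1)[OF that] bounded_linear.linear[OF bounded_linear_dd[OF su D that]]]
      by (simp add: o_def)
    have "dd u x (J x h) = dd u x (J x (\<Sum>b\<in>Basis. (h \<bullet> b) *\<^sub>R b))"
      by (simp only: euclidean_representation)
    also have "\<dots> = (\<Sum>b\<in>Basis. dd u x (J x b) * (h \<bullet> b))"
      by (simp add: linear_sum[OF lin] linear_scale[OF lin] mult.commute del: euclidean_representation)
    also have "\<dots> = A x \<bullet> h"
      by (simp add: A_def inner_sum_left inner_commute[of h])
    finally show ?thesis by simp
  qed
  have dA: "dd A x h \<bullet> k = dd (\<lambda>z. dd u z (J z k)) x h" if "x \<in> D" for x h k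
  proof -
    have "dd (\<lambda>z. dd u z (J z k)) x = dd (\<lambda>z. A z \<bullet> k) x"
      by (rule dd_cong[OF D that]) (simp add: A)
    then show ?thesis
      by (simp add: dd_bounded_linear_comp[OF bounded_linear_inner_left smooth_onD[OF sA D that]])
  qed
  obtain v where v: "\<And>x. x \<in> ball c r \<Longrightarrow> (v has_derivative (\<lambda>h. A x \<bullet> h)) (at x)"
  proof (rule poincare_ball)
    show "smooth_on (ball c r) A" by (rule smooth_on_subset[OF sA B])
    show "dd A x h \<bullet> k = dd A x k \<bullet> h" if "x \<in> ball c r" for x h k
      using that B u by (auto simp: dA J_harmonic_def subset_iff)
  qed blast
  show ?thesis
  proof
    show v': "(v has_derivative (\<lambda>h. dd u x (J x h))) (at x)" if "x \<in> ball c r" for x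
      using v[OF that] A[of x] B that by (simp add: subset_iff)
    show "smooth_on (ball c r) v"
      by (rule smooth_onI_derivative[OF open_ball v' smooth_on_subset[OF sJ B]])
  qed
qed

text \<open>Near \<open>x0\<close>, \<open>u0\<close> and its conjugate are isothermal coordinates, in which \<open>u\<close> and its conjugate
  form a holomorphic function.\<close>

lemma unique_continuation:
  assumes D: "open D" "x0 \<in> D"
    and J: "\<And>z. z \<in> D \<Longrightarrow> linear (J z)" "\<And>k. smooth_on D (\<lambda>z. J z k)"
      "\<And>z h. z \<in> D \<Longrightarrow> J z (J z h) = - h"
    and u0: "J_harmonic D J u0" "dd u0 x0 a \<noteq> 0"
  obtains N where "open N" "x0 \<in> N" "N \<subseteq> D"
    "\<And>u \<kappa> N0 y. J_harmonic D J u \<Longrightarrow> open N0 \<Longrightarrow> N0 \<noteq> {} \<Longrightarrow> N0 \<subseteq> N \<Longrightarrow>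
       (\<And>z. z \<in> N0 \<Longrightarrow> u z = \<kappa>) \<Longrightarrow> y \<in> N \<Longrightarrow> u y = \<kappa>"
proof -
  obtain r where r: "r > 0" "ball x0 r \<subseteq> D" using D openE by blast
  let ?B = "ball x0 r"
  have x0: "x0 \<in> ?B" using r by simp
  obtain v0 where v0: "\<And>x. x \<in> ?B \<Longrightarrow> (v0 has_derivative (\<lambda>h. dd u0 x (J x h))) (at x)"
    "smooth_on ?B v0"
    using harmonic_conjugate[OF u0(1) r(2) D(1) J(1,2)] by blast
  \<comment> \<open>The coordinate change has to map \<open>real^2\<close> to itself, while
    holomorphy lives on \<open>complex\<close>; this is the identification of the two.\<close>
  define \<iota> :: "complex \<Rightarrow> real^2" where "\<iota> = (\<lambda>c. Re c *\<^sub>R axis 1 1 + Im c *\<^sub>R axis 2 1)"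
  have bl\<iota>: "bounded_linear \<iota>"
    unfolding \<iota>_def by (intro bounded_linear_add bounded_linear_scaleR_left[THEN bounded_linear_compose]
        bounded_linear_Re bounded_linear_Im)
  have \<iota>_eq: "\<iota> c = \<iota> d \<longleftrightarrow> c = d" for c d
    by (auto simp: \<iota>_def vec_eq_iff forall_2 axis_def complex_eq_iff)
  have \<iota>_surj: "\<exists>c. y = \<iota> c" for y
    by (rule exI[of _ "Complex (y$1) (y$2)"]) (auto simp: \<iota>_def vec_eq_iff forall_2 axis_def)
  define \<psi> where "\<psi> = (\<lambda>x. \<iota> (Complex (u0 x) (v0 x)))"
  have su0: "smooth_on ?B u0" using u0 r smooth_on_subset by (auto simp: J_harmonic_def)
  have s\<psi>: "smooth_on ?B \<psi>"
    unfolding \<psi>_def \<iota>_def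
    by (intro smooth_on_add smooth_on_scaleR smooth_on_const open_ball) (use su0 v0(2) in auto)
  have d\<psi>: "dd \<psi> x = (\<lambda>h. \<iota> (Complex (dd u0 x h) (dd u0 x (J x h))))" if "x \<in> ?B" for x
    unfolding \<psi>_def \<iota>_def
    by (rule dd_eqI, simp, intro has_derivative_add has_derivative_scaleR_left
        smooth_onD[OF su0 open_ball that] v0(1)[OF that])
  \<comment> \<open>A nonzero h in the kernel would make du0 vanish on h and on J h, which span the
    plane, against the hypothesis on a.\<close>
  have inj: "h = 0" if "dd \<psi> x0 h = 0" for h
  proof (rule ccontr)
    assume "h \<noteq> 0"
    then obtain \<alpha> \<beta> where ab: "a = \<alpha> *\<^sub>R h + \<beta> *\<^sub>R J x0 h"
      using complex_structure_span[OF J(1)[OF D(2)] J(3)[OF D(2)]] by metis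
    have "dd u0 x0 h = 0" "dd u0 x0 (J x0 h) = 0"
      using that \<iota>_eq[of "Complex (dd u0 x0 h) (dd u0 x0 (J x0 h))" 0]
        linear_0[OF bounded_linear.linear[OF bl\<iota>]] by (auto simp: d\<psi>[OF x0] complex_eq_iff)
    then have "dd u0 x0 a = 0"
      using bounded_linear_dd[OF su0 open_ball x0]
      by (simp add: ab bounded_linear.linear linear_add linear_scale)
    then show False using u0(2) by simp
  qed
  obtain N e g where N: "open N" "N \<subseteq> ?B" "x0 \<in> N" "e > 0" "homeomorphism N (ball (\<psi> x0) e) \<psi> g"
    "\<And>y. y \<in> ball (\<psi> x0) e \<Longrightarrow> (g has_derivative inv (dd \<psi> (g y))) (at y)"
    "\<And>y. y \<in> N \<Longrightarrow> bij (dd \<psi> y)"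
    using local_diffeo[OF open_ball x0 s\<psi> inj] by blast
  let ?T = "ball (\<psi> x0) e"
  have gN: "g y \<in> N" if "y \<in> ?T" for y using N(5) that unfolding homeomorphism_def by blast
  have g\<psi>: "g (\<psi> y) = y" "\<psi> y \<in> ?T" if "y \<in> N" for y using N(5) that unfolding homeomorphism_def by auto
  define T where "T = \<iota> -` ?T"
  have "continuous_on UNIV \<iota>" using bl\<iota> linear_continuous_on by blast
  then have oT: "open T" unfolding T_def by (intro open_vimage open_ball)
  have convT: "convex T" unfolding T_def
    using convex_linear_vimage[OF bounded_linear.linear[OF bl\<iota>]] convex_ball by blast
  have main: "u y = \<kappa>" if u: "J_harmonic D J u" and N0: "open N0" "N0 \<noteq> {}" "N0 \<subseteq> N"
    and const: "\<And>z. z \<in> N0 \<Longrightarrow> u z = \<kappa>" and y: "y \<in> N" for u \<kappa> N0 y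
  proof -
    have su: "smooth_on D u" using u by (auto simp: J_harmonic_def)
    obtain v where v: "\<And>x. x \<in> ?B \<Longrightarrow> (v has_derivative (\<lambda>h. dd u x (J x h))) (at x)"
      using harmonic_conjugate[OF u r(2) D(1) J(1,2)] by blast
    define H where "H = (\<lambda>c. Complex (u (g (\<iota> c))) (v (g (\<iota> c))))"
    define H' where "H' = (\<lambda>c. let k = inv (dd \<psi> (g (\<iota> c))) (\<iota> 1); x = g (\<iota> c)
      in Complex (dd u x k) (dd u x (J x k)))"
    have H: "(H has_field_derivative H' c) (at c)" if c: "c \<in> T" for c
    proof -
      define x where "x = g (\<iota> c)"
      have \<iota>c: "\<iota> c \<in> ?T" using c by (simp add: T_def)
      have xN: "x \<in> N" using gN[OF \<iota>c] by (simp add: x_def)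
      have xB: "x \<in> ?B" and xD: "x \<in> D" using xN N(2) r(2) by auto
      define P where "P = inv (dd \<psi> x)"
      have bij: "bij (dd \<psi> x)" by (rule N(7)[OF xN])
      have P: "dd \<psi> x (P k) = k" "P (dd \<psi> x k) = k" for k
        using bij by (auto simp: P_def bij_is_surj surj_f_inv_f bij_is_inj inv_f_f)
      have dg: "((\<lambda>c. g (\<iota> c)) has_derivative (\<lambda>h. P (\<iota> h))) (at c)"
        using has_derivative_compose[OF bounded_linear_imp_has_derivative[OF bl\<iota>] N(6)[OF \<iota>c]]
        by (simp add: P_def x_def)
      define W where "W = (\<lambda>h. Complex (dd u x (P (\<iota> h))) (dd u x (J x (P (\<iota> h)))))"
      have "((\<lambda>c. u (g (\<iota> c))) has_derivative (\<lambda>h. dd u x (P (\<iota> h)))) (at c)"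
        using has_derivative_compose[OF dg[unfolded x_def]] smooth_onD[OF su D(1) xD] by (simp add: x_def)
      moreover have "((\<lambda>c. v (g (\<iota> c))) has_derivative (\<lambda>h. dd u x (J x (P (\<iota> h))))) (at c)"
        using has_derivative_compose[OF dg[unfolded x_def]] v[OF xB] by (simp add: x_def)
      ultimately have HW: "(H has_derivative W) (at c)"
        unfolding H_def W_def Complex_eq
        by (intro has_derivative_add has_derivative_mult_right has_derivative_of_real)
      have lu: "linear (dd u x)" using bounded_linear_dd[OF su D(1) xD] bounded_linear.linear by blast
      have lu0: "linear (dd u0 x)" using bounded_linear_dd[OF su0 open_ball xB] bounded_linear.linear by blast
      \<comment> \<open>The Cauchy-Riemann equations: both the coordinates (u0, v0) and the pair (u,
        v) have differentials that turn -J into multiplication by i.\<close>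
      have WI: "W (\<i> * h) = \<i> * W h" for h
      proof -
        have "dd \<psi> x (- J x (P (\<iota> h))) = \<iota> (\<i> * h)"
        proof -
          have "\<iota> h = \<iota> (Complex (dd u0 x (P (\<iota> h))) (dd u0 x (J x (P (\<iota> h)))))"
            using P(1)[of "\<iota> h"] by (simp add: d\<psi>[OF xB])
          then have h: "h = Complex (dd u0 x (P (\<iota> h))) (dd u0 x (J x (P (\<iota> h))))"
            by (simp add: \<iota>_eq)
          have "dd \<psi> x (- J x (P (\<iota> h))) = \<iota> (Complex (- dd u0 x (J x (P (\<iota> h)))) (dd u0 x (P (\<iota> h))))"
            by (simp add: d\<psi>[OF xB] linear_neg[OF J(1)[OF xD]] linear_neg[OF lu0] J(3)[OF xD])
          also have "Complex (- dd u0 x (J x (P (\<iota> h)))) (dd u0 x (P (\<iota> h))) = \<i> * h"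
            by (subst (3) h) (simp add: complex_eq_iff)
          finally show ?thesis .
        qed
        then have "P (\<iota> (\<i> * h)) = - J x (P (\<iota> h))" using P(2) by metis
        then show ?thesis
          by (simp add: W_def linear_neg[OF J(1)[OF xD]] linear_neg[OF lu] J(3)[OF xD] complex_eq_iff)
      qed
      have lW: "linear W" using HW has_derivative_linear by blast
      have "W = (*) (H' c)"
      proof (rule ext)
        fix h
        have "W h = W (Re h *\<^sub>R 1 + Im h *\<^sub>R (\<i> * 1))"
          by (rule arg_cong[of _ _ W]) (simp add: complex_eq_iff)
        also have "\<dots> = Re h *\<^sub>R W 1 + Im h *\<^sub>R (\<i> * W 1)"
          by (simp only: linear_add[OF lW] linear_scale[OF lW] WI)
        also have "\<dots> = W 1 * h" by (simp add: complex_eq_iff)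
        finally show "W h = H' c * h" by (simp add: H'_def W_def P_def x_def Let_def)
      qed
      then show ?thesis using HW unfolding has_field_derivative_def by simp
    qed
    then have hol: "H holomorphic_on T"
      using oT by (auto simp: holomorphic_on_open)
    have dH: "deriv H c = H' c" if "c \<in> T" for c using DERIV_imp_deriv[OF H[OF that]] .
    define O0 where "O0 = {c \<in> T. g (\<iota> c) \<in> N0}"
    have "O0 = T \<inter> (\<lambda>c. g (\<iota> c)) -` N0" by (auto simp: O0_def)
    moreover have "continuous_on T (\<lambda>c. g (\<iota> c))"
    proof (rule continuous_on_compose2[of ?T g T \<iota>])
      show "continuous_on ?T g" using N(5) unfolding homeomorphism_def by blast
      show "continuous_on T \<iota>" using bl\<iota> linear_continuous_on by blast
    qed (auto simp: T_def)
    ultimately have O0: "open O0" using continuous_open_preimage oT N0(1) by metis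
    obtain z0 where z0: "z0 \<in> N0" using N0(2) by blast
    obtain c0 where c0: "\<psi> z0 = \<iota> c0" using \<iota>_surj by blast
    have c0O: "c0 \<in> O0"
      using g\<psi>[of z0] z0 N0(3) c0 by (auto simp: O0_def T_def)
    \<comment> \<open>The identity theorem is applied to the derivative of H: on \<open>O0\<close>
      only the real part of H is known to be constant, but du = 0 kills both components of
      H'.\<close>
    have "deriv H c = 0" if c: "c \<in> T" for c
    proof (rule analytic_continuation_open[OF O0 oT _ convex_connected[OF convT],
          where f = "deriv H" and g = "\<lambda>_. 0"])
      show "O0 \<noteq> {}" "O0 \<subseteq> T" using c0O by (auto simp: O0_def)
      show "deriv H holomorphic_on T" by (rule holomorphic_deriv[OF hol oT])
      fix c assume c: "c \<in> O0"
      have "dd u (g (\<iota> c)) = dd (\<lambda>_. \<kappa>) (g (\<iota> c))"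
        by (rule dd_cong[OF N0(1)]) (use c const in \<open>auto simp: O0_def\<close>)
      also have "\<dots> = (\<lambda>h. 0)" by (rule dd_eqI) simp
      finally show "deriv H c = 0"
        using dH[of c] c by (simp add: H'_def O0_def Let_def complex_eq_iff)
    qed (use c in auto)
    then have "(H has_field_derivative 0) (at c within T)" if "c \<in> T" for c
      using H[OF that] dH[OF that] that by (metis has_field_derivative_at_within)
    then obtain C where C: "\<And>c. c \<in> T \<Longrightarrow> H c = C"
      using has_field_derivative_zero_constant[OF convT] by blast
    obtain c where c: "\<psi> y = \<iota> c" using \<iota>_surj by blast
    have cT: "c \<in> T" using g\<psi>[OF y] c by (auto simp: T_def)
    have "u y = Re (H c)" using g\<psi>[OF y] c by (simp add: H_def)
    also have "\<dots> = Re (H c0)" using C[OF cT] C[of c0] c0O by (simp add: O0_def)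
    also have "\<dots> = \<kappa>" using c0O const by (simp add: H_def O0_def)
    finally show ?thesis .
  qed
  show ?thesis
    by (rule that[OF N(1) N(3)]) (use N(2) r(2) main in auto)
qed

section \<open>Linear algebra of Minkowski space\<close>

lemma mink_commute: "mink v w = mink w v"
  by (simp add: mink_def mult.commute)

lemma mink_linear [simp]:
  "mink (u + v) w = mink u w + mink v w" "mink w (u + v) = mink w u + mink w v"
  "mink (u - v) w = mink u w - mink v w" "mink w (u - v) = mink w u - mink w v"
  "mink (- v) w = - mink v w" "mink w (- v) = - mink w v"
  "mink (s *\<^sub>R v) w = s * mink v w" "mink w (s *\<^sub>R v) = s * mink w v"
  "mink 0 w = 0" "mink w 0 = 0"
  by (simp_all add: mink_def algebra_simps)

lemma bounded_bilinear_mink: "bounded_bilinear mink"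
  unfolding bilinear_conv_bounded_bilinear[symmetric] bilinear_def
  by (auto intro!: linearI)

lemma bounded_bilinear_wedge: "bounded_bilinear wedge"
  unfolding bilinear_conv_bounded_bilinear[symmetric] bilinear_def
  by (auto intro!: linearI simp: wedge_def vec_eq_iff algebra_simps)

definition eta :: "real^4 \<Rightarrow> real^4" where
  "eta v = (\<chi> i. if i = 1 then - (v$i) else v$i)"

lemma inner_eta: "v \<bullet> eta w = mink v w"
  by (simp add: inner_vec_def sum_4 eta_def mink_def)

lemma null_time_component_nonzero: "mink v v = 0 \<Longrightarrow> v \<noteq> 0 \<Longrightarrow> v$1 \<noteq> 0"
  by (auto simp: mink_def vec_eq_iff forall_4 add_nonneg_eq_0_iff)

text \<open>The combination of a and b with vanishing time component is again null, and a null
  vector without time component is zero.\<close>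

lemma null_orthogonal_parallel:
  assumes "mink a a = 0" "mink b b = 0" "mink a b = 0"
  shows "b$1 *\<^sub>R a = a$1 *\<^sub>R b"
proof -
  define c where "c = b$1 *\<^sub>R a - a$1 *\<^sub>R b"
  have "mink c c = 0" using assms by (simp add: c_def mink_commute[of b a])
  moreover have "c$1 = 0" by (simp add: c_def)
  ultimately have "c = 0" using null_time_component_nonzero by blast
  then show ?thesis by (simp add: c_def)
qed

text \<open>Otherwise, with t' and n' the spatial parts, orthogonality and Cauchy-Schwarz give (t1
  n1)^2 = (t' . n')^2 \<le> |t'|^2 |n'|^2 < (t1 n1)^2.\<close>

lemma timelike_orthogonal:
  assumes t: "mink t t < 0" and n: "mink t n = 0" "n \<noteq> 0"
  shows "mink n n > 0"
proof (rule ccontr)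
  define T where "T = (t$2)\<^sup>2 + (t$3)\<^sup>2 + (t$4)\<^sup>2"
  define N where "N = (n$2)\<^sup>2 + (n$3)\<^sup>2 + (n$4)\<^sup>2"
  assume "\<not> ?thesis"
  then have N: "N \<le> (n$1)\<^sup>2" by (simp add: mink_def N_def power2_eq_square)
  have T: "T < (t$1)\<^sup>2" "0 \<le> T" using t by (simp_all add: mink_def T_def power2_eq_square)
  have n1: "n$1 \<noteq> 0"
  proof
    assume "n$1 = 0"
    then have "n$1 = 0 \<and> n$2 = 0 \<and> n$3 = 0 \<and> n$4 = 0"
      using N unfolding N_def by (smt (verit) power2_less_eq_zero_iff zero_le_power2)
    then show False using n by (simp add: vec_eq_iff forall_4)
  qed
  have "T * N \<le> T * (n$1)\<^sup>2" using N T(2) by (rule mult_left_mono)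
  also have "\<dots> < (t$1)\<^sup>2 * (n$1)\<^sup>2" using T(1) n1 by (intro mult_strict_right_mono) auto
  also have "\<dots> = (t$2 * n$2 + t$3 * n$3 + t$4 * n$4)\<^sup>2"
  proof -
    have "t$1 * n$1 = t$2 * n$2 + t$3 * n$3 + t$4 * n$4" using n(1) by (simp add: mink_def)
    then show ?thesis unfolding power_mult_distrib[symmetric] by (rule arg_cong)
  qed
  also have "\<dots> \<le> T * N"
  proof -
    \<comment> \<open>Lagrange's identity, which is Cauchy-Schwarz with its defect written as
      squares.\<close>
    have "T * N - (t$2 * n$2 + t$3 * n$3 + t$4 * n$4)\<^sup>2 =
        (t$2 * n$3 - t$3 * n$2)\<^sup>2 + (t$2 * n$4 - t$4 * n$2)\<^sup>2 + (t$3 * n$4 - t$4 * n$3)\<^sup>2"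
      unfolding T_def N_def by (simp add: power2_eq_square algebra_simps)
    also have "\<dots> \<ge> 0" by simp
    finally show ?thesis by simp
  qed
  finally show False by simp
qed

section \<open>Volume form and orthonormal frames\<close>

definition vol :: "real^4 \<Rightarrow> real^4 \<Rightarrow> real^4 \<Rightarrow> real^4 \<Rightarrow> real" where
  "vol a b c d = det (vector [a, b, c, d] :: real^4^4)"

text \<open>Laplace expansion along the first two rows. It expresses the determinant through 2 x 2
  minors, that is through components of wedge products, which reduces later identities to polynomial
  ones.\<close>

lemma det_4:
  fixes A :: "real^4^4"
  defines "P \<equiv> wedge (A$1) (A$2)" and "Q \<equiv> wedge (A$3) (A$4)"
  shows "det A = P$1$2 * Q$3$4 - P$1$3 * Q$2$4 + P$1$4 * Q$2$3 + P$2$3 * Q$1$4 - P$2$4 * Q$1$3 + P$3$4 * Q$1$2"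
proof -
  have f: "finite {2::4, 3, 4}" "1 \<notin> {2::4, 3, 4}" "finite {3::4, 4}" "2 \<notin> {3::4, 4}"
    "finite {4::4}" "3 \<notin> {4::4}" by auto
  have d: "1 \<noteq> (2::4)" "1 \<noteq> (3::4)" "1 \<noteq> (4::4)" "2 \<noteq> (3::4)" "2 \<noteq> (4::4)" "3 \<noteq> (4::4)"
    "2 \<noteq> (1::4)" "3 \<noteq> (1::4)" "4 \<noteq> (1::4)" "3 \<noteq> (2::4)" "4 \<noteq> (2::4)" "4 \<noteq> (3::4)" by auto
  have s: "sum g {1,2,3,4} = g 1 + g 2 + g 3 + g 4" "sum g {2,3,4} = g 2 + g 3 + g 4"
    "sum g {3,4} = g 3 + g 4" "prod g {1,2,3,4} = g 1 * g 2 * g 3 * g 4" for g :: "4 \<Rightarrow> real"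
    by (simp_all add: d mult.assoc)
  have "det A = (\<Sum>p | p permutes {1,2,3,4}. of_int (sign p) * (\<Prod>i\<in>{1,2,3,4}. A$i$p i))"
    unfolding det_def UNIV_4 ..
  then show ?thesis
    apply (rule trans)
    apply (simp only: sum_over_permutations_insert[OF f(1,2)])
    apply (simp only: sum_over_permutations_insert[OF f(3,4)])
    apply (simp only: sum_over_permutations_insert[OF f(5,6)])
    apply (simp only: permutes_sing s Collect_conv_if singleton_conv sum.insert finite.emptyI
        empty_iff not_False_eq_True sum.empty add_0_right comp_id)
    apply (simp only: sign_compose permutation_compose permutation_swap_id sign_swap_id d simp_thms
        if_True if_False sign_id permutation_id comp_id id_comp transpose_same)
    apply (simp only: o_def transpose_def d simp_thms if_True if_False id_def)
    apply (simp add: P_def Q_def wedge_def algebra_simps)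
    done
qed

lemma vol_wedge:
  "vol a b c d = wedge a b$1$2 * wedge c d$3$4 - wedge a b$1$3 * wedge c d$2$4 + wedge a b$1$4 * wedge c d$2$3
     + wedge a b$2$3 * wedge c d$1$4 - wedge a b$2$4 * wedge c d$1$3 + wedge a b$3$4 * wedge c d$1$2"
  unfolding vol_def det_4 vector_4 ..

lemma wedge_component: "wedge v w$i$j = v$i * w$j - v$j * w$i"
  by (simp add: wedge_def)

lemmas vol_expand = vol_wedge wedge_component

lemma vol_plane:
  "vol a b (s1 *\<^sub>R a + s2 *\<^sub>R b + s3 *\<^sub>R c + s4 *\<^sub>R d) (t1 *\<^sub>R a + t2 *\<^sub>R b + t3 *\<^sub>R c + t4 *\<^sub>R d)
    = (s3 * t4 - s4 * t3) * vol a b c d"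
  unfolding vol_expand vector_add_component vector_scaleR_component real_scaleR_def
  by algebra

lemma vol_lincomb:
  "vol (s1 *\<^sub>R a + s2 *\<^sub>R b) (t1 *\<^sub>R a + t2 *\<^sub>R b) c d = (s1 * t2 - s2 * t1) * vol a b c d"
  unfolding vol_expand vector_add_component vector_scaleR_component real_scaleR_def
  by algebra

text \<open>The product of the row matrix with the transpose of its image under \<open>eta\<close>
  is the Minkowski Gram matrix, here diagonal; the minus sign is the determinant of the
  metric.\<close>

lemma vol_orthogonal:
  assumes "mink a b = 0" "mink a c = 0" "mink a d = 0" "mink b c = 0" "mink b d = 0" "mink c d = 0"
  shows "(vol a b c d)\<^sup>2 = - (mink a a * mink b b * mink c c * mink d d)"
proof -
  define B :: "real^4^4" where "B = vector [a, b, c, d]"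
  define E :: "real^4^4" where "E = vector [eta a, eta b, eta c, eta d]"
  have BE: "B ** transpose E = (\<chi> i j. mink (B$i) (B$j))"
    by (simp add: matrix_matrix_mult_def transpose_def vec_eq_iff forall_4 sum_4 B_def E_def vector_4 eta_def mink_def)
  have "det (B ** transpose E) = mink a a * mink b b * mink c c * mink d d"
  proof -
    have "\<forall>i j. i \<noteq> j \<longrightarrow> mink (B$i) (B$j) = 0"
      using assms by (simp add: forall_4 B_def vector_4 mink_commute)
    then have "det (B ** transpose E) = (\<Prod>i\<in>UNIV. mink (B$i) (B$i))"
      unfolding BE by (subst det_diagonal) auto
    moreover have "prod g (UNIV::4 set) = g 1 * g 2 * g 3 * g 4" for g :: "4 \<Rightarrow> real"
      unfolding UNIV_4 by (simp add: mult.assoc)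
    ultimately show ?thesis by (simp add: B_def vector_4)
  qed
  moreover have "det E = - det B"
  proof -
    have w: "wedge (eta v) (eta w)$1$2 = - wedge v w$1$2" "wedge (eta v) (eta w)$1$3 = - wedge v w$1$3"
      "wedge (eta v) (eta w)$1$4 = - wedge v w$1$4" "wedge (eta v) (eta w)$2$3 = wedge v w$2$3"
      "wedge (eta v) (eta w)$2$4 = wedge v w$2$4" "wedge (eta v) (eta w)$3$4 = wedge v w$3$4" for v w
      by (simp_all add: wedge_component eta_def)
    show ?thesis unfolding det_4 B_def E_def vector_4 w by simp
  qed
  ultimately show ?thesis
    by (simp add: det_mul det_transpose vol_def B_def power2_eq_square)
qed

lemma vol_nonzero_nondegenerate:
  assumes "vol a b c d \<noteq> 0" "mink a x = 0" "mink b x = 0" "mink c x = 0" "mink d x = 0"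
  shows "x = 0"
proof -
  define B :: "real^4^4" where "B = vector [a, b, c, d]"
  have "B *v eta x = 0"
    using assms(2-5) by (simp add: matrix_vector_mul_component vec_eq_iff forall_4 B_def vector_4 inner_eta)
  moreover have "invertible B" using assms(1) by (simp add: vol_def B_def invertible_det_nz)
  ultimately have "eta x = 0"
    using inj_matrix_vector_mult[of B] by (metis injD matrix_vector_mult_0_right)
  then show ?thesis by (auto simp: eta_def vec_eq_iff split: if_splits)
qed

text \<open>The signs of e3 and e4 are left open because \<open>adapted_frame\<close> allows either
  normal vector to be the time-like one.\<close>

definition lorentz_frame :: "real^4 \<Rightarrow> real^4 \<Rightarrow> real^4 \<Rightarrow> real^4 \<Rightarrow> bool" where
  "lorentz_frame e1 e2 e3 e4 \<longleftrightarrow> mink e1 e1 = 1 \<and> mink e2 e2 = 1 \<and> \<bar>mink e3 e3\<bar> = 1 \<and> \<bar>mink e4 e4\<bar> = 1 \<and>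
     mink e1 e2 = 0 \<and> mink e1 e3 = 0 \<and> mink e1 e4 = 0 \<and> mink e2 e3 = 0 \<and> mink e2 e4 = 0 \<and> mink e3 e4 = 0 \<and>
     vol e1 e2 e3 e4 > 0"

text \<open>The square of the volume is minus the product of the two normal signs; being positive,
  it forces opposite signs and volume 1. The expansion holds since the difference of its sides is
  orthogonal to all four vectors.\<close>

lemma lorentz_frameD:
  assumes "lorentz_frame e1 e2 e3 e4"
  shows "vol e1 e2 e3 e4 = 1" "mink e3 e3 * mink e4 e4 = -1"
    "x = mink x e1 *\<^sub>R e1 + mink x e2 *\<^sub>R e2 + (mink e3 e3 * mink x e3) *\<^sub>R e3 + (mink e4 e4 * mink x e4) *\<^sub>R e4"
proof -
  note f = assms[unfolded lorentz_frame_def]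
  have sq: "(vol e1 e2 e3 e4)\<^sup>2 = - (mink e3 e3 * mink e4 e4)"
    using vol_orthogonal[of e1 e2 e3 e4] f by simp
  have e34: "mink e3 e3 = 1 \<or> mink e3 e3 = -1" "mink e4 e4 = 1 \<or> mink e4 e4 = -1" using f by auto
  have "0 < (vol e1 e2 e3 e4)\<^sup>2" using f by simp
  then show m: "mink e3 e3 * mink e4 e4 = -1" using e34 sq by auto
  then have "(vol e1 e2 e3 e4)\<^sup>2 = 1\<^sup>2" using sq by simp
  then show "vol e1 e2 e3 e4 = 1" using f power2_eq_iff_nonneg[of "vol e1 e2 e3 e4" 1] by simp
  define y where "y = x - (mink x e1 *\<^sub>R e1 + mink x e2 *\<^sub>R e2 + (mink e3 e3 * mink x e3) *\<^sub>R e3 + (mink e4 e4 * mink x e4) *\<^sub>R e4)"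
  have s: "mink e3 e3 * mink e3 e3 = 1" "mink e4 e4 * mink e4 e4 = 1" using e34 by auto
  have "y = 0"
  proof (rule vol_nonzero_nondegenerate)
    show "vol e1 e2 e3 e4 \<noteq> 0" using f by simp
    show "mink e1 y = 0" "mink e2 y = 0" using f by (simp_all add: y_def mink_commute)
    have "mink e3 e3 * (mink e3 e3 * mink x e3) = mink x e3" "mink e4 e4 * (mink e4 e4 * mink x e4) = mink x e4"
      unfolding mult.assoc[symmetric] s by simp_all
    then show "mink e3 y = 0" "mink e4 y = 0"
      using f by (simp_all add: y_def mink_commute mult.commute mult.left_commute)
  qed
  then show "x = mink x e1 *\<^sub>R e1 + mink x e2 *\<^sub>R e2 + (mink e3 e3 * mink x e3) *\<^sub>R e3 + (mink e4 e4 * mink x e4) *\<^sub>R e4"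
    by (simp add: y_def)
qed

lemma lorentz_frame_exists:
  assumes "mink e1 e1 = 1" "mink e2 e2 = 1" "mink e1 e2 = 0"
  obtains e3 e4 where "lorentz_frame e1 e2 e3 e4"
proof -
  \<comment> \<open>Removing the tangential part of the time axis only makes it more time-like, so
    it can be normalised to e3.\<close>
  define t :: "real^4" where "t = axis 1 1"
  define n where "n = t - mink t e1 *\<^sub>R e1 - mink t e2 *\<^sub>R e2"
  have tt: "mink t t = -1" by (simp add: t_def mink_def axis_def)
  have sym: "mink e1 t = mink t e1" "mink e2 t = mink t e2" "mink e2 e1 = 0"
    using assms by (simp_all add: mink_commute)
  have "mink n n = -1 - (mink t e1)\<^sup>2 - (mink t e2)\<^sup>2"
    using assms tt by (simp add: n_def sym power2_eq_square algebra_simps)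
  then have nn: "mink n n < 0" by (smt (verit) zero_le_power2)
  define e3 where "e3 = (1 / sqrt (- mink n n)) *\<^sub>R n"
  have e33: "mink e3 e3 = -1"
    using nn by (simp add: e3_def field_simps)
  have e3: "mink e1 e3 = 0" "mink e2 e3 = 0"
    using assms by (simp_all add: e3_def n_def sym)
  \<comment> \<open>Euclidean orthogonality to these three vectors is Minkowski orthogonality to e1,
    e2, e3. Dimension 4 leaves a nonzero solution, space-like because e3 is time-like.\<close>
  have "dim {eta e1, eta e2, eta e3} \<le> card {eta e1, eta e2, eta e3}" by (rule dim_le_card') simp
  also have "\<dots> \<le> 3" by (simp add: card_insert_if)
  finally have "dim {eta e1, eta e2, eta e3} < DIM(real^4)" by simp
  then obtain m where m: "m \<noteq> 0" "\<And>y. y \<in> span {eta e1, eta e2, eta e3} \<Longrightarrow> orthogonal m y"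
    using orthogonal_to_subspace_exists by metis
  have m0: "mink m e1 = 0" "mink m e2 = 0" "mink m e3 = 0"
    using m(2)[OF span_base, of "eta e1"] m(2)[OF span_base, of "eta e2"] m(2)[OF span_base, of "eta e3"]
    by (auto simp: orthogonal_def inner_eta)
  have mm: "mink m m > 0"
    using timelike_orthogonal[of e3 m] e33 m0 m(1) by (simp add: mink_commute)
  define e where "e = (1 / sqrt (mink m m)) *\<^sub>R m"
  have ee: "mink e e = 1" "mink e1 e = 0" "mink e2 e = 0" "mink e3 e = 0"
    using mm m0 by (simp_all add: e_def field_simps mink_commute)
  have "(vol e1 e2 e3 e)\<^sup>2 = 1"
    using vol_orthogonal[of e1 e2 e3 e] assms e3 e33 ee by simp
  then have v: "vol e1 e2 e3 e \<noteq> 0" by auto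
  have vm: "vol e1 e2 e3 (- e) = - vol e1 e2 e3 e"
    unfolding vol_expand vector_uminus_component by algebra
  show ?thesis
  proof (cases "vol e1 e2 e3 e > 0")
    case True
    then show ?thesis by (intro that[of e3 e]) (use assms e3 e33 ee in \<open>simp add: lorentz_frame_def\<close>)
  next
    case False
    then show ?thesis by (intro that[of e3 "- e"]) (use assms e3 e33 ee v vm in \<open>simp add: lorentz_frame_def\<close>)
  qed
qed

text \<open>The Hodge dual of v \<and> w, its components read off against the index-lowered
  coordinate vectors; the sign makes the dual of e1 \<and> e2 equal to e3 \<and> e4.\<close>

definition star :: "real^4 \<Rightarrow> real^4 \<Rightarrow> real^4^4" where
  "star v w = (\<chi> i j. - vol v w (eta (axis i 1)) (eta (axis j 1)))"

text \<open>Expanding x and y in the frame leaves the normal minor times the product -1 of the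
  normal signs. Thus e3 \<and> e4 depends on the tangent pair alone, and the normal frame disappears
  from the Gauss map.\<close>

lemma star_lorentz_frame:
  assumes "lorentz_frame e1 e2 e3 e4"
  shows "star e1 e2 = wedge e3 e4"
proof -
  have "\<forall>i. mink (eta (axis i 1)) v = v$i" for v
    by (simp add: forall_4 mink_def eta_def axis_def)
  then have c: "mink (eta (axis i 1)) v = v$i" for i v by simp
  have "vol e1 e2 x y = (mink x e4 * mink y e3 - mink x e3 * mink y e4)" for x y
  proof -
    note D = lorentz_frameD[OF assms]
    have "vol e1 e2 x y = ((mink e3 e3 * mink x e3) * (mink e4 e4 * mink y e4)
       - (mink e4 e4 * mink x e4) * (mink e3 e3 * mink y e3)) * vol e1 e2 e3 e4"
      by (subst D(3)[of x], subst D(3)[of y]) (rule vol_plane)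
    also have "\<dots> = (mink e3 e3 * mink e4 e4) * (mink x e3 * mink y e4 - mink x e4 * mink y e3)"
      unfolding D(1) by algebra
    finally show ?thesis unfolding D(2) by simp
  qed
  then show ?thesis by (simp add: star_def wedge_def c vec_eq_iff mult.commute)
qed

lemma star_lincomb:
  "star (s1 *\<^sub>R a + s2 *\<^sub>R b) (t1 *\<^sub>R a + t2 *\<^sub>R b) = (s1 * t2 - s2 * t1) *\<^sub>R star a b"
  by (simp add: star_def vol_lincomb vec_eq_iff)

text \<open>The inverse of the Hodge dual in coordinates. Its constant coefficients let it pass
  through derivatives, so it carries the harmonic map equation from the Gauss map to e1 \<and>
  e2.\<close>

definition hodge :: "real^4^4 \<Rightarrow> real^4^4" where
  "hodge B = vector [vector [0, - (B$3$4), B$2$4, - (B$2$3)], vector [B$3$4, 0, B$1$4, - (B$1$3)],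
     vector [- (B$2$4), - (B$1$4), 0, B$1$2], vector [B$2$3, B$1$3, - (B$1$2), 0]]"

lemma hodge_star: "hodge (star v w) = wedge v w"
  by (simp add: hodge_def star_def wedge_def vec_eq_iff forall_4 vector_4 vol_expand eta_def axis_def)

lemma bounded_linear_hodge: "bounded_linear hodge"
  unfolding linear_conv_bounded_linear[symmetric]
  by (auto intro!: linearI simp: hodge_def vec_eq_iff forall_4 vector_4)

text \<open>The inner product of a bivector with x \<and> y; for B = v \<and> w it is the 2 x 2
  determinant of inner products.\<close>

definition bivector_pairing :: "real^4^4 \<Rightarrow> real^4 \<Rightarrow> real^4 \<Rightarrow> real" where
  "bivector_pairing B x y = (\<Sum>i\<in>UNIV. \<Sum>j\<in>UNIV. B$i$j * eta x$i * eta y$j)"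

lemma bivector_pairing_wedge:
  "bivector_pairing (wedge v w) x y = mink v x * mink w y - mink v y * mink w x"
  by (simp add: bivector_pairing_def wedge_def eta_def mink_def sum_4 algebra_simps)

lemma bounded_linear_bivector_pairing: "bounded_linear (\<lambda>B. bivector_pairing B x y)"
  unfolding linear_conv_bounded_linear[symmetric]
  by (auto intro!: linearI simp: bivector_pairing_def sum_distrib_left algebra_simps sum.distrib)

section \<open>The normal plane\<close>

text \<open>In a Lorentzian plane the orthogonal complement of a null line is that line. In normal
  coordinates the metric is a multiple of x3^2 - x4^2, so a3^2 = a4^2 \<noteq> 0 and a3 b3 = a4 b4
  give b3^2 = b4^2.\<close>

lemma normal_null:
  assumes "mink e1 e1 = 1" "mink e2 e2 = 1" "mink e1 e2 = 0"
    and a: "mink a e1 = 0" "mink a e2 = 0" "mink a a = 0" "a \<noteq> 0"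
    and b: "mink b e1 = 0" "mink b e2 = 0" "mink a b = 0"
  shows "mink b b = 0"
proof -
  obtain e3 e4 where f: "lorentz_frame e1 e2 e3 e4" using lorentz_frame_exists[OF assms(1-3)] .
  define \<epsilon> where "\<epsilon> = mink e3 e3"
  have e: "mink e4 e4 = - \<epsilon>" "\<epsilon> \<noteq> 0"
    using lorentz_frameD(2)[OF f] f[unfolded lorentz_frame_def] by (auto simp: \<epsilon>_def abs_if split: if_splits)
  have D: "x = (\<epsilon> * mink x e3) *\<^sub>R e3 - (\<epsilon> * mink x e4) *\<^sub>R e4" if "mink x e1 = 0" "mink x e2 = 0" for x
    using lorentz_frameD(3)[OF f, of x] e that by (simp add: \<epsilon>_def)
  have M: "mink x y = \<epsilon> * (mink x e3 * mink y e3 - mink x e4 * mink y e4)" if "mink y e1 = 0" "mink y e2 = 0" for x y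
    by (subst D[OF that]) (simp add: algebra_simps)
  have 1: "mink a e3 * mink a e3 = mink a e4 * mink a e4" using M[OF a(1,2), of a] a(3) e(2) by simp
  have 2: "mink a e3 * mink b e3 = mink a e4 * mink b e4" using M[OF b(1,2), of a] b(3) e(2) by simp
  have 3: "mink a e3 \<noteq> 0"
  proof
    assume "mink a e3 = 0"
    moreover from this 1 have "mink a e4 = 0" by simp
    ultimately show False using D[OF a(1,2)] a(4) by simp
  qed
  have "(mink a e3 * mink a e3) * (mink b e3 * mink b e3) = (mink a e3 * mink b e3) * (mink a e3 * mink b e3)" by algebra
  also have "\<dots> = (mink a e4 * mink a e4) * (mink b e4 * mink b e4)" unfolding 2 by algebra
  finally have "mink b e3 * mink b e3 = mink b e4 * mink b e4" using 1 3 by (metis mult_cancel_left mult_eq_0_iff)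
  then show ?thesis using M[OF b(1,2), of b] by simp
qed

lemma null_normal_exists:
  assumes "mink e1 e1 = 1" "mink e2 e2 = 1" "mink e1 e2 = 0"
  obtains l where "l \<noteq> 0" "mink l l = 0" "mink e1 l = 0" "mink e2 l = 0"
proof -
  obtain e3 e4 where f: "lorentz_frame e1 e2 e3 e4" using lorentz_frame_exists[OF assms] .
  note f' = f[unfolded lorentz_frame_def]
  have s: "mink e3 e3 + mink e4 e4 = 0"
    using lorentz_frameD(2)[OF f] f' by (auto simp: abs_if split: if_splits)
  show ?thesis
  \<comment> \<open>The two normal vectors have opposite squared lengths, so their sum is
    null.\<close>
  proof (rule that[of "e3 + e4"])
    have "mink (e3 + e4) e3 \<noteq> 0" using f' by (auto simp: mink_commute)
    then show "e3 + e4 \<noteq> 0" by (metis mink_linear(9))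
  qed (use f' s in \<open>auto simp: mink_commute\<close>)
qed

section \<open>Maximal patches with an orthonormal frame\<close>

lemma dd_mink:
  assumes "(f has_derivative dd f w) (at w)" "(g has_derivative dd g w) (at w)"
  shows "dd (\<lambda>z. mink (f z) (g z)) w h = mink (f w) (dd g w h) + mink (dd f w h) (g w)"
  by (subst dd_eqI[OF bounded_bilinear.FDERIV[OF bounded_bilinear_mink assms]]) simp

lemma dd_wedge:
  assumes "(f has_derivative dd f w) (at w)" "(g has_derivative dd g w) (at w)"
  shows "dd (\<lambda>z. wedge (f z) (g z)) w h = wedge (f w) (dd g w h) + wedge (dd f w h) (g w)"
  by (subst dd_eqI[OF bounded_bilinear.FDERIV[OF bounded_bilinear_wedge assms]]) simp

lemma dd_const: "dd (\<lambda>z. c) w = (\<lambda>h. 0)"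
  by (rule dd_eqI) simp

text \<open>Expanding V in a fixed basis reduces this to the product rule; the term with the
  derivative of V is tangent to the surface.\<close>

lemma dd_dd_field:
  assumes X: "smooth_on D X" and D: "open D" "w \<in> D" and V: "smooth_on D V"
  shows "dd (\<lambda>z. dd X z (V z)) w h = dd (\<lambda>z. dd X z (V w)) w h + dd X w (dd V w h)"
proof -
  have expand: "dd X z v = (\<Sum>b\<in>Basis. (v \<bullet> b) *\<^sub>R dd X z b)" if "z \<in> D" for z v
  proof -
    have lin: "linear (dd X z)" using bounded_linear_dd[OF X D(1) that] bounded_linear.linear by blast
    show ?thesis
      by (subst (1) euclidean_representation[symmetric, of v]) (simp only: linear_sum[OF lin] linear_scale[OF lin])
  qed
  have dV: "((\<lambda>z. V z \<bullet> b) has_derivative (\<lambda>h. dd V w h \<bullet> b)) (at w)" for b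
    using bounded_linear.has_derivative[OF bounded_linear_inner_left smooth_onD[OF V D]] .
  have dX: "((\<lambda>z. dd X z b) has_derivative dd (\<lambda>z. dd X z b) w) (at w)" for b
    by (rule smooth_onD[OF smooth_on_dd[OF X D(1)] D])
  have 1: "dd (\<lambda>z. dd X z (V z)) w = dd (\<lambda>z. \<Sum>b\<in>Basis. (V z \<bullet> b) *\<^sub>R dd X z b) w"
    by (rule dd_cong[OF D expand])
  have 2: "dd (\<lambda>z. dd X z (V w)) w = dd (\<lambda>z. \<Sum>b\<in>Basis. (V w \<bullet> b) *\<^sub>R dd X z b) w"
    by (rule dd_cong[OF D expand])
  have 3: "dd (\<lambda>z. \<Sum>b\<in>Basis. (V z \<bullet> b) *\<^sub>R dd X z b) w =
      (\<lambda>h. \<Sum>b\<in>Basis. (V w \<bullet> b) *\<^sub>R dd (\<lambda>z. dd X z b) w h + (dd V w h \<bullet> b) *\<^sub>R dd X w b)"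
    by (rule dd_eqI, rule has_derivative_sum, rule has_derivative_scaleR[OF dV dX])
  have 4: "dd (\<lambda>z. \<Sum>b\<in>Basis. (V w \<bullet> b) *\<^sub>R dd X z b) w =
      (\<lambda>h. \<Sum>b\<in>Basis. (V w \<bullet> b) *\<^sub>R dd (\<lambda>z. dd X z b) w h)"
    by (rule dd_eqI, rule has_derivative_sum, rule has_derivative_scaleR_right[OF dX])
  show ?thesis
    unfolding 1 2 3 4 by (simp add: sum.distrib expand[OF D(2), of "dd V w h"])
qed

text \<open>Pairing the harmonic map equation for \<open>e1 \<and> e2\<close> with \<open>e1 \<and> e2\<close> and with \<open>\<alpha> \<and> \<beta>\<close>, where
  \<open>\<alpha> = h(e1, e1) = - h(e2, e2)\<close> and \<open>\<beta> = h(e1, e2)\<close>, gives \<open>\<langle>\<alpha>, \<alpha>\<rangle> + \<langle>\<beta>, \<beta>\<rangle> = 0\<close> and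
  \<open>\<langle>\<alpha>, \<alpha>\<rangle> \<langle>\<beta>, \<beta>\<rangle> = \<langle>\<alpha>, \<beta>\<rangle>\<^sup>2\<close>. Here \<open>A\<^sub>i\<close>, \<open>B\<^sub>i\<close> are the derivatives of \<open>e1\<close>, \<open>e2\<close> along \<open>e\<^sub>i\<close>,
  and \<open>C\<^sub>i\<close>, \<open>G\<^sub>i\<close> those of \<open>A\<^sub>i\<close>, \<open>B\<^sub>i\<close>.\<close>

lemma second_fundamental_form_null:
  assumes e: "mink e1 e1 = 1" "mink e2 e2 = 1" "mink e1 e2 = 0"
    and A: "mink A1 e1 = 0" "mink A2 e1 = 0"
    and B: "mink B1 e2 = 0" "mink B2 e2 = 0" "mink B1 e1 = - mink A1 e2" "mink B2 e1 = - mink A2 e2"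
    and C: "mink C1 e1 = - mink A1 A1" "mink C2 e1 = - mink A2 A2"
    and G: "mink G1 e2 = - mink B1 B1" "mink G2 e2 = - mink B2 B2"
    and T: "mink T1 e1 = 0" "mink T2 e2 = 0"
    and eq: "wedge C1 e2 + 2 *\<^sub>R wedge A1 B1 + wedge e1 G1 + (wedge C2 e2 + 2 *\<^sub>R wedge A2 B2 + wedge e1 G2)
      = wedge T1 e2 + wedge e1 T2"
    and \<alpha>: "\<alpha> = A1 - mink A1 e2 *\<^sub>R e2" "\<alpha> = - B2 - mink A2 e2 *\<^sub>R e1"
    and \<beta>: "\<beta> = A2 - mink A2 e2 *\<^sub>R e2" "\<beta> = B1 + mink A1 e2 *\<^sub>R e1"
  shows "mink \<alpha> \<alpha> = 0" "mink \<beta> \<beta> = 0" "mink \<alpha> \<beta> = 0"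
proof -
  let ?P = "\<lambda>B x y. bivector_pairing B x y"
  have lin: "?P (U + V) x y = ?P U x y + ?P V x y" "?P (s *\<^sub>R U) x y = s * ?P U x y" for U V x y s
    using linear_add[OF bounded_linear.linear[OF bounded_linear_bivector_pairing]]
      linear_scale[OF bounded_linear.linear[OF bounded_linear_bivector_pairing]] by auto
  note eqP = arg_cong[OF eq, of "\<lambda>U. ?P U x y" for x y, unfolded lin bivector_pairing_wedge]
  \<comment> \<open>p and q are the values of the connection form of the frame on e1 and e2.\<close>
  define p where "p = mink A1 e2"
  define q where "q = mink A2 e2"
  have e': "mink e2 e1 = 0" using e(3) by (simp add: mink_commute)
  have A': "A1 = \<alpha> + p *\<^sub>R e2" "A2 = \<beta> + q *\<^sub>R e2" using \<alpha>(1) \<beta>(1) by (simp_all add: p_def q_def)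
  have B': "B1 = \<beta> - p *\<^sub>R e1" "B2 = - \<alpha> - q *\<^sub>R e1" using \<alpha>(2) \<beta>(2) by (simp_all add: p_def q_def)
  have n: "mink \<alpha> e1 = 0" "mink \<alpha> e2 = 0" "mink \<beta> e1 = 0" "mink \<beta> e2 = 0"
    using A e e' unfolding \<alpha>(1) \<beta>(1) by simp_all
  have n': "mink e1 \<alpha> = 0" "mink e2 \<alpha> = 0" "mink e1 \<beta> = 0" "mink e2 \<beta> = 0"
    using n by (simp_all add: mink_commute)
  have AA: "mink A1 A1 = mink \<alpha> \<alpha> + p * p" "mink A2 A2 = mink \<beta> \<beta> + q * q"
    unfolding A' by (simp_all add: n n' e)
  have BB: "mink B1 B1 = mink \<beta> \<beta> + p * p" "mink B2 B2 = mink \<alpha> \<alpha> + q * q"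
    unfolding B' by (simp_all add: n n' e)
  \<comment> \<open>Against e1 \<and> e2 the right-hand side drops out, and the squares p^2 and q^2
    from C and G cancel those from the doubled middle terms.\<close>
  have s: "mink \<alpha> \<alpha> + mink \<beta> \<beta> = 0"
    using eqP[of e1 e2] by (simp add: e e' A B C G T AA BB p_def[symmetric] q_def[symmetric])
  \<comment> \<open>Against \<alpha> \<and> \<beta> every wedge with a tangent factor vanishes, so
    only the doubled terms survive.\<close>
  have "mink A1 \<alpha> * mink B1 \<beta> - mink A1 \<beta> * mink B1 \<alpha> + (mink A2 \<alpha> * mink B2 \<beta> - mink A2 \<beta> * mink B2 \<alpha>) = 0"
    using eqP[of \<alpha> \<beta>] by (simp add: n')
  then have d: "mink \<alpha> \<alpha> * mink \<beta> \<beta> = mink \<alpha> \<beta> * mink \<alpha> \<beta>"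
    unfolding A' B' by (simp add: n' mink_commute[of \<beta> \<alpha>] algebra_simps)
  \<comment> \<open>The first relation gives the second the opposite sign, so a sum of two real
    squares is zero.\<close>
  have "mink \<alpha> \<alpha> * mink \<alpha> \<alpha> + mink \<alpha> \<beta> * mink \<alpha> \<beta> = 0"
    using d s by algebra
  then show "mink \<alpha> \<alpha> = 0" "mink \<alpha> \<beta> = 0" by (simp_all add: sum_squares_eq_zero_iff)
  then show "mink \<beta> \<beta> = 0" using s by simp
qed

text \<open>H = 0 is recorded as tangency of D_e1 e1 + D_e2 e2: the Levi-Civita terms in the second
  fundamental form are tangent and go into the witness t.\<close>

locale framed_patch =
  fixes X :: "real^2 \<Rightarrow> real^4" and D :: "(real^2) set" and E1 E2 :: "real^2 \<Rightarrow> real^2"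
  assumes D: "open D" and X: "smooth_on D X" and E: "smooth_on D E1" "smooth_on D E2"
    and orthonormal: "\<And>w. w \<in> D \<Longrightarrow> mink (dd X w (E1 w)) (dd X w (E1 w)) = 1"
      "\<And>w. w \<in> D \<Longrightarrow> mink (dd X w (E2 w)) (dd X w (E2 w)) = 1"
      "\<And>w. w \<in> D \<Longrightarrow> mink (dd X w (E1 w)) (dd X w (E2 w)) = 0"
    and maximal: "\<And>w. w \<in> D \<Longrightarrow>
      \<exists>t. dd (\<lambda>z. dd X z (E1 z)) w (E1 w) + dd (\<lambda>z. dd X z (E2 z)) w (E2 w) = dd X w t"
begin

definition e1 :: "real^2 \<Rightarrow> real^4" where "e1 z = dd X z (E1 z)"
definition e2 :: "real^2 \<Rightarrow> real^4" where "e2 z = dd X z (E2 z)"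

lemma smooth_e: "smooth_on D e1" "smooth_on D e2"
  unfolding e1_def[abs_def] e2_def[abs_def] by (intro smooth_on_dd_field X D E)+

lemma deriv_e:
  assumes "w \<in> D"
  shows "(e1 has_derivative dd e1 w) (at w)" "(e2 has_derivative dd e2 w) (at w)"
  using smooth_onD[OF smooth_e(1) D assms] smooth_onD[OF smooth_e(2) D assms] .

lemma linear_dd:
  assumes "w \<in> D"
  shows "linear (dd X w)" "linear (dd e1 w)" "linear (dd e2 w)"
  using bounded_linear_dd[OF X D assms] bounded_linear_dd[OF smooth_e(1) D assms] bounded_linear_dd[OF smooth_e(2) D assms]
    bounded_linear.linear by blast+

lemma e_orthonormal:
  assumes "w \<in> D"
  shows "mink (e1 w) (e1 w) = 1" "mink (e2 w) (e2 w) = 1" "mink (e1 w) (e2 w) = 0" "mink (e2 w) (e1 w) = 0"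
  using orthonormal[OF assms] by (simp_all add: e1_def e2_def mink_commute)

definition \<theta>1 :: "real^2 \<Rightarrow> real^2 \<Rightarrow> real" where "\<theta>1 z k = mink (dd X z k) (e1 z)"
definition \<theta>2 :: "real^2 \<Rightarrow> real^2 \<Rightarrow> real" where "\<theta>2 z k = mink (dd X z k) (e2 z)"

lemma coframe:
  assumes w: "w \<in> D"
  shows "k = \<theta>1 w k *\<^sub>R E1 w + \<theta>2 w k *\<^sub>R E2 w"
proof -
  note lin = linear_dd(1)[OF w]
  have E1: "dd X w (E1 w) = e1 w" and E2: "dd X w (E2 w) = e2 w" by (simp_all add: e1_def e2_def)
  have ne: "E1 w \<noteq> 0" "E2 w \<noteq> 0"
    using orthonormal[OF w] linear_0[OF lin] by force+
  have "E1 w \<notin> span {E2 w}"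
  proof
    assume "E1 w \<in> span {E2 w}"
    then obtain s where "E1 w = s *\<^sub>R E2 w" by (auto simp: span_singleton)
    then have "e1 w = s *\<^sub>R e2 w" using linear_scale[OF lin] by (simp add: e1_def e2_def)
    then have "mink (e1 w) (e1 w) = s * mink (e1 w) (e2 w)" by (metis mink_linear(8))
    then show False using e_orthonormal[OF w] by simp
  qed
  moreover from this have "E1 w \<noteq> E2 w" using span_base by fastforce
  ultimately have "k \<in> span {E1 w, E2 w}"
    using card_ge_dim_independent[of "{E1 w, E2 w}" UNIV] ne by (auto simp: independent_insert)
  then obtain a b where k: "k = a *\<^sub>R E1 w + b *\<^sub>R E2 w"
    by (auto simp: span_insert span_singleton algebra_simps)
  have "dd X w k = a *\<^sub>R e1 w + b *\<^sub>R e2 w"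
    unfolding k by (simp add: linear_add[OF lin] linear_scale[OF lin] E1 E2)
  then have "\<theta>1 w k = a" "\<theta>2 w k = b" using e_orthonormal[OF w] by (simp_all add: \<theta>1_def \<theta>2_def)
  then show ?thesis using k by simp
qed

lemma dd_coframe:
  assumes w: "w \<in> D"
  shows "dd X w k = \<theta>1 w k *\<^sub>R e1 w + \<theta>2 w k *\<^sub>R e2 w"
    "dd e1 w k = \<theta>1 w k *\<^sub>R dd e1 w (E1 w) + \<theta>2 w k *\<^sub>R dd e1 w (E2 w)"
    "dd e2 w k = \<theta>1 w k *\<^sub>R dd e2 w (E1 w) + \<theta>2 w k *\<^sub>R dd e2 w (E2 w)"
  using arg_cong[OF coframe[OF w, of k], of "dd X w"] arg_cong[OF coframe[OF w, of k], of "dd e1 w"]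
    arg_cong[OF coframe[OF w, of k], of "dd e2 w"]
  by (simp_all add: linear_add[OF linear_dd(1)[OF w]] linear_scale[OF linear_dd(1)[OF w]]
     linear_add[OF linear_dd(2)[OF w]] linear_scale[OF linear_dd(2)[OF w]]
     linear_add[OF linear_dd(3)[OF w]] linear_scale[OF linear_dd(3)[OF w]] e1_def e2_def)

lemma dd_e_tangential:
  assumes w: "w \<in> D"
  shows "mink (dd e1 w h) (e1 w) = 0" "mink (dd e2 w h) (e2 w) = 0"
    "mink (dd e2 w h) (e1 w) = - mink (dd e1 w h) (e2 w)"
proof -
  have c: "dd (\<lambda>z. mink (f z) (g z)) w h = 0" if "\<And>z. z \<in> D \<Longrightarrow> mink (f z) (g z) = c" for f g c
    using dd_cong[OF D w, of "\<lambda>z. mink (f z) (g z)" "\<lambda>z. c"] that by (simp add: dd_const)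
  show "mink (dd e1 w h) (e1 w) = 0"
    using c[of e1 e1 1] e_orthonormal dd_mink[OF deriv_e(1)[OF w] deriv_e(1)[OF w]] by (simp add: mink_commute)
  show "mink (dd e2 w h) (e2 w) = 0"
    using c[of e2 e2 1] e_orthonormal dd_mink[OF deriv_e(2)[OF w] deriv_e(2)[OF w]] by (simp add: mink_commute)
  show "mink (dd e2 w h) (e1 w) = - mink (dd e1 w h) (e2 w)"
    using c[of e1 e2 0] e_orthonormal dd_mink[OF deriv_e(1)[OF w] deriv_e(2)[OF w]] by (simp add: mink_commute)
qed

section \<open>The second fundamental form along the frame\<close>

definition normal_part :: "real^2 \<Rightarrow> real^4 \<Rightarrow> real^4" where
  "normal_part z v = v - mink v (e1 z) *\<^sub>R e1 z - mink v (e2 z) *\<^sub>R e2 z"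

lemma normal_part_linear:
  "normal_part z (u + v) = normal_part z u + normal_part z v"
  "normal_part z (u - v) = normal_part z u - normal_part z v"
  "normal_part z (s *\<^sub>R v) = s *\<^sub>R normal_part z v"
  by (simp_all add: normal_part_def algebra_simps)

lemma normal_part_tangent: "w \<in> D \<Longrightarrow> normal_part w (dd X w k) = 0"
  unfolding normal_part_def by (subst (1 2 3) dd_coframe(1)) (simp_all add: e_orthonormal)

lemma normal_part_maximal:
  assumes w: "w \<in> D"
  shows "normal_part w (dd e1 w (E1 w)) = - normal_part w (dd e2 w (E2 w))"
proof -
  obtain t where "dd e1 w (E1 w) + dd e2 w (E2 w) = dd X w t"
    using maximal[OF w] by (auto simp: e1_def[abs_def] e2_def[abs_def])
  then have "normal_part w (dd e1 w (E1 w)) + normal_part w (dd e2 w (E2 w)) = 0"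
    using normal_part_tangent[OF w] by (simp flip: normal_part_linear)
  then show ?thesis by (simp add: eq_neg_iff_add_eq_0)
qed

text \<open>Symmetry of h: mixed second derivatives of X agree, and the remaining terms of
  \<open>dd_dd_field\<close> are tangent.\<close>

lemma normal_part_symmetric:
  assumes w: "w \<in> D"
  shows "normal_part w (dd e2 w (E1 w)) = normal_part w (dd e1 w (E2 w))"
proof -
  have "dd e2 w (E1 w) = dd (\<lambda>z. dd X z (E2 w)) w (E1 w) + dd X w (dd E2 w (E1 w))"
    using dd_dd_field[OF X D w E(2)] by (simp add: e2_def[abs_def])
  moreover have "dd e1 w (E2 w) = dd (\<lambda>z. dd X z (E1 w)) w (E2 w) + dd X w (dd E1 w (E2 w))"
    using dd_dd_field[OF X D w E(1)] by (simp add: e1_def[abs_def])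
  moreover have "dd (\<lambda>z. dd X z (E2 w)) w (E1 w) = dd (\<lambda>z. dd X z (E1 w)) w (E2 w)"
    by (rule dd_commute[OF X D w])
  ultimately show ?thesis
    using normal_part_tangent[OF w] by (simp add: normal_part_linear)
qed

text \<open>The quarter turn of the induced metric that sends E1 to -E2 and E2 to E1.\<close>

definition J :: "real^2 \<Rightarrow> real^2 \<Rightarrow> real^2" where
  "J z k = \<theta>2 z k *\<^sub>R E1 z - \<theta>1 z k *\<^sub>R E2 z"

lemma linear_\<theta>:
  assumes "w \<in> D"
  shows "linear (\<theta>1 w)" "linear (\<theta>2 w)"
  using linear_dd(1)[OF assms] by (auto intro!: linearI simp: \<theta>1_def \<theta>2_def linear_add linear_scale)

lemma smooth_\<theta>: "smooth_on D (\<lambda>z. \<theta>1 z k)" "smooth_on D (\<lambda>z. \<theta>2 z k)"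
  unfolding \<theta>1_def \<theta>2_def by (intro smooth_on_bilinear[OF bounded_bilinear_mink] smooth_on_dd X D smooth_e)+

lemma dd_J: "z \<in> D \<Longrightarrow> dd X z (J z k) = \<theta>2 z k *\<^sub>R e1 z - \<theta>1 z k *\<^sub>R e2 z"
  using linear_dd(1)[of z] by (simp add: J_def e1_def e2_def linear_diff linear_scale)

lemma J_complex_structure:
  assumes w: "w \<in> D"
  shows "linear (J w)" "J w (J w k) = - k"
proof -
  show "linear (J w)"
    using linear_\<theta>[OF w] by (auto intro!: linearI simp: J_def linear_add linear_scale algebra_simps)
  have "\<theta>1 w (J w k) = \<theta>2 w k" "\<theta>2 w (J w k) = - \<theta>1 w k"
    using e_orthonormal[OF w] by (simp_all add: \<theta>1_def[of w "J w k"] \<theta>2_def[of w "J w k"] dd_J[OF w])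
  then show "J w (J w k) = - k"
    by (subst (2) coframe[OF w, of k]) (simp add: J_def[of w "J w k"])
qed

lemma smooth_J: "smooth_on D (\<lambda>z. J z k)"
  unfolding J_def by (intro smooth_on_diff smooth_on_scaleR smooth_\<theta> E D)

text \<open>The coordinate functions are harmonic: the difference of both sides is bilinear and alternating in
  \<open>h\<close> and \<open>k\<close>, hence a multiple of its value at \<open>E1\<close>, \<open>E2\<close>, which is the normal part of \<open>D\<^sub>e\<^sub>1 e1 + D\<^sub>e\<^sub>2 e2\<close>.\<close>

lemma dd_dX_J:
  assumes w: "w \<in> D"
  shows "dd (\<lambda>z. dd X z (J z k)) w h = dd (\<lambda>z. dd X z (J z h)) w k"
proof -
  define Xhk where "Xhk = dd (\<lambda>z. dd X z k) w h"
  have sym: "dd (\<lambda>z. dd X z h) w k = Xhk" unfolding Xhk_def by (rule dd_commute[OF X D w])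
  have d\<theta>: "dd (\<lambda>z. \<theta>1 z k) w h = mink (dd X w k) (dd e1 w h) + mink (dd (\<lambda>z. dd X z k) w h) (e1 w)"
    "dd (\<lambda>z. \<theta>2 z k) w h = mink (dd X w k) (dd e2 w h) + mink (dd (\<lambda>z. dd X z k) w h) (e2 w)" for h k
    unfolding \<theta>1_def \<theta>2_def
    by (intro dd_mink smooth_onD[OF smooth_on_dd[OF X D] D w] deriv_e[OF w])+
  have expand: "dd (\<lambda>z. dd X z (J z k)) w h =
      \<theta>2 w k *\<^sub>R dd e1 w h + dd (\<lambda>z. \<theta>2 z k) w h *\<^sub>R e1 w - (\<theta>1 w k *\<^sub>R dd e2 w h + dd (\<lambda>z. \<theta>1 z k) w h *\<^sub>R e2 w)" for h k
  proof -
    have "dd (\<lambda>z. dd X z (J z k)) w = dd (\<lambda>z. \<theta>2 z k *\<^sub>R e1 z - \<theta>1 z k *\<^sub>R e2 z) w"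
      by (rule dd_cong[OF D w dd_J])
    also have "\<dots> = (\<lambda>h. \<theta>2 w k *\<^sub>R dd e1 w h + dd (\<lambda>z. \<theta>2 z k) w h *\<^sub>R e1 w - (\<theta>1 w k *\<^sub>R dd e2 w h + dd (\<lambda>z. \<theta>1 z k) w h *\<^sub>R e2 w))"
      by (intro dd_eqI has_derivative_diff has_derivative_scaleR deriv_e[OF w]
          smooth_onD[OF smooth_\<theta>(1) D w] smooth_onD[OF smooth_\<theta>(2) D w])
    finally show ?thesis by simp
  qed
  define A1 A2 B1 B2 where "A1 = dd e1 w (E1 w)" and "A2 = dd e1 w (E2 w)"
    and "B1 = dd e2 w (E1 w)" and "B2 = dd e2 w (E2 w)"
  define p where "p = mink A1 (e2 w)"
  define q where "q = mink A2 (e2 w)"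
  define h1 h2 k1 k2 where "h1 = \<theta>1 w h" and "h2 = \<theta>2 w h" and "k1 = \<theta>1 w k" and "k2 = \<theta>2 w k"
  note defs = A1_def[symmetric] A2_def[symmetric] B1_def[symmetric] B2_def[symmetric]
    h1_def[symmetric] h2_def[symmetric] k1_def[symmetric] k2_def[symmetric]
  have m: "mink (e1 w) A1 = 0" "mink (e1 w) A2 = 0" "mink (e2 w) B1 = 0" "mink (e2 w) B2 = 0"
    "mink (e2 w) A1 = p" "mink (e2 w) A2 = q" "mink (e1 w) B1 = - p" "mink (e1 w) B2 = - q"
    using dd_e_tangential[OF w] by (simp_all add: A1_def A2_def B1_def B2_def p_def q_def mink_commute)
  \<comment> \<open>This is H = 0: the normal parts of A1 and B2 cancel, and the connection form
    supplies the tangential remainder.\<close>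
  have tang: "A1 + B2 = p *\<^sub>R e2 w - q *\<^sub>R e1 w"
    using normal_part_maximal[OF w] m unfolding defs
    by (simp add: normal_part_def mink_commute algebra_simps)
  then have tang': "A1$i + B2$i = p * e2 w$i - q * e1 w$i" for i
    by (simp add: vec_eq_iff)
  show ?thesis
    unfolding expand d\<theta> sym Xhk_def[symmetric] dd_coframe[OF w, of h] dd_coframe[OF w, of k] defs
    unfolding vec_eq_iff
  proof
    \<comment> \<open>A2 and B1 cancel by symmetry in h and k, while A1 and B2 occur only through
      their sum; in components this is a polynomial identity.\<close>
    fix i
    show "(k2 *\<^sub>R (h1 *\<^sub>R A1 + h2 *\<^sub>R A2) + (mink (k1 *\<^sub>R e1 w + k2 *\<^sub>R e2 w) (h1 *\<^sub>R B1 + h2 *\<^sub>R B2) + mink Xhk (e2 w)) *\<^sub>R e1 w -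
      (k1 *\<^sub>R (h1 *\<^sub>R B1 + h2 *\<^sub>R B2) + (mink (k1 *\<^sub>R e1 w + k2 *\<^sub>R e2 w) (h1 *\<^sub>R A1 + h2 *\<^sub>R A2) + mink Xhk (e1 w)) *\<^sub>R e2 w))$i =
      (h2 *\<^sub>R (k1 *\<^sub>R A1 + k2 *\<^sub>R A2) + (mink (h1 *\<^sub>R e1 w + h2 *\<^sub>R e2 w) (k1 *\<^sub>R B1 + k2 *\<^sub>R B2) + mink Xhk (e2 w)) *\<^sub>R e1 w -
      (h1 *\<^sub>R (k1 *\<^sub>R B1 + k2 *\<^sub>R B2) + (mink (h1 *\<^sub>R e1 w + h2 *\<^sub>R e2 w) (k1 *\<^sub>R A1 + k2 *\<^sub>R A2) + mink Xhk (e1 w)) *\<^sub>R e2 w))$i"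
      using tang'[of i] by (simp add: m) algebra
  qed
qed

lemma J_harmonic_coordinate: "J_harmonic D J (\<lambda>z. mink (X z) c)"
proof -
  have L: "bounded_linear (\<lambda>v. mink v c)" by (rule bounded_bilinear.bounded_linear_left[OF bounded_bilinear_mink])
  have sm: "smooth_on D (\<lambda>z. mink (X z) c)" by (rule smooth_on_bounded_linear[OF L D X])
  have *: "dd (\<lambda>z. dd (\<lambda>z. mink (X z) c) z (J z k)) w h = mink (dd (\<lambda>z. dd X z (J z k)) w h) c" if w: "w \<in> D" for w h k
  proof -
    have "dd (\<lambda>z. dd (\<lambda>z. mink (X z) c) z (J z k)) w = dd (\<lambda>z. mink (dd X z (J z k)) c) w"
      by (rule dd_cong[OF D w]) (rule dd_bounded_linear_comp[OF L smooth_onD[OF X D]])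
    then show ?thesis
      using dd_bounded_linear_comp[OF L smooth_onD[OF smooth_on_dd_field[OF X D smooth_J] D w]] by simp
  qed
  show ?thesis
    unfolding J_harmonic_def using sm dd_dX_J by (simp add: *)
qed

lemma unique_continuation_coordinates:
  assumes w: "w \<in> D"
  shows "\<exists>N. open N \<and> w \<in> N \<and> N \<subseteq> D \<and> (\<forall>c \<kappa> N0. open N0 \<longrightarrow> N0 \<noteq> {} \<longrightarrow> N0 \<subseteq> N \<longrightarrow>
       (\<forall>z\<in>N0. mink (X z) c = \<kappa>) \<longrightarrow> (\<forall>z\<in>N. mink (X z) c = \<kappa>))"
proof -
  have L: "bounded_linear (\<lambda>v. mink v (e1 w))" by (rule bounded_bilinear.bounded_linear_left[OF bounded_bilinear_mink])
  \<comment> \<open>The coordinate function along the fixed vector \<open>e1 w\<close> has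
    derivative 1 at w in direction E1; it plays the part of u0.\<close>
  have "dd (\<lambda>z. mink (X z) (e1 w)) w (E1 w) \<noteq> 0"
    unfolding dd_bounded_linear_comp[OF L smooth_onD[OF X D w]] e1_def[symmetric] e_orthonormal(1)[OF w] by simp
  note ne = this
  show ?thesis
  proof (rule unique_continuation[OF D w _ _ _ J_harmonic_coordinate ne])
    fix N assume N: "open N" "w \<in> N" "N \<subseteq> D"
      "\<And>u \<kappa> N0 y. J_harmonic D J u \<Longrightarrow> open N0 \<Longrightarrow> N0 \<noteq> {} \<Longrightarrow> N0 \<subseteq> N \<Longrightarrow>
         (\<And>z. z \<in> N0 \<Longrightarrow> u z = \<kappa>) \<Longrightarrow> y \<in> N \<Longrightarrow> u y = \<kappa>"
    show ?thesis
    proof (intro exI[of _ N] conjI allI impI ballI N(1-3))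
      fix c \<kappa> N0 y assume a: "open N0" "N0 \<noteq> {}" "N0 \<subseteq> N" "\<forall>z\<in>N0. mink (X z) c = \<kappa>" "y \<in> N"
      show "mink (X y) c = \<kappa>"
        by (rule N(4)[OF J_harmonic_coordinate a(1-3) _ a(5)]) (rule bspec[OF a(4)])
    qed
  qed (rule J_complex_structure smooth_J, assumption?)+
qed

subsection \<open>The null direction\<close>

text \<open>A normal vector sees only the second fundamental form, and symmetry together with H = 0
  expresses that through its values at (E1, E1) and (E1, E2).\<close>

lemma dd_e_normal_part:
  assumes w: "w \<in> D" and n: "mink \<eta> (e1 w) = 0" "mink \<eta> (e2 w) = 0"
  shows "mink (dd e1 w h) \<eta> = \<theta>1 w h * mink (normal_part w (dd e1 w (E1 w))) \<eta> + \<theta>2 w h * mink (normal_part w (dd e1 w (E2 w))) \<eta>"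
    "mink (dd e2 w h) \<eta> = \<theta>1 w h * mink (normal_part w (dd e1 w (E2 w))) \<eta> - \<theta>2 w h * mink (normal_part w (dd e1 w (E1 w))) \<eta>"
proof -
  have "mink (e1 w) \<eta> = 0" "mink (e2 w) \<eta> = 0" using n by (simp_all add: mink_commute)
  then have m: "mink (normal_part w v) \<eta> = mink v \<eta>" for v
    by (simp add: normal_part_def)
  show "mink (dd e1 w h) \<eta> = \<theta>1 w h * mink (normal_part w (dd e1 w (E1 w))) \<eta> + \<theta>2 w h * mink (normal_part w (dd e1 w (E2 w))) \<eta>"
    unfolding m by (subst dd_coframe(2)[OF w]) simp
  have "mink (dd e2 w h) \<eta> = \<theta>1 w h * mink (normal_part w (dd e2 w (E1 w))) \<eta> + \<theta>2 w h * mink (normal_part w (dd e2 w (E2 w))) \<eta>"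
    unfolding m by (subst dd_coframe(3)[OF w]) simp
  then show "mink (dd e2 w h) \<eta> = \<theta>1 w h * mink (normal_part w (dd e1 w (E2 w))) \<eta> - \<theta>2 w h * mink (normal_part w (dd e1 w (E1 w))) \<eta>"
    unfolding normal_part_symmetric[OF w] normal_part_maximal[OF w] by simp
qed

lemma normal_part_orthogonal:
  assumes w: "w \<in> D"
  shows "mink (normal_part w v) (e1 w) = 0" "mink (normal_part w v) (e2 w) = 0"
  using e_orthonormal[OF w] by (simp_all add: normal_part_def)

definition \<alpha> :: "real^2 \<Rightarrow> real^4" where "\<alpha> z = normal_part z (dd e1 z (E1 z))"
definition \<beta> :: "real^2 \<Rightarrow> real^4" where "\<beta> z = normal_part z (dd e1 z (E2 z))"

lemma smooth_\<alpha>\<beta>: "smooth_on D \<alpha>" "smooth_on D \<beta>"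
  unfolding \<alpha>_def[abs_def] \<beta>_def[abs_def] normal_part_def
  by (intro smooth_on_diff smooth_on_scaleR smooth_on_dd_field smooth_on_bilinear[OF bounded_bilinear_mink] smooth_e E D)+

text \<open>In the Lorentzian normal plane a vector orthogonal to the null vector \<eta> is a
  multiple of it, so the derivative of \<eta> is parallel to \<eta>. Scaling the time component to 1
  removes this multiple and leaves a constant vector.\<close>

lemma normal_field_constant_direction:
  assumes w: "w \<in> D" and \<eta>: "smooth_on D \<eta>"
    and null: "\<And>z. z \<in> D \<Longrightarrow> mink (\<eta> z) (\<eta> z) = 0"
    and normal: "\<And>z. z \<in> D \<Longrightarrow> mink (\<eta> z) (e1 z) = 0" "\<And>z. z \<in> D \<Longrightarrow> mink (\<eta> z) (e2 z) = 0"
    and h: "\<And>z. z \<in> D \<Longrightarrow> mink (\<alpha> z) (\<eta> z) = 0" "\<And>z. z \<in> D \<Longrightarrow> mink (\<beta> z) (\<eta> z) = 0"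
    and nz: "\<eta> w \<noteq> 0"
  obtains l r where "r > 0" "ball w r \<subseteq> D" "l \<noteq> 0" "mink l l = 0"
    "\<And>z. z \<in> ball w r \<Longrightarrow> mink (e1 z) l = 0 \<and> mink (e2 z) l = 0"
proof -
  have nz1: "\<eta> w $ 1 \<noteq> 0" using null_time_component_nonzero[OF null[OF w] nz] .
  have cont: "continuous_on D (\<lambda>z. \<eta> z $ 1)"
    using smooth_on_continuous[OF smooth_on_vec_nth[OF D \<eta>]] .
  have "open (D \<inter> (\<lambda>z. \<eta> z $ 1) -` (- {0}))"
    by (rule continuous_open_preimage[OF cont D]) auto
  then obtain r where r: "r > 0" "ball w r \<subseteq> D \<inter> (\<lambda>z. \<eta> z $ 1) -` (- {0})"
    using w nz1 openE by (metis IntI vimageI ComplI singletonD)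
  define q where "q = (\<lambda>z. inverse (\<eta> z $ 1) *\<^sub>R \<eta> z)"
  have dq: "(q has_derivative (\<lambda>h. 0)) (at z)" if z: "z \<in> ball w r" for z
  proof -
    have zD: "z \<in> D" and z1: "\<eta> z $ 1 \<noteq> 0" using z r by auto
    have d: "(\<eta> has_derivative dd \<eta> z) (at z)" by (rule smooth_onD[OF \<eta> D zD])
    have par: "\<eta> z $ 1 *\<^sub>R dd \<eta> z h = (dd \<eta> z h $ 1) *\<^sub>R \<eta> z" for h
    proof -
      have c: "dd (\<lambda>z. mink (f z) (g z)) z h = 0" if "\<And>z. z \<in> D \<Longrightarrow> mink (f z) (g z) = 0" for f g h
        using dd_cong[OF D zD, of "\<lambda>z. mink (f z) (g z)" "\<lambda>z. 0"] that by (simp add: dd_const)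
      note H = dd_e_normal_part[OF zD normal(1)[OF zD] normal(2)[OF zD], folded \<alpha>_def \<beta>_def, unfolded h[OF zD]]
      have "mink (\<eta> z) (dd e1 z h) = 0" "mink (\<eta> z) (dd e2 z h) = 0"
        using H[of h] by (simp_all add: mink_commute)
      \<comment> \<open>Differentiating the orthogonality of \<eta> and e_i moves the derivative
        onto e_i, where it vanishes because \<eta> is orthogonal to \<alpha> and \<beta>.\<close>
      then have y: "mink (dd \<eta> z h) (e1 z) = 0" "mink (dd \<eta> z h) (e2 z) = 0"
        using c[of \<eta> e1 h, OF normal(1)] dd_mink[OF d deriv_e(1)[OF zD], of h]
          c[of \<eta> e2 h, OF normal(2)] dd_mink[OF d deriv_e(2)[OF zD], of h] by simp_all
      have y3: "mink (\<eta> z) (dd \<eta> z h) = 0"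
        using c[of \<eta> \<eta> h, OF null] dd_mink[OF d d, of h] mink_commute[of "dd \<eta> z h" "\<eta> z"] by simp
      have "\<eta> z \<noteq> 0" using z1 by auto
      then have "mink (dd \<eta> z h) (dd \<eta> z h) = 0"
        using normal_null[OF e_orthonormal(1-3)[OF zD] normal(1)[OF zD] normal(2)[OF zD] null[OF zD] _ y y3] by simp
      then show ?thesis
        using null_orthogonal_parallel[of "dd \<eta> z h" "\<eta> z"] null[OF zD] y3 by (simp add: mink_commute)
    qed
    have d1: "((\<lambda>z. \<eta> z $ 1) has_derivative (\<lambda>h. dd \<eta> z h $ 1)) (at z)"
      by (rule bounded_linear.has_derivative[OF bounded_linear_vec_nth d])
    have "(q has_derivative (\<lambda>h. inverse (\<eta> z $ 1) *\<^sub>R dd \<eta> z h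
        + (- (inverse (\<eta> z $ 1) * (dd \<eta> z h $ 1) * inverse (\<eta> z $ 1))) *\<^sub>R \<eta> z)) (at z)"
      unfolding q_def by (rule has_derivative_scaleR[OF Deriv.has_derivative_inverse[OF z1 d1] d])
    moreover have "inverse (\<eta> z $ 1) *\<^sub>R dd \<eta> z h
        + (- (inverse (\<eta> z $ 1) * (dd \<eta> z h $ 1) * inverse (\<eta> z $ 1))) *\<^sub>R \<eta> z = 0" for h
    proof -
      have "inverse (\<eta> z $ 1) *\<^sub>R dd \<eta> z h = (inverse (\<eta> z $ 1) * inverse (\<eta> z $ 1)) *\<^sub>R (\<eta> z $ 1 *\<^sub>R dd \<eta> z h)"
        using z1 by simp
      also have "\<dots> = (inverse (\<eta> z $ 1) * (dd \<eta> z h $ 1) * inverse (\<eta> z $ 1)) *\<^sub>R \<eta> z"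
        unfolding par by (simp add: mult_ac)
      finally show ?thesis by simp
    qed
    ultimately show ?thesis by simp
  qed
  have "q z = q w" if "z \<in> ball w r" for z
    by (rule has_derivative_zero_unique_connected[where f = q, OF open_ball connected_ball dq that])
      (use r in auto)
  then have q: "\<eta> z = \<eta> z $ 1 *\<^sub>R q w" if "z \<in> ball w r" for z
  proof -
    have "\<eta> z $ 1 \<noteq> 0" using subsetD[OF r(2) that] by simp
    then have "\<eta> z $ 1 *\<^sub>R q z = \<eta> z" by (simp add: q_def)
    then show ?thesis using \<open>\<And>z. z \<in> ball w r \<Longrightarrow> q z = q w\<close>[OF that] by simp
  qed
  show ?thesis
  proof (rule that[of r "q w"])
    show "r > 0" "ball w r \<subseteq> D" using r by auto
    show "q w \<noteq> 0" using nz nz1 by (simp add: q_def)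
    show "mink (q w) (q w) = 0" using null[OF w] by (simp add: q_def)
    fix z assume z: "z \<in> ball w r"
    have zD: "z \<in> D" and z1: "\<eta> z $ 1 \<noteq> 0" using z r by auto
    have "mink (e1 z) (\<eta> z) = 0" "mink (e2 z) (\<eta> z) = 0" using normal[OF zD] by (simp_all add: mink_commute)
    then have "\<eta> z $ 1 * mink (e1 z) (q w) = 0" "\<eta> z $ 1 * mink (e2 z) (q w) = 0"
      using q[OF z] by (metis mink_linear(8))+
    then show "mink (e1 z) (q w) = 0 \<and> mink (e2 z) (q w) = 0" using z1 by simp
  qed
qed

text \<open>Without second fundamental form the derivatives of e1 and e2 only rotate the pair. The
  sum F of the squared products with the fixed vector l is invariant under rotation, hence constant,
  and it is zero at w.\<close>

lemma planar_normal_constant: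
  assumes h: "\<And>z. z \<in> D \<Longrightarrow> \<alpha> z = 0" "\<And>z. z \<in> D \<Longrightarrow> \<beta> z = 0"
    and l: "mink (e1 w) l = 0" "mink (e2 w) l = 0" and B: "ball w r \<subseteq> D" and z: "z \<in> ball w r"
  shows "mink (e1 z) l = 0 \<and> mink (e2 z) l = 0"
proof -
  define F where "F = (\<lambda>z. (mink (e1 z) l)\<^sup>2 + (mink (e2 z) l)\<^sup>2)"
  have L: "bounded_linear (\<lambda>v. mink v l)" by (rule bounded_bilinear.bounded_linear_left[OF bounded_bilinear_mink])
  have dF: "(F has_derivative (\<lambda>h. 0)) (at x)" if x: "x \<in> ball w r" for x
  proof -
    have xD: "x \<in> D" using x B by auto
    have d: "((\<lambda>z. mink (e1 z) l) has_derivative (\<lambda>h. mink (dd e1 x h) l)) (at x)"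
      "((\<lambda>z. mink (e2 z) l) has_derivative (\<lambda>h. mink (dd e2 x h) l)) (at x)"
      using bounded_linear.has_derivative[OF L deriv_e(1)[OF xD]] bounded_linear.has_derivative[OF L deriv_e(2)[OF xD]] .
    have 1: "dd e1 x h = mink (dd e1 x h) (e2 x) *\<^sub>R e2 x" for h
    proof -
      have "normal_part x (dd e1 x h) = 0"
        by (subst dd_coframe(2)[OF xD]) (simp add: normal_part_linear h[OF xD] flip: \<alpha>_def \<beta>_def)
      then show ?thesis using dd_e_tangential[OF xD] by (simp add: normal_part_def)
    qed
    have 2: "dd e2 x h = - mink (dd e1 x h) (e2 x) *\<^sub>R e1 x" for h
    proof -
      have "normal_part x (dd e2 x h) = 0"
        using normal_part_maximal[OF xD]
        by (subst dd_coframe(3)[OF xD])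
          (simp add: normal_part_linear normal_part_symmetric[OF xD] h[OF xD] flip: \<alpha>_def \<beta>_def)
      then show ?thesis using dd_e_tangential[OF xD] by (simp add: normal_part_def eq_neg_iff_add_eq_0)
    qed
    have "(F has_derivative (\<lambda>h. 2 * mink (e1 x) l * mink (dd e1 x h) l + 2 * mink (e2 x) l * mink (dd e2 x h) l)) (at x)"
      unfolding F_def using has_derivative_add[OF has_derivative_power[OF d(1), of 2] has_derivative_power[OF d(2), of 2]]
      by (simp add: mult_ac)
    moreover have "2 * mink (e1 x) l * mink (dd e1 x h) l + 2 * mink (e2 x) l * mink (dd e2 x h) l = 0" for h
      by (subst 1, subst 2) simp
    ultimately show ?thesis by simp
  qed
  have "w \<in> ball w r" using z by auto (metis dist_self order_le_less_trans zero_le_dist)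
  then have "F z = F w"
    using has_derivative_zero_unique_connected[where f = F, OF open_ball connected_ball dF z] by blast
  then show ?thesis using l by (simp add: F_def sum_power2_eq_zero_iff)
qed

lemma null_direction:
  assumes w: "w \<in> D"
    and null: "\<And>z. z \<in> D \<Longrightarrow> mink (\<alpha> z) (\<alpha> z) = 0" "\<And>z. z \<in> D \<Longrightarrow> mink (\<beta> z) (\<beta> z) = 0"
      "\<And>z. z \<in> D \<Longrightarrow> mink (\<alpha> z) (\<beta> z) = 0"
  obtains l r x \<kappa> where "r > 0" "ball x r \<subseteq> D" "l \<noteq> 0" "mink l l = 0" "\<And>z. z \<in> ball x r \<Longrightarrow> mink (X z) l = \<kappa>"
proof -
  have null': "mink (\<beta> z) (\<alpha> z) = 0" if "z \<in> D" for z using null(3)[OF that] by (simp add: mink_commute)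
  have n\<alpha>: "mink (\<alpha> z) (e1 z) = 0" "mink (\<alpha> z) (e2 z) = 0"
    and n\<beta>: "mink (\<beta> z) (e1 z) = 0" "mink (\<beta> z) (e2 z) = 0" if "z \<in> D" for z
    unfolding \<alpha>_def \<beta>_def using normal_part_orthogonal[OF that] by blast+
  obtain l r x where l: "r > 0" "ball x r \<subseteq> D" "l \<noteq> 0" "mink l l = 0"
    "\<And>z. z \<in> ball x r \<Longrightarrow> mink (e1 z) l = 0 \<and> mink (e2 z) l = 0"
  proof (cases "\<exists>x\<in>D. \<alpha> x \<noteq> 0 \<or> \<beta> x \<noteq> 0")
    case True
    then obtain x where x: "x \<in> D" "\<alpha> x \<noteq> 0 \<or> \<beta> x \<noteq> 0" by blast
    \<comment> \<open>Both \<alpha> and \<beta> are null and they are mutually orthogonal, so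
      whichever is nonzero at x serves as \<eta>.\<close>
    show ?thesis
    proof (cases "\<alpha> x = 0")
      case False
      show ?thesis
        by (rule normal_field_constant_direction[OF x(1) smooth_\<alpha>\<beta>(1) null(1) n\<alpha> null(1) null' False])
          (assumption | rule that)+
    next
      case True
      then have "\<beta> x \<noteq> 0" using x(2) by blast
      show ?thesis
        by (rule normal_field_constant_direction[OF x(1) smooth_\<alpha>\<beta>(2) null(2) n\<beta> null(3) null(2) \<open>\<beta> x \<noteq> 0\<close>])
          (assumption | rule that)+
    qed
  next
    case False
    obtain l where l: "l \<noteq> 0" "mink l l = 0" "mink (e1 w) l = 0" "mink (e2 w) l = 0"
      using null_normal_exists[OF e_orthonormal(1-3)[OF w]] .
    obtain r where r: "r > 0" "ball w r \<subseteq> D" using D w openE by blast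
    show ?thesis
      by (rule that[OF r l(1,2)], rule planar_normal_constant[OF _ _ l(3,4) r(2)]) (use False in auto)
  qed
  have L: "bounded_linear (\<lambda>v. mink v l)" by (rule bounded_bilinear.bounded_linear_left[OF bounded_bilinear_mink])
  have d: "((\<lambda>z. mink (X z) l) has_derivative (\<lambda>h. 0)) (at z)" if z: "z \<in> ball x r" for z
  proof -
    have zD: "z \<in> D" using z l(2) by auto
    have "mink (dd X z h) l = 0" for h
      using l(5)[OF z] by (subst dd_coframe(1)[OF zD]) simp
    then show ?thesis using bounded_linear.has_derivative[OF L smooth_onD[OF X D zD]] by simp
  qed
  have "mink (X z) l = mink (X x) l" if z: "z \<in> ball x r" for z
  proof -
    have "x \<in> ball x r" using l(1) by simp
    then show ?thesis
      using has_derivative_zero_unique_connected[where f = "\<lambda>z. mink (X z) l", OF open_ball connected_ball d z] by blast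
  qed
  then show ?thesis by (rule that[OF l(1-4)])
qed

section \<open>The harmonic map equation in the frame\<close>

lemma dd_dd_wedge:
  assumes w: "w \<in> D" and V: "smooth_on D V"
  defines "A \<equiv> \<lambda>z. dd e1 z (V z)" and "B \<equiv> \<lambda>z. dd e2 z (V z)"
  shows "dd (\<lambda>z. dd (\<lambda>z. wedge (e1 z) (e2 z)) z (V z)) w (V w)
    = wedge (dd A w (V w)) (e2 w) + 2 *\<^sub>R wedge (A w) (B w) + wedge (e1 w) (dd B w (V w))"
proof -
  have sA: "smooth_on D A" and sB: "smooth_on D B"
    unfolding A_def B_def by (intro smooth_on_dd_field smooth_e D V)+
  note dA = smooth_onD[OF sA D w] and dB = smooth_onD[OF sB D w]
  have "dd (\<lambda>z. dd (\<lambda>z. wedge (e1 z) (e2 z)) z (V z)) w = dd (\<lambda>z. wedge (e1 z) (B z) + wedge (A z) (e2 z)) w"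
    by (rule dd_cong[OF D w]) (simp add: dd_wedge[OF deriv_e] A_def B_def)
  also have "\<dots> = (\<lambda>h. (wedge (e1 w) (dd B w h) + wedge (dd e1 w h) (B w)) + (wedge (A w) (dd e2 w h) + wedge (dd A w h) (e2 w)))"
    by (intro dd_eqI has_derivative_add bounded_bilinear.FDERIV[OF bounded_bilinear_wedge] dA dB deriv_e[OF w])
  finally show ?thesis by (simp add: scaleR_2) (simp add: A_def B_def)
qed

text \<open>The first-order part of the Laplacian is kept as an unspecified direction t; its wedges
  drop out in both pairings of \<open>second_fundamental_form_null\<close>.\<close>

lemma harmonic_null:
  assumes w: "w \<in> D"
    and harm: "dd (\<lambda>z. dd (\<lambda>z. wedge (e1 z) (e2 z)) z (E1 z)) w (E1 w)
      + dd (\<lambda>z. dd (\<lambda>z. wedge (e1 z) (e2 z)) z (E2 z)) w (E2 w) = dd (\<lambda>z. wedge (e1 z) (e2 z)) w t"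
  shows "mink (\<alpha> w) (\<alpha> w) = 0" "mink (\<beta> w) (\<beta> w) = 0" "mink (\<alpha> w) (\<beta> w) = 0"
proof -
  define C where "C = (\<lambda>V. dd (\<lambda>z. dd e1 z (V z)) w (V w))"
  define G where "G = (\<lambda>V. dd (\<lambda>z. dd e2 z (V z)) w (V w))"
  note tan = dd_e_tangential[OF w]
  \<comment> \<open>Obtained by differentiating once more the orthogonality of a unit vector to its
    derivative.\<close>
  have C: "mink (C V) (e1 w) = - mink (dd e1 w (V w)) (dd e1 w (V w))" 
    and G: "mink (G V) (e2 w) = - mink (dd e2 w (V w)) (dd e2 w (V w))" if V: "smooth_on D V" for V
  proof -
    have c: "dd (\<lambda>z. mink (f z) (g z)) w h = 0" if "\<And>z. z \<in> D \<Longrightarrow> mink (f z) (g z) = 0" for f g h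
      using dd_cong[OF D w, of "\<lambda>z. mink (f z) (g z)" "\<lambda>z. 0"] that by (simp add: dd_const)
    have s: "smooth_on D (\<lambda>z. dd e1 z (V z))" "smooth_on D (\<lambda>z. dd e2 z (V z))"
      by (intro smooth_on_dd_field smooth_e D V)+
    show "mink (C V) (e1 w) = - mink (dd e1 w (V w)) (dd e1 w (V w))"
      using c[of "\<lambda>z. dd e1 z (V z)" e1 "V w", OF dd_e_tangential(1)]
        dd_mink[OF smooth_onD[OF s(1) D w] deriv_e(1)[OF w], of "V w"] by (simp add: C_def)
    show "mink (G V) (e2 w) = - mink (dd e2 w (V w)) (dd e2 w (V w))"
      using c[of "\<lambda>z. dd e2 z (V z)" e2 "V w", OF dd_e_tangential(2)]
        dd_mink[OF smooth_onD[OF s(2) D w] deriv_e(2)[OF w], of "V w"] by (simp add: G_def)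
  qed
  have eq: "wedge (C E1) (e2 w) + 2 *\<^sub>R wedge (dd e1 w (E1 w)) (dd e2 w (E1 w)) + wedge (e1 w) (G E1)
     + (wedge (C E2) (e2 w) + 2 *\<^sub>R wedge (dd e1 w (E2 w)) (dd e2 w (E2 w)) + wedge (e1 w) (G E2))
     = wedge (dd e1 w t) (e2 w) + wedge (e1 w) (dd e2 w t)"
    using harm unfolding dd_dd_wedge[OF w E(1)] dd_dd_wedge[OF w E(2)] dd_wedge[OF deriv_e[OF w]]
    by (simp add: C_def G_def add.commute)
  have \<alpha>: "\<alpha> w = dd e1 w (E1 w) - mink (dd e1 w (E1 w)) (e2 w) *\<^sub>R e2 w"
      "\<beta> w = dd e1 w (E2 w) - mink (dd e1 w (E2 w)) (e2 w) *\<^sub>R e2 w"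
    using tan by (simp_all add: \<alpha>_def \<beta>_def normal_part_def)
  have \<beta>: "\<beta> w = dd e2 w (E1 w) + mink (dd e1 w (E1 w)) (e2 w) *\<^sub>R e1 w"
      "\<alpha> w = - dd e2 w (E2 w) - mink (dd e1 w (E2 w)) (e2 w) *\<^sub>R e1 w"
    using tan normal_part_symmetric[OF w] normal_part_maximal[OF w]
    by (simp_all add: \<alpha>_def \<beta>_def normal_part_def[of w "dd e2 w v" for v])
  show "mink (\<alpha> w) (\<alpha> w) = 0" "mink (\<beta> w) (\<beta> w) = 0" "mink (\<alpha> w) (\<beta> w) = 0"
    using second_fundamental_form_null[OF e_orthonormal(1-3)[OF w] tan(1) tan(1) tan(2) tan(2) tan(3) tan(3)
        C[OF E(1)] C[OF E(2)] G[OF E(1)] G[OF E(2)] tan(1) tan(2) eq \<alpha>(1) \<beta>(2) \<alpha>(2) \<beta>(1)] by blast+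
qed

end

section \<open>The Gauss map in a chart\<close>

text \<open>Gram-Schmidt on the coordinate fields, with E, F, G the coefficients of the first
  fundamental form. It yields one oriented frame on the whole chart domain.\<close>

lemma orthonormal_frame_exists:
  assumes D: "open D" and X: "smooth_on D X"
    and pos: "\<And>w a. w \<in> D \<Longrightarrow> a \<noteq> 0 \<Longrightarrow> induced_metric X w a a > 0"
  obtains E1 E2 where "orthonormal_frame_on X D E1 E2" "\<And>w. w \<in> D \<Longrightarrow> det (vector [E1 w, E2 w] :: real^2^2) > 0"
proof -
  define a1 a2 :: "real^2" where "a1 = axis 1 1" and "a2 = axis 2 1"
  define E where "E = (\<lambda>w. induced_metric X w a1 a1)"
  define F where "F = (\<lambda>w. induced_metric X w a1 a2)"
  define G where "G = (\<lambda>w. induced_metric X w a2 a2)"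
  have sm: "smooth_on D E" "smooth_on D F" "smooth_on D G"
    unfolding E_def F_def G_def induced_metric_def
    by (intro smooth_on_bilinear[OF bounded_bilinear_mink] smooth_on_dd X D)+
  have metric: "induced_metric X w (x *\<^sub>R a1 + y *\<^sub>R a2) (x' *\<^sub>R a1 + y' *\<^sub>R a2)
      = x * x' * E w + (x * y' + y * x') * F w + y * y' * G w" if w: "w \<in> D" for w x y x' y'
  proof -
    have lin: "linear (dd X w)" using bounded_linear_dd[OF X D w] bounded_linear.linear by blast
    have "mink (dd X w a2) (dd X w a1) = F w" by (simp add: F_def induced_metric_def mink_commute)
    then show ?thesis
      by (simp add: induced_metric_def E_def F_def G_def linear_add[OF lin] linear_scale[OF lin] algebra_simps)
  qed
  have Epos: "E w > 0" if w: "w \<in> D" for w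
    using pos[OF w, of a1] by (simp add: E_def a1_def axis_eq_0_iff)
  have Wpos: "E w * G w - F w * F w > 0" if w: "w \<in> D" for w
  proof -
    \<comment> \<open>This combination is orthogonal to the first coordinate field and has squared
      length E (E G - F^2), so positivity of the metric yields E G - F^2 > 0.\<close>
    have "(- F w *\<^sub>R a1 + E w *\<^sub>R a2) $ 2 = E w" by (simp add: a1_def a2_def axis_def)
    then have "- F w *\<^sub>R a1 + E w *\<^sub>R a2 \<noteq> 0" using Epos[OF w] by (metis less_irrefl zero_index)
    then have "0 < induced_metric X w (- F w *\<^sub>R a1 + E w *\<^sub>R a2) (- F w *\<^sub>R a1 + E w *\<^sub>R a2)"
      by (rule pos[OF w])
    also have "\<dots> = E w * (E w * G w - F w * F w)"
      unfolding metric[OF w] by (simp add: algebra_simps)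
    finally show ?thesis using Epos[OF w] by (simp add: zero_less_mult_iff)
  qed
  define r where "r = (\<lambda>w. 1 / sqrt (E w))"
  define s where "s = (\<lambda>w. 1 / sqrt (E w * (E w * G w - F w * F w)))"
  have P: "E w * (E w * G w - F w * F w) > 0" if "w \<in> D" for w
    using Epos[OF that] Wpos[OF that] by simp
  have sr: "smooth_on D r" "smooth_on D s"
    unfolding r_def s_def
    by (intro smooth_on_divide smooth_on_sqrt smooth_on_const smooth_on_mult smooth_on_diff sm D;
        use P Epos in force)+
  have r2: "r w * r w * E w = 1" if w: "w \<in> D" for w
    using Epos[OF w] by (simp add: r_def field_simps)
  have s2: "s w * s w * (E w * (E w * G w - F w * F w)) = 1" if w: "w \<in> D" for w
  proof -
    have "sqrt (E w * (E w * G w - F w * F w)) * sqrt (E w * (E w * G w - F w * F w)) = E w * (E w * G w - F w * F w)"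
      using P[OF w] by (intro real_sqrt_mult_self[THEN trans]) simp
    then have "s w * s w = 1 / (E w * (E w * G w - F w * F w))" by (simp add: s_def)
    then show ?thesis using less_imp_neq[OF P[OF w]] by simp
  qed
  have rpos: "r w > 0" "s w > 0" if w: "w \<in> D" for w
    using Epos[OF w] P[OF w] by (simp_all add: r_def s_def)
  \<comment> \<open>The zero summand brings E1 into the form to which \<open>metric\<close>
    applies.\<close>
  define E1 where "E1 = (\<lambda>w. r w *\<^sub>R a1 + 0 *\<^sub>R a2)"
  define E2 where "E2 = (\<lambda>w. (- F w * s w) *\<^sub>R a1 + (E w * s w) *\<^sub>R a2)"
  have "orthonormal_frame_on X D E1 E2"
    unfolding orthonormal_frame_on_def
  proof (intro conjI ballI)
    show "smooth_on D E1" "smooth_on D E2"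
      unfolding E1_def E2_def
      by (intro smooth_on_add smooth_on_scaleR smooth_on_mult smooth_on_minus smooth_on_const sr sm D)+
    fix w assume w: "w \<in> D"
    show "induced_metric X w (E1 w) (E1 w) = 1" "induced_metric X w (E1 w) (E2 w) = 0"
      unfolding E1_def E2_def metric[OF w] using r2[OF w] by (simp_all add: algebra_simps)
    have "induced_metric X w (E2 w) (E2 w) = s w * s w * (E w * (E w * G w - F w * F w))"
      unfolding E2_def metric[OF w] by (simp add: algebra_simps)
    then show "induced_metric X w (E2 w) (E2 w) = 1" using s2[OF w] by simp
  qed
  moreover have "det (vector [E1 w, E2 w] :: real^2^2) > 0" if w: "w \<in> D" for w
    using rpos[OF w] Epos[OF w] by (simp add: det_2 E1_def E2_def a1_def a2_def axis_def)
  ultimately show ?thesis by (rule that)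
qed

text \<open>The sum of the two Levi-Civita fields is itself the required tangent coordinate
  vector.\<close>

lemma frame_sum_tangent:
  assumes "mean_curvature X E1 E2 w = 0" "linear (dd X w)"
  shows "\<exists>t. dd (\<lambda>z. dd X z (E1 z)) w (E1 w) + dd (\<lambda>z. dd X z (E2 z)) w (E2 w) = dd X w t"
proof -
  have "second_fundamental_form X E1 E1 w + second_fundamental_form X E2 E2 w = 0"
    using assms(1) by (simp add: mean_curvature_def)
  then show ?thesis
    unfolding second_fundamental_form_def
    by (intro exI[of _ "levi_civita X E1 E1 w + levi_civita X E2 E2 w"])
      (simp add: linear_add[OF assms(2)] algebra_simps)
qed

lemma laplacian_zero:
  assumes "laplacian X E1 E2 \<psi> w = 0" "linear (dd \<psi> w)"
  shows "\<exists>t. dd (\<lambda>z. dd \<psi> z (E1 z)) w (E1 w) + dd (\<lambda>z. dd \<psi> z (E2 z)) w (E2 w) = dd \<psi> w t"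
  using assms(1) unfolding laplacian_def
  by (intro exI[of _ "levi_civita X E1 E1 w + levi_civita X E2 E2 w"])
    (simp add: linear_add[OF assms(2)] algebra_simps)

section \<open>Independence of the Gauss map from chart and frame\<close>

lemma bounded_bilinear_star: "bounded_bilinear star"
proof -
  have w: "wedge (u + v) w = wedge u w + wedge v w" "wedge w (u + v) = wedge w u + wedge w v"
    "wedge (s *\<^sub>R u) w = s *\<^sub>R wedge u w" "wedge w (s *\<^sub>R u) = s *\<^sub>R wedge w u" for u v w s
    by (simp_all add: wedge_def vec_eq_iff algebra_simps)
  show ?thesis
    unfolding bilinear_conv_bounded_bilinear[symmetric] bilinear_def
    by (auto intro!: linearI simp: star_def vec_eq_iff vol_wedge w algebra_simps)
qed

lemma det_linear_image:
  fixes T :: "real^2 \<Rightarrow> real^2"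
  assumes "linear T"
  shows "det (vector [T a, T b] :: real^2^2) = det (matrix T) * det (vector [a, b] :: real^2^2)"
proof -
  have "T v $ i = matrix T $ i $ 1 * v $ 1 + matrix T $ i $ 2 * v $ 2" for v i
  proof -
    have "v = v$1 *\<^sub>R axis 1 1 + v$2 *\<^sub>R axis 2 1" by (simp add: vec_eq_iff forall_2 axis_def)
    then have "T v = v$1 *\<^sub>R T (axis 1 1) + v$2 *\<^sub>R T (axis 2 1)"
      by (metis linear_add[OF assms] linear_scale[OF assms])
    then show ?thesis by (simp add: matrix_def)
  qed
  then show ?thesis by (simp add: det_2 algebra_simps)
qed

lemma chart_facts:
  assumes "oriented_surface M A" "(D, p) \<in> A"
  shows "open D" "openin M (p ` D)" "inj_on p D" "continuous_map (top_of_set D) M p"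
    "\<And>V. open V \<Longrightarrow> V \<subseteq> D \<Longrightarrow> openin M (p ` V)" "p ` D \<subseteq> topspace M"
    "\<And>U. openin M U \<Longrightarrow> open {w \<in> D. p w \<in> U}"
proof -
  have h: "open D" "openin M (p ` D)" "homeomorphic_map (top_of_set D) (subtopology M (p ` D)) p"
    using assms unfolding oriented_surface_def by auto
  then show "open D" "openin M (p ` D)" by auto
  show "inj_on p D" using homeomorphic_imp_injective_map[OF h(3)] by simp
  show c: "continuous_map (top_of_set D) M p"
    using homeomorphic_imp_continuous_map[OF h(3)] by (simp add: continuous_map_in_subtopology)
  show "openin M (p ` V)" if "open V" "V \<subseteq> D" for V
  proof -
    have "openin (top_of_set D) V" using that by (simp add: openin_open_eq h(1))
    then have "openin (subtopology M (p ` D)) (p ` V)"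
      using homeomorphic_imp_open_map[OF h(3)] unfolding open_map_def by blast
    then show ?thesis using h(2) openin_trans_full by blast
  qed
  show "p ` D \<subseteq> topspace M" using h(2) openin_subset by blast
  show "open {w \<in> D. p w \<in> U}" if "openin M U" for U
    using openin_continuous_map_preimage[OF c that] by (simp add: openin_open_eq h(1))
qed

text \<open>Any other adapted frame at the point, in any chart, has a tangent pair that differs from
  the given one by a rotation: orthonormality makes the determinant 1 or -1, and the positive
  Jacobian of the transition map selects 1. The Hodge dual of the pair scales by this determinant,
  so the description in \<open>gauss_map\<close> has a unique solution.\<close>

lemma gauss_map_chart:
  assumes M: "oriented_surface M A" and imm: "spacelike_immersion A f" and DA: "(D, p) \<in> A" and w: "w \<in> D"
    and a: "mink (dd (f \<circ> p) w a) (dd (f \<circ> p) w a) = 1" "mink (dd (f \<circ> p) w b) (dd (f \<circ> p) w b) = 1"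
      "mink (dd (f \<circ> p) w a) (dd (f \<circ> p) w b) = 0" "det (vector [a, b] :: real^2^2) > 0"
  shows "gauss_map A f (p w) = star (dd (f \<circ> p) w a) (dd (f \<circ> p) w b)"
proof -
  let ?X = "f \<circ> p"
  let ?n = "star (dd ?X w a) (dd ?X w b)"
  have sX: "smooth_on D' (f \<circ> p')" if "(D', p') \<in> A" for D' p'
    using imm that unfolding spacelike_immersion_def by auto
  have lin: "linear (dd ?X w)"
    using bounded_linear_dd[OF sX[OF DA] chart_facts(1)[OF M DA] w] bounded_linear.linear by blast
  show ?thesis
    unfolding gauss_map_def
  proof (rule the_equality)
    obtain e3 e4 where f34: "lorentz_frame (dd ?X w a) (dd ?X w b) e3 e4"
      using lorentz_frame_exists[OF a(1-3)] .
    have "adapted_frame ?X w (dd ?X w a) (dd ?X w b) e3 e4"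
      using f34 a(4) unfolding adapted_frame_def lorentz_frame_def vol_def by auto
    then show "\<exists>D' p' w' e1 e2 e3 e4. (D', p') \<in> A \<and> w' \<in> D' \<and> p' w' = p w \<and>
        adapted_frame (f \<circ> p') w' e1 e2 e3 e4 \<and> ?n = wedge e3 e4"
      using DA w star_lorentz_frame[OF f34] by blast
  next
    fix n assume "\<exists>D' p' w' e1 e2 e3 e4. (D', p') \<in> A \<and> w' \<in> D' \<and> p' w' = p w \<and>
        adapted_frame (f \<circ> p') w' e1 e2 e3 e4 \<and> n = wedge e3 e4"
    then obtain D' p' w' e1 e2 e3 e4 where n: "(D', p') \<in> A" "w' \<in> D'" "p' w' = p w"
      "adapted_frame (f \<circ> p') w' e1 e2 e3 e4" "n = wedge e3 e4" by blast
    let ?X' = "f \<circ> p'"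
    obtain a' b' where ab': "e1 = dd ?X' w' a'" "e2 = dd ?X' w' b'" "det (vector [a', b'] :: real^2^2) > 0"
      using n(4) unfolding adapted_frame_def by blast
    have lin': "linear (dd ?X' w')"
      using bounded_linear_dd[OF sX[OF n(1)] chart_facts(1)[OF M n(1)] n(2)] bounded_linear.linear by blast
    \<comment> \<open>\<open>adapted_frame\<close> fixes squared lengths up to sign; space-likeness
      excludes -1 for the tangent pair.\<close>
    have pos: "mink (dd ?X' w' v) (dd ?X' w' v) \<ge> 0" for v
    proof (cases "v = 0")
      case False
      then show ?thesis
        using bspec[OF imm[unfolded spacelike_immersion_def] n(1)] n(2) by (auto simp: induced_metric_def intro: less_imp_le)
    qed (simp add: linear_0[OF lin'])
    have o: "mink e1 e1 = 1" "mink e2 e2 = 1" "mink e1 e2 = 0"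
      using n(4) pos[of a'] pos[of b'] ab'(1,2) unfolding adapted_frame_def by auto
    have "lorentz_frame e1 e2 e3 e4"
      using n(4) o unfolding adapted_frame_def lorentz_frame_def vol_def by auto
    then have n12: "n = star e1 e2" using star_lorentz_frame n(5) by simp
    define S where "S = {z \<in> D'. p' z \<in> p ` D}"
    define \<tau> where "\<tau> = (\<lambda>z. inv_into D p (p' z))"
    have \<tau>: "smooth_on S \<tau>" "\<And>z. z \<in> S \<Longrightarrow> det (matrix (dd \<tau> z)) > 0"
      using M n(1) DA unfolding oriented_surface_def S_def \<tau>_def by (auto simp: Let_def split: prod.splits)
    have S: "open S" unfolding S_def by (rule chart_facts(7)[OF M n(1) chart_facts(2)[OF M DA]])
    have w'S: "w' \<in> S" using n(2,3) w by (auto simp: S_def)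
    have \<tau>w: "\<tau> w' = w" unfolding \<tau>_def n(3) by (rule inv_into_f_f[OF chart_facts(3)[OF M DA] w])
    have d\<tau>: "(\<tau> has_derivative dd \<tau> w') (at w')" by (rule smooth_onD[OF \<tau>(1) S w'S])
    have l\<tau>: "linear (dd \<tau> w')" using d\<tau> has_derivative_linear by blast
    have "dd ?X' w' = dd (\<lambda>z. ?X (\<tau> z)) w'"
      by (rule dd_cong[OF S w'S]) (auto simp: S_def \<tau>_def f_inv_into_f)
    also have "\<dots> = (\<lambda>h. dd ?X w (dd \<tau> w' h))"
    proof -
      have "(?X has_derivative dd ?X w) (at (\<tau> w'))"
        using smooth_onD[OF sX[OF DA] chart_facts(1)[OF M DA] w] by (simp only: \<tau>w)
      then show ?thesis by (rule dd_eqI[OF has_derivative_compose[OF d\<tau>]])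
    qed
    finally have dX': "dd ?X' w' h = dd ?X w (dd \<tau> w' h)" for h by simp
    define \<Delta> where "\<Delta> = det (vector [a, b] :: real^2^2)"
    have \<Delta>: "\<Delta> > 0" "\<Delta> = a$1 * b$2 - a$2 * b$1" using a(4) by (simp_all add: \<Delta>_def det_2)
    have span: "\<exists>x y. v = x *\<^sub>R a + y *\<^sub>R b" for v
    proof (intro exI)
      \<comment> \<open>Cramer's rule in the basis a, b.\<close>
      show "v = ((v$1 * b$2 - v$2 * b$1) / \<Delta>) *\<^sub>R a + ((a$1 * v$2 - a$2 * v$1) / \<Delta>) *\<^sub>R b"
      proof -
        have "v$i * \<Delta> = (v$1 * b$2 - v$2 * b$1) * a$i + (a$1 * v$2 - a$2 * v$1) * b$i" for i
          using exhaust_2[of i] unfolding \<Delta>(2) by (auto simp: algebra_simps)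
        then have "v$i = ((v$1 * b$2 - v$2 * b$1) * a$i + (a$1 * v$2 - a$2 * v$1) * b$i) / \<Delta>" for i
          using \<Delta>(1) by (simp add: eq_divide_eq)
        from this show ?thesis
          unfolding vec_eq_iff vector_add_component vector_scaleR_component real_scaleR_def
            times_divide_eq_left add_divide_distrib[symmetric] ..
      qed
    qed
    obtain x1 y1 where 1: "dd \<tau> w' a' = x1 *\<^sub>R a + y1 *\<^sub>R b" using span by blast
    obtain x2 y2 where 2: "dd \<tau> w' b' = x2 *\<^sub>R a + y2 *\<^sub>R b" using span by blast
    have e12: "e1 = x1 *\<^sub>R dd ?X w a + y1 *\<^sub>R dd ?X w b" "e2 = x2 *\<^sub>R dd ?X w a + y2 *\<^sub>R dd ?X w b"
      unfolding ab' dX' 1 2 by (simp_all add: linear_add[OF lin] linear_scale[OF lin])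
    have ba: "mink (dd ?X w b) (dd ?X w a) = 0" using a(3) by (simp add: mink_commute)
    have xy: "x1 * x1 + y1 * y1 = 1" "x2 * x2 + y2 * y2 = 1" "x1 * x2 + y1 * y2 = 0"
      using o a(1-3) ba unfolding e12 by (simp_all add: mult.commute)
    have "det (vector [dd \<tau> w' a', dd \<tau> w' b'] :: real^2^2) > 0"
      unfolding det_linear_image[OF l\<tau>] using \<tau>(2)[OF w'S] ab'(3) by simp
    moreover have "det (vector [dd \<tau> w' a', dd \<tau> w' b'] :: real^2^2) = (x1 * y2 - y1 * x2) * \<Delta>"
      unfolding 1 2 \<Delta>(2) by (simp add: det_2 algebra_simps)
    ultimately have dpos: "x1 * y2 - y1 * x2 > 0" using \<Delta>(1) by (simp add: zero_less_mult_iff)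
    \<comment> \<open>Lagrange's identity for the two orthonormal coordinate rows.\<close>
    have "(x1 * y2 - y1 * x2)\<^sup>2 = 1" using xy by algebra
    then have "x1 * y2 - y1 * x2 = 1" using dpos by (simp add: power2_eq_1_iff)
    then show "n = ?n" unfolding n12 e12 star_lincomb by simp
  qed
qed

text \<open>On the chart the Gauss map is the Hodge dual of e1 \<and> e2. Applying
  \<open>hodge\<close> to its harmonic map equation gives the equation that
  \<open>harmonic_null\<close> expects.\<close>

lemma chart_frame:
  assumes M: "oriented_surface M A" and max: "maximal_surface A f" and harm: "harmonic_map A f (gauss_map A f)"
    and DA: "(D, p) \<in> A"
  obtains E1 E2 where "framed_patch (f \<circ> p) D E1 E2"
    "\<And>w. w \<in> D \<Longrightarrow> mink (framed_patch.\<alpha> (f \<circ> p) E1 E2 w) (framed_patch.\<alpha> (f \<circ> p) E1 E2 w) = 0"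
    "\<And>w. w \<in> D \<Longrightarrow> mink (framed_patch.\<beta> (f \<circ> p) E1 E2 w) (framed_patch.\<beta> (f \<circ> p) E1 E2 w) = 0"
    "\<And>w. w \<in> D \<Longrightarrow> mink (framed_patch.\<alpha> (f \<circ> p) E1 E2 w) (framed_patch.\<beta> (f \<circ> p) E1 E2 w) = 0"
proof -
  let ?X = "f \<circ> p"
  note D = chart_facts(1)[OF M DA]
  have imm: "spacelike_immersion A f" using max by (simp add: maximal_surface_def)
  have X: "smooth_on D ?X" and pos: "\<And>w a. w \<in> D \<Longrightarrow> a \<noteq> 0 \<Longrightarrow> induced_metric ?X w a a > 0"
    using bspec[OF imm[unfolded spacelike_immersion_def] DA] by auto
  obtain E1 E2 where fr: "orthonormal_frame_on ?X D E1 E2" "\<And>w. w \<in> D \<Longrightarrow> det (vector [E1 w, E2 w] :: real^2^2) > 0"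
    using orthonormal_frame_exists[OF D X pos] by blast
  note on = fr(1)[unfolded orthonormal_frame_on_def induced_metric_def]
  have mc: "mean_curvature ?X E1 E2 w = 0" if "w \<in> D" for w
    using max DA D fr(1) that unfolding maximal_surface_def by blast
  have lap: "laplacian ?X E1 E2 (gauss_map A f \<circ> p) w = 0" if "w \<in> D" for w
    using harm DA D fr(1) that unfolding harmonic_map_def by blast
  interpret framed_patch ?X D E1 E2
  proof
    show "\<exists>t. dd (\<lambda>z. dd ?X z (E1 z)) w (E1 w) + dd (\<lambda>z. dd ?X z (E2 z)) w (E2 w) = dd ?X w t" if "w \<in> D" for w
      using frame_sum_tangent[OF mc[OF that]] bounded_linear_dd[OF X D that] bounded_linear.linear by blast
  qed (use D X on in auto)
  define \<nu> where "\<nu> = (\<lambda>z. star (e1 z) (e2 z))"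
  have s\<nu>: "smooth_on D \<nu>" unfolding \<nu>_def by (rule smooth_on_bilinear[OF bounded_bilinear_star D smooth_e])
  have \<nu>: "(gauss_map A f \<circ> p) z = \<nu> z" if "z \<in> D" for z
    using gauss_map_chart[OF M imm DA that orthonormal(1)[OF that] orthonormal(2)[OF that] orthonormal(3)[OF that] fr(2)[OF that]]
    by (simp add: \<nu>_def e1_def e2_def)
  have d\<nu>: "dd (gauss_map A f \<circ> p) z = dd \<nu> z" if "z \<in> D" for z by (rule dd_cong[OF D that \<nu>])
  have dd\<nu>: "dd (\<lambda>z. dd (gauss_map A f \<circ> p) z (V z)) z = dd (\<lambda>z. dd \<nu> z (V z)) z" if "z \<in> D" for z V
    by (rule dd_cong[OF D that]) (simp add: d\<nu>)
  have N: "dd (\<lambda>z. wedge (e1 z) (e2 z)) z v = hodge (dd \<nu> z v)" if "z \<in> D" for z v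
    using dd_bounded_linear_comp[OF bounded_linear_hodge smooth_onD[OF s\<nu> D that]] by (simp add: \<nu>_def hodge_star)
  have NN: "dd (\<lambda>z. dd (\<lambda>z. wedge (e1 z) (e2 z)) z (V z)) w h = hodge (dd (\<lambda>z. dd \<nu> z (V z)) w h)"
    if w: "w \<in> D" and V: "smooth_on D V" for w V h
  proof -
    have "dd (\<lambda>z. dd (\<lambda>z. wedge (e1 z) (e2 z)) z (V z)) w = dd (\<lambda>z. hodge (dd \<nu> z (V z))) w"
      by (rule dd_cong[OF D w N])
    then show ?thesis
      using dd_bounded_linear_comp[OF bounded_linear_hodge smooth_onD[OF smooth_on_dd_field[OF s\<nu> D V] D w]] by simp
  qed
  have null: "mink (\<alpha> w) (\<alpha> w) = 0 \<and> mink (\<beta> w) (\<beta> w) = 0 \<and> mink (\<alpha> w) (\<beta> w) = 0" if w: "w \<in> D" for w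
  proof -
    have "linear (dd (gauss_map A f \<circ> p) w)"
      unfolding d\<nu>[OF w] using bounded_linear_dd[OF s\<nu> D w] bounded_linear.linear by blast
    then obtain t where "dd (\<lambda>z. dd \<nu> z (E1 z)) w (E1 w) + dd (\<lambda>z. dd \<nu> z (E2 z)) w (E2 w) = dd \<nu> w t"
      using laplacian_zero[OF lap[OF w]] unfolding dd\<nu>[OF w] d\<nu>[OF w] by blast
    then have "hodge (dd (\<lambda>z. dd \<nu> z (E1 z)) w (E1 w)) + hodge (dd (\<lambda>z. dd \<nu> z (E2 z)) w (E2 w)) = hodge (dd \<nu> w t)"
      using linear_add[OF bounded_linear.linear[OF bounded_linear_hodge]] by metis
    then show ?thesis
      using harmonic_null[OF w] unfolding NN[OF w E(1)] by (simp add: NN[OF w] N[OF w] on)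
  qed
  show ?thesis
    by (rule that[OF framed_patch_axioms]) (use null in auto)
qed

section \<open>Graphs over a degenerate hyperplane\<close>

text \<open>The isometry is the reflection in the vector \<open>l - l0\<close>, unless \<open>l = l0\<close>.\<close>

lemma null_vector_standard_form:
  assumes l: "mink l l = 0" "l$1 = 1"
  obtains L where "linear L" "\<And>v w. mink (L v) (L w) = mink v w" "L l = vector [1, 0, 0, 1]"
proof -
  define l0 :: "real^4" where "l0 = vector [1, 0, 0, 1]"
  have l0: "mink l0 l0 = 0" "l0$1 = 1" by (simp_all add: l0_def mink_def vector_4)
  define m where "m = mink l l0"
  have m': "mink l0 l = m" by (simp add: m_def mink_commute)
  show ?thesis
  proof (cases "m = 0")
    case True
    \<comment> \<open>Orthogonal null vectors are parallel, and both have time component 1.\<close>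
    then have "l = l0" using null_orthogonal_parallel[OF l(1) l0(1)] l(2) l0(2) by (simp add: m_def)
    then show ?thesis by (intro that[of "\<lambda>v. v"]) (auto simp: l0_def linear_iff)
  next
    case False
    define n where "n = l - l0"
    have nn: "mink n n = - 2 * m" using l l0 m' by (simp add: n_def m_def)
    \<comment> \<open>The usual reflection formula: -2 divided by the squared length -2m of n is
      1/m.\<close>
    define L where "L = (\<lambda>v. v + (mink v n / m) *\<^sub>R n)"
    have "linear L" by (auto intro!: linearI simp: L_def add_divide_distrib algebra_simps)
    moreover have "mink (L v) (L w) = mink v w" for v w
    proof -
      have "mink (L v) (L w) = mink v w + (mink w n / m) * mink v n + (mink v n / m) * mink n w
          + (mink v n / m) * ((mink w n / m) * (- 2 * m))"
        by (simp add: L_def nn algebra_simps)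
      also have "\<dots> = mink v w" using False by (simp add: mink_commute[of n w] field_simps)
      finally show ?thesis .
    qed
    moreover have "L l = l0"
    proof -
      have "mink l n = - m" using l by (simp add: n_def m_def)
      then show ?thesis using False by (simp add: L_def n_def)
    qed
    ultimately show ?thesis by (intro that[of L]) (auto simp: l0_def)
  qed
qed

text \<open>Equal first and fourth components cancel in the metric, so the projection \<psi> to the
  second and third is a local isometry to the Euclidean plane. Its local inverse makes the patch a
  graph, and maximality becomes the Laplace equation for the height.\<close>

lemma graph_chart:
  fixes Y :: "real^2 \<Rightarrow> real^4"
  assumes D: "open D" "w \<in> D" and Y: "smooth_on D Y"
    and pos: "\<And>z a. z \<in> D \<Longrightarrow> a \<noteq> 0 \<Longrightarrow> mink (dd Y z a) (dd Y z a) > 0"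
    and deg: "\<And>z. z \<in> D \<Longrightarrow> Y z $ 1 = Y z $ 4"
    and max: "\<And>U E1 E2 z. open U \<Longrightarrow> U \<subseteq> D \<Longrightarrow> orthonormal_frame_on Y U E1 E2 \<Longrightarrow> z \<in> U \<Longrightarrow>
       \<exists>t. dd (\<lambda>z. dd Y z (E1 z)) z (E1 z) + dd (\<lambda>z. dd Y z (E2 z)) z (E2 z) = dd Y z t"
  obtains N \<Omega> \<phi> where "open N" "w \<in> N" "N \<subseteq> D" "open \<Omega>" "smooth_on \<Omega> \<phi>" "harmonic_function_on \<Omega> \<phi>"
    "bij_betw Y N (graph_surface \<phi> ` \<Omega>)"
proof -
  define \<psi> :: "real^2 \<Rightarrow> real^2" where "\<psi> = (\<lambda>z. (Y z $ 2) *\<^sub>R axis 1 1 + (Y z $ 3) *\<^sub>R axis 2 1)"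
  have \<psi>c: "\<psi> z $ 1 = Y z $ 2" "\<psi> z $ 2 = Y z $ 3" for z by (simp_all add: \<psi>_def axis_def)
  have s\<psi>: "smooth_on D \<psi>"
    unfolding \<psi>_def by (intro smooth_on_add smooth_on_scaleR smooth_on_const smooth_on_vec_nth Y D)
  have dYn: "((\<lambda>z. Y z $ i) has_derivative (\<lambda>h. dd Y z h $ i)) (at z)" if "z \<in> D" for z i
    by (rule bounded_linear.has_derivative[OF bounded_linear_vec_nth smooth_onD[OF Y D(1) that]])
  have dY14: "dd Y z h $ 1 = dd Y z h $ 4" if z: "z \<in> D" for z h
  proof -
    have "dd (\<lambda>z. Y z $ 1) z = dd (\<lambda>z. Y z $ 4) z" by (rule dd_cong[OF D(1) z deg])
    then show ?thesis unfolding dd_eqI[OF dYn[OF z]] by metis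
  qed
  have d\<psi>: "dd \<psi> z h = (dd Y z h $ 2) *\<^sub>R axis 1 1 + (dd Y z h $ 3) *\<^sub>R axis 2 1" if z: "z \<in> D" for z h
  proof -
    have "dd \<psi> z = (\<lambda>h. (dd Y z h $ 2) *\<^sub>R axis 1 1 + (dd Y z h $ 3) *\<^sub>R axis 2 1)"
      unfolding \<psi>_def by (intro dd_eqI has_derivative_add has_derivative_scaleR_left dYn z)
    then show ?thesis by simp
  qed
  have d\<psi>c: "dd \<psi> z h $ 1 = dd Y z h $ 2" "dd \<psi> z h $ 2 = dd Y z h $ 3" if "z \<in> D" for z h
    unfolding d\<psi>[OF that] by (simp_all add: axis_def)
  have iso: "mink (dd Y z a) (dd Y z b) = dd \<psi> z a $ 1 * dd \<psi> z b $ 1 + dd \<psi> z a $ 2 * dd \<psi> z b $ 2" if "z \<in> D" for z a b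
    unfolding mink_def d\<psi>c[OF that] dY14[OF that] by simp
  have lin: "linear (dd \<psi> z)" if "z \<in> D" for z using bounded_linear_dd[OF s\<psi> D(1) that] bounded_linear.linear by blast
  have inj: "h = 0" if "z \<in> D" "dd \<psi> z h = 0" for z h
    using pos[OF that(1), of h] iso[OF that(1), of h h] that(2) by force
  obtain N e g where N: "open N" "N \<subseteq> D" "w \<in> N" "e > 0" "homeomorphism N (ball (\<psi> w) e) \<psi> g"
    "\<And>y. y \<in> ball (\<psi> w) e \<Longrightarrow> (g has_derivative inv (dd \<psi> (g y))) (at y)"
    "\<And>y. y \<in> N \<Longrightarrow> bij (dd \<psi> y)"
    using local_diffeo[OF D s\<psi> inj[OF D(2)]] by blast
  let ?\<Omega> = "ball (\<psi> w) e"
  have gN: "g y \<in> N" "\<psi> (g y) = y" if "y \<in> ?\<Omega>" for y using N(5) that unfolding homeomorphism_def by auto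
  have g\<psi>: "g (\<psi> z) = z" "\<psi> z \<in> ?\<Omega>" if "z \<in> N" for z using N(5) that unfolding homeomorphism_def by auto
  define a where "a = (\<lambda>z i j. dd \<psi> z (axis j 1) $ i)"
  define \<delta> where "\<delta> = (\<lambda>z. a z 1 1 * a z 2 2 - a z 1 2 * a z 2 1)"
  \<comment> \<open>Cramer's rule: \<open>C h z\<close> is the inverse of \<open>dd \<psi> z\<close>
    applied to h, visibly smooth in z. Thus the derivative of g is a smooth expression in g itself,
    the form needed by \<open>smooth_on_inverse_map\<close>.\<close>
  define C where "C = (\<lambda>(h::real^2) z. ((a z 2 2 * h$1 - a z 1 2 * h$2) / \<delta> z) *\<^sub>R (axis 1 1 :: real^2)
      + ((a z 1 1 * h$2 - a z 2 1 * h$1) / \<delta> z) *\<^sub>R axis 2 1)"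
  have d\<psi>_matrix: "dd \<psi> z h $ i = a z i 1 * h $ 1 + a z i 2 * h $ 2" if "z \<in> D" for z h i
  proof -
    have "h = h$1 *\<^sub>R axis 1 1 + h$2 *\<^sub>R axis 2 1" by (simp add: vec_eq_iff forall_2 axis_def)
    then have "dd \<psi> z h = h$1 *\<^sub>R dd \<psi> z (axis 1 1) + h$2 *\<^sub>R dd \<psi> z (axis 2 1)"
      by (metis linear_add[OF lin[OF that]] linear_scale[OF lin[OF that]])
    then show ?thesis by (simp add: a_def)
  qed
  have \<delta>: "\<delta> z \<noteq> 0" if z: "z \<in> D" for z
  proof
    assume 0: "\<delta> z = 0"
    have "dd \<psi> z (vector [a z 2 2, - a z 2 1]) = 0" "dd \<psi> z (vector [- a z 1 2, a z 1 1]) = 0"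
      using 0 by (simp_all add: vec_eq_iff forall_2 d\<psi>_matrix[OF z] \<delta>_def algebra_simps)
    then have "vector [a z 2 2, - a z 2 1] = (0::real^2)" "vector [- a z 1 2, a z 1 1] = (0::real^2)"
      using inj[OF z] by blast+
    then have "a z 2 2 = 0" "a z 2 1 = 0" "a z 1 2 = 0" "a z 1 1 = 0" by (simp_all add: vec_eq_iff forall_2)
    then have "dd \<psi> z (axis 1 1) = 0" by (simp add: vec_eq_iff forall_2 a_def)
    then have "(axis 1 1 :: real^2) = 0" using inj[OF z] by blast
    then show False by (simp add: axis_eq_0_iff)
  qed
  have \<psi>C: "dd \<psi> z (C h z) = h" if z: "z \<in> D" for z h
    using \<delta>[OF z] by (simp add: vec_eq_iff forall_2 d\<psi>_matrix[OF z] C_def axis_def field_simps)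
      (simp add: \<delta>_def algebra_simps)
  have smC: "smooth_on D (C h)" for h
    unfolding C_def \<delta>_def a_def
    by (intro smooth_on_add smooth_on_scaleR smooth_on_const smooth_on_divide smooth_on_diff smooth_on_mult
        smooth_on_vec_nth smooth_on_dd s\<psi> D) (use \<delta> in \<open>auto simp: \<delta>_def a_def\<close>)
  have smCN: "smooth_on N (C h)" for h by (rule smooth_on_subset[OF smC N(2)])
  have dg: "(g has_derivative (\<lambda>h. C h (g y))) (at y)" if y: "y \<in> ?\<Omega>" for y
  proof -
    have gD: "g y \<in> D" using gN(1)[OF y] N(2) by blast
    have "inv (dd \<psi> (g y)) h = C h (g y)" for h
      using \<psi>C[OF gD, of h] bij_inv_eq_iff[OF N(7)[OF gN(1)[OF y]]] by metis
    then have "inv (dd \<psi> (g y)) = (\<lambda>h. C h (g y))" by blast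
    then show ?thesis using N(6)[OF y] by simp
  qed
  define u where "u = (\<lambda>z. Y z $ 4)"
  have su: "smooth_on D u" unfolding u_def by (rule smooth_on_vec_nth[OF D(1) Y])
  define \<phi> where "\<phi> = (\<lambda>y. u (g y))"
  have s\<phi>: "smooth_on ?\<Omega> \<phi>"
    unfolding \<phi>_def
    by (rule smooth_on_inverse_map[OF N(1) open_ball smooth_on_subset[OF su N(2)] gN(1) dg smCN])
  have chain: "dd (\<lambda>y. v (g y)) y h = dd v (g y) (C h (g y))" if "y \<in> ?\<Omega>" "smooth_on D v" for v :: "real^2 \<Rightarrow> real" and y h
  proof -
    have "g y \<in> D" using gN(1)[OF that(1)] N(2) by blast
    from has_derivative_compose[OF dg[OF that(1)] smooth_onD[OF that(2) D(1) this]]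
    show ?thesis by (simp add: dd_eqI)
  qed
  have dd\<phi>: "dd (\<lambda>y. dd \<phi> y h) y h = dd (\<lambda>z. dd u z (C h z)) (g y) (C h (g y))" if y: "y \<in> ?\<Omega>" for y h
  proof -
    have "dd (\<lambda>y. dd \<phi> y h) y = dd (\<lambda>y. dd u (g y) (C h (g y))) y"
      by (rule dd_cong[OF open_ball y]) (simp add: \<phi>_def chain[OF _ su])
    then show ?thesis using chain[OF y smooth_on_dd_field[OF su D(1) smC]] by simp
  qed
  let ?C1 = "C (axis 1 1)" and ?C2 = "C (axis 2 1)"
  \<comment> \<open>The coordinate fields of the isometry \<psi>, orthonormal because \<psi> maps
    them to the standard basis.\<close>
  have frame: "orthonormal_frame_on Y N ?C1 ?C2"
    unfolding orthonormal_frame_on_def induced_metric_def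
    using N(2) smCN by (auto simp: iso \<psi>C subset_iff axis_def)
  have "harmonic_function_on ?\<Omega> \<phi>"
    unfolding harmonic_function_on_def
  proof
    fix y assume y: "y \<in> ?\<Omega>"
    define z where "z = g y"
    have zN: "z \<in> N" and zD: "z \<in> D" using gN(1)[OF y] N(2) by (auto simp: z_def)
    obtain t where t: "dd (\<lambda>z. dd Y z (?C1 z)) z (?C1 z) + dd (\<lambda>z. dd Y z (?C2 z)) z (?C2 z) = dd Y z t"
      using max[OF N(1,2) frame zN] by blast
    have comp: "dd (\<lambda>z. dd Y z (C h z)) z k $ i = dd (\<lambda>z. dd Y z (C h z) $ i) z k" for h k i
      using dd_bounded_linear_comp[OF bounded_linear_vec_nth smooth_onD[OF smooth_on_dd_field[OF Y D(1) smC] D(1) zD]] by simp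
    \<comment> \<open>Along these fields the second and third components of dY are constant. Hence
      the vector t of the maximality condition projects to zero and vanishes, and the fourth
      component becomes the Laplace equation for \<phi>.\<close>
    have const: "dd (\<lambda>z. dd Y z (C h z) $ 2) z = (\<lambda>k. 0)" "dd (\<lambda>z. dd Y z (C h z) $ 3) z = (\<lambda>k. 0)" for h
    proof -
      have "dd (\<lambda>z. dd Y z (C h z) $ 2) z = dd (\<lambda>z. h $ 1) z" "dd (\<lambda>z. dd Y z (C h z) $ 3) z = dd (\<lambda>z. h $ 2) z"
        using d\<psi>c \<psi>C by (intro dd_cong[OF D(1) zD]; metis)+
      then show "dd (\<lambda>z. dd Y z (C h z) $ 2) z = (\<lambda>k. 0)" "dd (\<lambda>z. dd Y z (C h z) $ 3) z = (\<lambda>k. 0)"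
        by (simp_all add: dd_const)
    qed
    have ti: "dd (\<lambda>z. dd Y z (?C1 z) $ i) z (?C1 z) + dd (\<lambda>z. dd Y z (?C2 z) $ i) z (?C2 z) = dd Y z t $ i" for i
      using arg_cong[OF t, of "\<lambda>v. v $ i"] by (simp add: comp)
    have "dd Y z t $ 2 = 0" "dd Y z t $ 3 = 0" using ti[of 2] ti[of 3] by (simp_all add: const)
    then have "dd \<psi> z t = 0" using d\<psi>[OF zD, of t] by simp
    then have "t = 0" by (rule inj[OF zD])
    then have t4: "dd Y z t $ 4 = 0" using linear_0[OF bounded_linear.linear[OF bounded_linear_dd[OF Y D(1) zD]]] by simp
    have du: "dd (\<lambda>z. dd u z (C h z)) z = dd (\<lambda>z. dd Y z (C h z) $ 4) z" for h
      by (rule dd_cong[OF D(1) zD]) (simp add: u_def dd_eqI[OF dYn])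
    show "dd (\<lambda>z. dd \<phi> z (axis 1 1)) y (axis 1 1) + dd (\<lambda>z. dd \<phi> z (axis 2 1)) y (axis 2 1) = 0"
      unfolding dd\<phi>[OF y] z_def[symmetric] du using ti[of 4] t4 by simp
  qed
  moreover have "bij_betw Y N (graph_surface \<phi> ` ?\<Omega>)"
  proof -
    have graph: "Y z = graph_surface \<phi> (\<psi> z)" if "z \<in> N" for z
    proof -
      have "graph_surface \<phi> (\<psi> z) = vector [Y z $ 4, Y z $ 2, Y z $ 3, Y z $ 4]"
        by (simp add: graph_surface_def \<phi>_def u_def g\<psi>(1)[OF that] \<psi>c)
      also have "\<dots> = Y z"
        using deg[of z] that N(2) by (auto simp: vec_eq_iff forall_4 vector_4)
      finally show ?thesis by simp
    qed
    have "inj_on Y N"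
    proof (rule inj_onI)
      fix z z' assume zz: "z \<in> N" "z' \<in> N" "Y z = Y z'"
      then have "\<psi> z = \<psi> z'" by (simp add: \<psi>_def)
      then show "z = z'" using g\<psi>(1)[OF zz(1)] g\<psi>(1)[OF zz(2)] by metis
    qed
    moreover have "Y ` N = graph_surface \<phi> ` ?\<Omega>"
    proof -
      have "\<psi> ` N = ?\<Omega>" using N(5) unfolding homeomorphism_def by blast
      then have "graph_surface \<phi> ` ?\<Omega> = (\<lambda>z. graph_surface \<phi> (\<psi> z)) ` N" by (metis image_image)
      then show ?thesis using graph by auto
    qed
    ultimately show ?thesis by (simp add: bij_betw_def)
  qed
  ultimately show ?thesis using that[OF N(1,3,2) open_ball s\<phi>] by blast
qed

section \<open>From charts to the whole surface\<close>

lemma linear_image_patch: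
  fixes X :: "real^2 \<Rightarrow> real^4" and b :: "real^4"
  assumes L: "linear L" "\<And>v w. mink (L v) (L w) = mink v w" and D: "open D" and X: "smooth_on D X"
  defines "Y \<equiv> \<lambda>z. L (X z) + b"
  shows "smooth_on D Y" "\<And>z h. z \<in> D \<Longrightarrow> dd Y z h = L (dd X z h)"
    "\<And>z h V. z \<in> D \<Longrightarrow> smooth_on D V \<Longrightarrow> dd (\<lambda>z. dd Y z (V z)) z h = L (dd (\<lambda>z. dd X z (V z)) z h)"
proof -
  have bL: "bounded_linear L" using L(1) linear_conv_bounded_linear by blast
  show "smooth_on D Y"
    unfolding Y_def by (intro smooth_on_add smooth_on_bounded_linear[OF bL] smooth_on_const D X)
  show dY: "dd Y z h = L (dd X z h)" if "z \<in> D" for z h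
  proof -
    have "(Y has_derivative (\<lambda>h. L (dd X z h) + 0)) (at z)"
      unfolding Y_def
      by (intro has_derivative_add bounded_linear.has_derivative[OF bL] smooth_onD[OF X D that] has_derivative_const)
    then show ?thesis by (simp add: dd_eqI)
  qed
  show "dd (\<lambda>z. dd Y z (V z)) z h = L (dd (\<lambda>z. dd X z (V z)) z h)" if z: "z \<in> D" and V: "smooth_on D V" for z h V
  proof -
    have "dd (\<lambda>z. dd Y z (V z)) z = dd (\<lambda>z. L (dd X z (V z))) z"
      by (rule dd_cong[OF D z dY])
    then show ?thesis
      using dd_bounded_linear_comp[OF bL smooth_onD[OF smooth_on_dd_field[OF X D V] D z]] by simp
  qed
qed

text \<open>An open-closed argument on the connected surface, started by the ball found in one
  chart.\<close>

lemma height_constant: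
  assumes M: "oriented_surface M A" "connected_space M" and max: "maximal_surface A f"
    and harm: "harmonic_map A f (gauss_map A f)" and ne: "topspace M \<noteq> {}"
  obtains l \<kappa> where "l \<noteq> 0" "mink l l = 0" "\<And>q. q \<in> topspace M \<Longrightarrow> mink (f q) l = \<kappa>"
proof -
  note ch = chart_facts[OF M(1)]
  have cover: "\<exists>D p w. (D, p) \<in> A \<and> w \<in> D \<and> p w = q" if "q \<in> topspace M" for q
  proof -
    have "q \<in> (\<Union>(D, p)\<in>A. p ` D)" using M(1) that unfolding oriented_surface_def by blast
    then show ?thesis by auto
  qed
  obtain q0 where "q0 \<in> topspace M" using ne by blast
  then obtain D0 p0 w0 where 0: "(D0, p0) \<in> A" "w0 \<in> D0" using cover by blast
  obtain E1 E2 where fp: "framed_patch (f \<circ> p0) D0 E1 E2"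
    "\<And>w. w \<in> D0 \<Longrightarrow> mink (framed_patch.\<alpha> (f \<circ> p0) E1 E2 w) (framed_patch.\<alpha> (f \<circ> p0) E1 E2 w) = 0"
    "\<And>w. w \<in> D0 \<Longrightarrow> mink (framed_patch.\<beta> (f \<circ> p0) E1 E2 w) (framed_patch.\<beta> (f \<circ> p0) E1 E2 w) = 0"
    "\<And>w. w \<in> D0 \<Longrightarrow> mink (framed_patch.\<alpha> (f \<circ> p0) E1 E2 w) (framed_patch.\<beta> (f \<circ> p0) E1 E2 w) = 0"
    using chart_frame[OF M(1) max harm 0(1)] by blast
  obtain l r x \<kappa> where l: "r > 0" "ball x r \<subseteq> D0" "l \<noteq> 0" "mink l l = 0"
    "\<And>z. z \<in> ball x r \<Longrightarrow> mink ((f \<circ> p0) z) l = \<kappa>"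
    by (rule framed_patch.null_direction[OF fp(1) 0(2) fp(2) fp(3) fp(4)]) (assumption | rule that)+
  \<comment> \<open>The interior of the level set rather than the level set itself, since unique
    continuation starts from an open set.\<close>
  define S where "S = {q. \<exists>U. openin M U \<and> q \<in> U \<and> (\<forall>q'\<in>U. mink (f q') l = \<kappa>)}"
  have "openin M S"
  proof -
    have "S = \<Union>{U. openin M U \<and> (\<forall>q'\<in>U. mink (f q') l = \<kappa>)}" by (auto simp: S_def)
    then show ?thesis by auto
  qed
  moreover have "p0 x \<in> S"
  proof -
    have "openin M (p0 ` ball x r)" by (rule ch(5)[OF 0(1) open_ball l(2)])
    moreover have "p0 x \<in> p0 ` ball x r" using l(1) by simp
    ultimately show ?thesis using l(5) unfolding S_def by auto
  qed
  moreover have "openin M (topspace M - S)"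
  proof (subst openin_subopen, intro ballI)
    fix q assume q: "q \<in> topspace M - S"
    then obtain D p w where DA: "(D, p) \<in> A" and w: "w \<in> D" "p w = q" using cover by blast
    obtain E1 E2 where fp: "framed_patch (f \<circ> p) D E1 E2"
      by (rule chart_frame[OF M(1) max harm DA]) (rule that)
    obtain N where N: "open N" "w \<in> N" "N \<subseteq> D" and uc: "\<forall>c \<kappa> N0. open N0 \<longrightarrow> N0 \<noteq> {} \<longrightarrow> N0 \<subseteq> N \<longrightarrow>
        (\<forall>z\<in>N0. mink ((f \<circ> p) z) c = \<kappa>) \<longrightarrow> (\<forall>z\<in>N. mink ((f \<circ> p) z) c = \<kappa>)"
      using framed_patch.unique_continuation_coordinates[OF fp w(1)] by blast
    have oN: "openin M (p ` N)" by (rule ch(5)[OF DA N(1,3)])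
    \<comment> \<open>If the neighbourhood met S, the height would be constant on an open part of
      it, hence on all of it, and q would lie in S.\<close>
    have "p ` N \<inter> S = {}"
    proof (rule ccontr)
      assume "p ` N \<inter> S \<noteq> {}"
      then obtain z where z: "z \<in> N" "p z \<in> S" by blast
      then obtain U where U: "openin M U" "p z \<in> U" "\<And>q'. q' \<in> U \<Longrightarrow> mink (f q') l = \<kappa>"
        unfolding S_def by blast
      have "\<forall>z\<in>N. mink ((f \<circ> p) z) l = \<kappa>"
      proof (intro uc[THEN spec, THEN spec, THEN spec, THEN mp, THEN mp, THEN mp, THEN mp])
        show "open (N \<inter> {w \<in> D. p w \<in> U})" by (rule open_Int[OF N(1) ch(7)[OF DA U(1)]])
        show "N \<inter> {w \<in> D. p w \<in> U} \<noteq> {}" using z U(2) N(3) by blast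
      qed (use U(3) in auto)
      then have "q \<in> S" using oN N(2) w(2) unfolding S_def by auto
      then show False using q by simp
    qed
    moreover have "q \<in> p ` N" using N(2) w(2) by blast
    ultimately show "\<exists>T. openin M T \<and> q \<in> T \<and> T \<subseteq> topspace M - S"
      using oN openin_subset[OF oN] by blast
  qed
  ultimately have "S = topspace M"
    using M(2) openin_subset[of M S] unfolding connected_space_clopen_in closedin_def by blast
  then show ?thesis
    by (intro that[OF l(3,4), of \<kappa>]) (auto simp: S_def)
qed

theorem theorem3p8:
  fixes M :: "'m topology" and A :: "'m atlas" and f :: "'m \<Rightarrow> real^4"
  assumes "oriented_surface M A" and "connected_space M"
    and "maximal_surface A f"
    and "harmonic_map A f (gauss_map A f)"
  shows "(\<exists>P. spacelike_plane P \<and> openin (top_of_set P) (f ` topspace M)) \<or>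
    (\<exists>F. minkowski_isometry F \<and>
      (\<forall>q\<in>topspace M. \<exists>W. openin M W \<and> q \<in> W \<and>
        (\<exists>\<Omega> \<phi>. open \<Omega> \<and> smooth_on \<Omega> \<phi> \<and> harmonic_function_on \<Omega> \<phi> \<and>
          bij_betw (F \<circ> f) W (graph_surface \<phi> ` \<Omega>))))"
proof (cases "topspace M = {}")
  case True
  have "minkowski_isometry (\<lambda>x. x)"
    unfolding minkowski_isometry_def by (intro exI[of _ "\<lambda>x. x"] exI[of _ 0]) (simp add: linear_iff)
  then show ?thesis using True by auto
next
  case False
  obtain l' \<kappa>' where l': "l' \<noteq> 0" "mink l' l' = 0" "\<And>q. q \<in> topspace M \<Longrightarrow> mink (f q) l' = \<kappa>'"
    using height_constant[OF assms False] by blast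
  have l'1: "l' $ 1 \<noteq> 0" by (rule null_time_component_nonzero[OF l'(2,1)])
  \<comment> \<open>Scaled to time component 1, as the standard form requires.\<close>
  define l where "l = (1 / l' $ 1) *\<^sub>R l'"
  define \<kappa> where "\<kappa> = \<kappa>' / l' $ 1"
  have l: "mink l l = 0" "l $ 1 = 1" "\<And>q. q \<in> topspace M \<Longrightarrow> mink (f q) l = \<kappa>"
    using l' l'1 by (simp_all add: l_def \<kappa>_def)
  obtain L where L: "linear L" "\<And>v w. mink (L v) (L w) = mink v w" "L l = vector [1, 0, 0, 1]"
    using null_vector_standard_form[OF l(1,2)] by blast
  \<comment> \<open>After L the constant height says x4 - x1 = \<kappa>, so adding \<kappa> to the
    first coordinate makes it equal to the fourth.\<close>
  define b :: "real^4" where "b = vector [\<kappa>, 0, 0, 0]"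
  define F where "F = (\<lambda>x. L x + b)"
  have "minkowski_isometry F"
    unfolding minkowski_isometry_def F_def using L(1,2) by blast
  moreover have "\<exists>W. openin M W \<and> q \<in> W \<and> (\<exists>\<Omega> \<phi>. open \<Omega> \<and> smooth_on \<Omega> \<phi> \<and> harmonic_function_on \<Omega> \<phi> \<and>
      bij_betw (F \<circ> f) W (graph_surface \<phi> ` \<Omega>))" if q: "q \<in> topspace M" for q
  proof -
    have "q \<in> (\<Union>(D, p)\<in>A. p ` D)" using assms(1) q unfolding oriented_surface_def by blast
    then obtain D p w where DA: "(D, p) \<in> A" and w: "w \<in> D" "p w = q" by auto
    note ch = chart_facts[OF assms(1) DA]
    define X where "X = f \<circ> p"
    define Y where "Y = (\<lambda>z. L (X z) + b)"
    have imm: "spacelike_immersion A f" using assms(3) by (simp add: maximal_surface_def)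
    have X: "smooth_on D X" and pos: "\<And>w a. w \<in> D \<Longrightarrow> a \<noteq> 0 \<Longrightarrow> induced_metric X w a a > 0"
      using bspec[OF imm[unfolded spacelike_immersion_def] DA] by (auto simp: X_def)
    note Y = linear_image_patch[OF L(1,2) ch(1) X, where b = b, folded Y_def]
    obtain N \<Omega> \<phi> where N: "open N" "w \<in> N" "N \<subseteq> D" "open \<Omega>" "smooth_on \<Omega> \<phi>" "harmonic_function_on \<Omega> \<phi>"
      "bij_betw Y N (graph_surface \<phi> ` \<Omega>)"
    proof (rule graph_chart[OF ch(1) w(1) Y(1)])
      show "mink (dd Y z a) (dd Y z a) > 0" if "z \<in> D" "a \<noteq> 0" for z a
        using pos[OF that] by (simp add: Y(2)[OF that(1)] L(2) induced_metric_def)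
      show "Y z $ 1 = Y z $ 4" if z: "z \<in> D" for z
      proof -
        have "p z \<in> topspace M" using ch(6) z by blast
        then have "mink (L (X z)) (L l) = \<kappa>" using l(3) L(2) by (simp add: X_def)
        then show ?thesis by (simp add: Y_def L(3) mink_def vector_4 b_def)
      qed
      show "\<exists>t. dd (\<lambda>z. dd Y z (E1 z)) z (E1 z) + dd (\<lambda>z. dd Y z (E2 z)) z (E2 z) = dd Y z t"
        if U: "open U" "U \<subseteq> D" and fr: "orthonormal_frame_on Y U E1 E2" and z: "z \<in> U" for U E1 E2 z
      proof -
        have zD: "z \<in> D" using U z by blast
        note YU = linear_image_patch[OF L(1,2) U(1) smooth_on_subset[OF X U(2)], where b = b, folded Y_def]
        have frX: "orthonormal_frame_on X U E1 E2"
          using fr unfolding orthonormal_frame_on_def induced_metric_def by (auto simp: YU(2) L(2))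
        have "mean_curvature X E1 E2 z = 0"
          using bspec[OF conjunct2[OF assms(3)[unfolded maximal_surface_def]] DA] U frX z unfolding X_def by blast
        then obtain t where t: "dd (\<lambda>z. dd X z (E1 z)) z (E1 z) + dd (\<lambda>z. dd X z (E2 z)) z (E2 z) = dd X z t"
          using frame_sum_tangent bounded_linear_dd[OF X ch(1) zD] bounded_linear.linear by blast
        have "smooth_on U E1" "smooth_on U E2" using fr by (auto simp: orthonormal_frame_on_def)
        then show ?thesis
          using t by (intro exI[of _ t]) (simp add: YU(2,3)[OF z] flip: linear_add[OF L(1)])
      qed
    qed blast
    have "bij_betw (F \<circ> f) (p ` N) (graph_surface \<phi> ` \<Omega>)"
    proof -
      have "bij_betw p N (p ` N)" using ch(3) N(3) by (simp add: bij_betw_def inj_on_subset)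
      moreover have "bij_betw ((F \<circ> f) \<circ> p) N (graph_surface \<phi> ` \<Omega>)"
        using N(7) by (simp add: F_def Y_def X_def o_def)
      ultimately show ?thesis using bij_betw_comp_iff by blast
    qed
    moreover have "openin M (p ` N)" by (rule ch(5)[OF N(1,3)])
    moreover have "q \<in> p ` N" using N(2) w(2) by blast
    ultimately show ?thesis using N(4-6) by blast
  qed
  ultimately show ?thesis by blast
qed

end
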